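(* Let $\pi_n$, with $\frac{d\pi_n}{d\tilde\pi_n}(x)=\exp\{-\phi_n(x)\}$, $\tilde{\pi}_n(x)=\prod_{i=1}^n \lambda_i^{-1} f(x_i/\lambda_i)$, $\lambda_i=i^{-\kappa}$, $\kappa\ge 0$, be the target distribution for RWM and SLA. Assume that $\sigma_n^2=l^2n^{-\rho}$ for constants $l,\rho>0$. Suppose that: (A) there exists $M\in\mathbb{R}$ such that, for all sufficiently large $n$, $\phi_n(x)\ge M$ for all $x\in\mathbb{R}^n$; (B) there exist a locally bounded function $\delta:\mathbb{R}^+\times\mathbb{R}^+\to\mathbb{R}^+$ and constants $C>0$, $p>0$ and $s,s',s''$, all three strictly smaller than $\kappa-1/2$, such that, for all sufficiently large $n$ and all $x,y\in\mathbb{R}^n$, $$|\phi_n(y)-\phi_n(x)|\le\delta(|x|_s,|y|_s)\,|y-x|_{s'},\qquad |\phi_n(x)|\le C(1+|x|_{s''}^p).$$ Fix an index $i^*\ge1$ and, for $n\ge i^*$, let $S_n:=E[(x'_{i^*}-x_{i^*})^2]$, where $x\sim\pi_n$ and $x'$ is the state of the chain after one step from $x$. Let $I=1$ for RWM and $I=1/3$ for SLA. Then, for each of the two algorithms with its own $I$, as $n\to\infty$: (i) if $\rho=2\kappa+I$, then $S_n=l^2a(l)\,n^{-2\kappa-I}+o(n^{-2\kappa-I})$, where $a(l)=2\Phi\big(-\frac{l}{2}\sqrt{K^{\mathrm{RWM}}/(1+2\kappa)}\big)$ for RWM and $a(l)=2\Phi\big(-\frac{l^3}{2}\sqrt{K^{\mathrm{SLA}}/(1+6\kappa)}\big)$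 for SLA; (ii) if $\rho>2\kappa+I$, then $S_n=l^2n^{-\rho}+o(n^{-\rho})$; (iii) if $2\kappa<\rho<2\kappa+I$, then $S_n=\mathcal{O}(n^{-p})$ for any $p\ge 0$.
   Context: $\mathbb{R}^+=[0,\infty)$; for $s\in\mathbb{R}$ and $x\in\mathbb{R}^n$, $|x|_s=\big(\sum_{i=1}^n i^{2s}x_i^2\big)^{1/2}$. "Locally bounded" means bounded on bounded sets. $\Phi$ is the CDF of $\mathcal{N}(0,1)$. Density $f$. $f=\exp\{-g\}$ is a probability density on $\mathbb{R}$, where $g:\mathbb{R}\to\mathbb{R}$ is infinitely differentiable, $g$ and each of its derivatives are bounded in absolute value by a polynomial, and all moments of $f$ are finite. With $E_f$ denoting expectation for $X$ with density $f$, $K^{\mathrm{RWM}}=E_f[(g'(X))^2]$ and $K^{\mathrm{SLA}}=\tfrac{1}{48}E_f[3g''(X)^3+5(g^{(3)}(X))^2]$. Target. For each $n$, $\phi_n:\mathbb{R}^n\to\mathbb{R}$ is Borel measurable and $\pi_n$ is the probability measure with density $\exp\{-\phi_n\}$ with respect to $\tilde\pi_n$; $\pi_n(x)$ also denotes its Lebesgue density. Algorithms. A Metropolis–Hastings step from $x\in\mathbb{R}^n$ draws a proposal $y$ from a transition density $q_n(x,\cdot)$ and moves to $x'=y$ with probability $a_n(x,y)$, otherwise $x'=x$, where $a_n(x,y)=1\wedge\frac{\pi_n(y)q_n(y,x)}{\pi_n(x)q_n(x,y)}$ if $\pi_n(x)q_n(x,y)>0$ and $a_n(x,y)=0$ otherwise.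 With $Z\sim\mathcal{N}(0,I_n)$ independent of $x$ and step-size $\sigma_n>0$, the proposals are RWM: $y=x+\sigma_n Z$; SLA: $y=x+\frac{\sigma_n^2}{2}\nabla\log\tilde\pi_n(x)+\sigma_n Z$, i.e. $y_i=x_i-\frac{\sigma_n^2}{2\lambda_i}g'(x_i/\lambda_i)+\sigma_nZ_i$ (the gradient uses $\tilde\pi_n$, the acceptance probability uses $\pi_n$). *)

theory Defs
  imports
    "HOL-Probability.Probability"
    "HOL-Computational_Algebra.Polynomial"
    "HOL-Library.Landau_Symbols"
begin

section \<open>Euclidean spaces of varying dimension\<close>

text \<open>
  As the dimension \<open>n\<close> tends to infinity, \<open>\<real>\<^sup>n\<close> is represented by the extensional functions on
  the index set \<open>{1..n}\<close>, i.e. by the space of the following product measure.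
\<close>

abbreviation lborel_n :: "nat \<Rightarrow> (nat \<Rightarrow> real) measure" where
  "lborel_n n \<equiv> PiM {1..n} (\<lambda>_. lborel)"

abbreviation Rn :: "nat \<Rightarrow> (nat \<Rightarrow> real) set" where
  "Rn n \<equiv> {1..n} \<rightarrow>\<^sub>E (UNIV :: real set)"

lemma space_lborel_n: "space (lborel_n n) = Rn n"
  by (simp add: space_PiM)

definition snorm :: "nat \<Rightarrow> real \<Rightarrow> (nat \<Rightarrow> real) \<Rightarrow> real" where
  "snorm n s x = sqrt (\<Sum>i=1..n. real i powr (2 * s) * (x i)\<^sup>2)"

definition locally_bounded_on :: "'a::metric_space set \<Rightarrow> ('a \<Rightarrow> 'b::metric_space) \<Rightarrow> bool" where
  "locally_bounded_on D h \<longleftrightarrow> (\<forall>B\<subseteq>D. bounded B \<longrightarrow> bounded (h ` B))"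


section \<open>Reference and target distributions\<close>

definition lam :: "real \<Rightarrow> nat \<Rightarrow> real" where
  "lam \<kappa> i = real i powr (-\<kappa>)"

definition ref_dens :: "(real \<Rightarrow> real) \<Rightarrow> real \<Rightarrow> nat \<Rightarrow> (nat \<Rightarrow> real) \<Rightarrow> real" where
  "ref_dens f \<kappa> n x = (\<Prod>i=1..n. inverse (lam \<kappa> i) * f (x i / lam \<kappa> i))"

definition ref_measure :: "(real \<Rightarrow> real) \<Rightarrow> real \<Rightarrow> nat \<Rightarrow> (nat \<Rightarrow> real) measure" where
  "ref_measure f \<kappa> n = density (lborel_n n) (\<lambda>x. ennreal (ref_dens f \<kappa> n x))"

definition target ::
  "(real \<Rightarrow> real) \<Rightarrow> real \<Rightarrow> (nat \<Rightarrow> (nat \<Rightarrow> real) \<Rightarrow> real) \<Rightarrow> nat \<Rightarrow> (nat \<Rightarrow> real) measure" where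
  "target f \<kappa> \<phi> n = density (ref_measure f \<kappa> n) (\<lambda>x. ennreal (exp (- \<phi> n x)))"

text \<open>The density of \<open>target\<close> with respect to Lebesgue measure (see \<open>target_eq_density\<close>):\<close>

definition target_dens ::
  "(real \<Rightarrow> real) \<Rightarrow> real \<Rightarrow> (nat \<Rightarrow> (nat \<Rightarrow> real) \<Rightarrow> real) \<Rightarrow> nat \<Rightarrow> (nat \<Rightarrow> real) \<Rightarrow> real" where
  "target_dens f \<kappa> \<phi> n x = exp (- \<phi> n x) * ref_dens f \<kappa> n x"

lemma target_eq_density:
  assumes [measurable]: "f \<in> borel_measurable borel" "\<phi> n \<in> borel_measurable (lborel_n n)"
  assumes f: "\<And>t. f t \<ge> 0"
  shows "target f \<kappa> \<phi> n = density (lborel_n n) (\<lambda>x. ennreal (target_dens f \<kappa> \<phi> n x))"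
proof -
  have [measurable]: "ref_dens f \<kappa> n \<in> borel_measurable (lborel_n n)"
    unfolding ref_dens_def by measurable
  have "ref_dens f \<kappa> n x \<ge> 0" for x
    unfolding ref_dens_def lam_def using f by (intro prod_nonneg) auto
  then show ?thesis
    unfolding target_def ref_measure_def target_dens_def
    by (subst density_density_eq) (simp_all del: One_nat_def add: ennreal_mult' mult.commute)
qed


section \<open>The algorithms\<close>

datatype algorithm = RWM | SLA

definition proposal_mean ::
  "algorithm \<Rightarrow> (real \<Rightarrow> real) \<Rightarrow> real \<Rightarrow> real \<Rightarrow> (nat \<Rightarrow> real) \<Rightarrow> nat \<Rightarrow> real" where
  "proposal_mean alg g \<kappa> \<sigma> x i =
     (case alg of
        RWM \<Rightarrow> x i
      | SLA \<Rightarrow> x i - \<sigma>\<^sup>2 / (2 * lam \<kappa> i) * deriv g (x i / lam \<kappa> i))"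

definition proposal ::
  "algorithm \<Rightarrow> (real \<Rightarrow> real) \<Rightarrow> real \<Rightarrow> real \<Rightarrow> nat \<Rightarrow> (nat \<Rightarrow> real) \<Rightarrow> (nat \<Rightarrow> real) \<Rightarrow> (nat \<Rightarrow> real)" where
  "proposal alg g \<kappa> \<sigma> n x z = (\<lambda>i\<in>{1..n}. proposal_mean alg g \<kappa> \<sigma> x i + \<sigma> * z i)"

definition std_gaussian :: "nat \<Rightarrow> (nat \<Rightarrow> real) measure" where
  "std_gaussian n = PiM {1..n} (\<lambda>_. std_normal_distribution)"

definition proposal_dens ::
  "algorithm \<Rightarrow> (real \<Rightarrow> real) \<Rightarrow> real \<Rightarrow> real \<Rightarrow> nat \<Rightarrow> (nat \<Rightarrow> real) \<Rightarrow> (nat \<Rightarrow> real) \<Rightarrow> real" where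
  "proposal_dens alg g \<kappa> \<sigma> n x y =
     (\<Prod>i=1..n. normal_density (proposal_mean alg g \<kappa> \<sigma> x i) \<sigma> (y i))"

text \<open>\<open>proposal_dens\<close> is the transition density of \<open>proposal\<close> driven by standard Gaussian noise.\<close>

lemma distr_proposal:
  assumes \<sigma>: "\<sigma> > 0"
  shows "distr (std_gaussian n) (lborel_n n) (proposal alg g \<kappa> \<sigma> n x) =
         density (lborel_n n) (\<lambda>y. ennreal (proposal_dens alg g \<kappa> \<sigma> n x y))"
proof -
  define m where "m = proposal_mean alg g \<kappa> \<sigma> x"
  define N where "N = (\<lambda>i. density lborel (\<lambda>t. ennreal (normal_density (m i) \<sigma> t)))"
  interpret P: product_prob_space "\<lambda>_::nat. std_normal_distribution"
    by (intro product_prob_spaceI prob_space_normal_density) simp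
  interpret L: product_sigma_finite "\<lambda>_::nat. lborel :: real measure" ..
  interpret NN: product_prob_space N
    unfolding N_def by (intro product_prob_spaceI prob_space_normal_density \<sigma>)
  have setsN: "sets (PiM {1..n} N) = sets (lborel_n n)"
    by (intro sets_PiM_cong) (auto simp: N_def)
  have dN: "distr std_normal_distribution lborel (\<lambda>t. m i + \<sigma> * t) = N i" for i
  proof -
    have S: "prob_space std_normal_distribution"
      by (intro prob_space_normal_density) simp
    have "distributed std_normal_distribution lborel (\<lambda>t. t) std_normal_density"
      by (auto simp: distributed_def distr_id2)
    from prob_space.distributed_affine[OF S this, of \<sigma> "m i"] \<sigma> have
      "distr std_normal_distribution lborel (\<lambda>t. m i + \<sigma> * t) =
       density lborel (\<lambda>t. ennreal (std_normal_density ((t - m i) / \<sigma>)) / ennreal \<bar>\<sigma>\<bar>)"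
      by (simp add: distributed_def)
    also have "\<dots> = N i"
      unfolding N_def using \<sigma>
      by (intro density_cong AE_I2)
         (auto simp: divide_ennreal normal_density_def real_sqrt_mult power_divide field_simps)
    finally show ?thesis .
  qed
  have meas [measurable]: "proposal alg g \<kappa> \<sigma> n x \<in> std_gaussian n \<rightarrow>\<^sub>M lborel_n n"
    unfolding proposal_def std_gaussian_def by measurable
  have "distr (std_gaussian n) (lborel_n n) (proposal alg g \<kappa> \<sigma> n x) = PiM {1..n} N"
  proof (rule NN.PiM_eqI)
    fix A assume A: "\<And>i. i \<in> {1..n} \<Longrightarrow> A i \<in> sets (N i)"
    have A' [measurable]: "i \<in> {1..n} \<Longrightarrow> A i \<in> sets borel" for i
      using A[of i] by (simp add: N_def)
    have eq: "proposal alg g \<kappa> \<sigma> n x -` Pi\<^sub>E {1..n} A \<inter> space (std_gaussian n) =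
              Pi\<^sub>E {1..n} (\<lambda>i. (\<lambda>t. m i + \<sigma> * t) -` A i)"
      by (auto simp: proposal_def std_gaussian_def space_PiM m_def PiE_iff Pi_iff)
    have vA: "(\<lambda>t. m i + \<sigma> * t) -` A i \<in> sets borel" if "i \<in> {1..n}" for i
      using measurable_sets_borel[of "\<lambda>t. m i + \<sigma> * t" "borel :: real measure" "A i"] A'[OF that] by simp
    have "emeasure (distr (std_gaussian n) (lborel_n n) (proposal alg g \<kappa> \<sigma> n x)) (Pi\<^sub>E {1..n} A) =
          emeasure (std_gaussian n) (Pi\<^sub>E {1..n} (\<lambda>i. (\<lambda>t. m i + \<sigma> * t) -` A i))"
      by (subst emeasure_distr[OF meas]) (auto simp: eq simp del: One_nat_def intro!: sets_PiM_I_finite A')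
    also have "\<dots> = (\<Prod>i\<in>{1..n}. emeasure std_normal_distribution ((\<lambda>t. m i + \<sigma> * t) -` A i))"
      unfolding std_gaussian_def by (rule P.emeasure_PiM) (auto intro: vA)
    also have "\<dots> = (\<Prod>i\<in>{1..n}. emeasure (N i) (A i))"
      by (intro prod.cong refl, subst dN[symmetric], subst emeasure_distr) (auto simp: A')
    finally show "emeasure (distr (std_gaussian n) (lborel_n n) (proposal alg g \<kappa> \<sigma> n x)) (Pi\<^sub>E {1..n} A) =
      (\<Prod>i\<in>{1..n}. emeasure (N i) (A i))" .
  qed (simp_all del: One_nat_def add: setsN)
  also have "\<dots> = density (lborel_n n) (\<lambda>y. ennreal (proposal_dens alg g \<kappa> \<sigma> n x y))"
  proof (rule NN.PiM_eqI[symmetric])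
    fix A assume A: "\<And>i. i \<in> {1..n} \<Longrightarrow> A i \<in> sets (N i)"
    have A' [measurable]: "i \<in> {1..n} \<Longrightarrow> A i \<in> sets borel" for i
      using A[of i] by (simp add: N_def)
    have [measurable]: "proposal_dens alg g \<kappa> \<sigma> n x \<in> borel_measurable (lborel_n n)"
      unfolding proposal_dens_def by measurable
    have ind: "indicator (Pi\<^sub>E {1..n} A) y = (\<Prod>i\<in>{1..n}. indicator (A i) (y i) :: ennreal)"
      if y: "y \<in> Rn n" for y
    proof (cases "y \<in> Pi\<^sub>E {1..n} A")
      case True
      then show ?thesis by (auto simp: PiE_iff)
    next
      case False
      then obtain i where "i \<in> {1..n}" "y i \<notin> A i" using y by (auto simp: PiE_iff)
      then have "(\<Prod>i\<in>{1..n}. indicator (A i) (y i) :: ennreal) = 0"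
        by (intro prod_zero) (auto intro!: bexI[of _ i])
      with False show ?thesis by simp
    qed
    have "emeasure (density (lborel_n n) (\<lambda>y. ennreal (proposal_dens alg g \<kappa> \<sigma> n x y))) (Pi\<^sub>E {1..n} A) =
      (\<integral>\<^sup>+ y. ennreal (proposal_dens alg g \<kappa> \<sigma> n x y) * indicator (Pi\<^sub>E {1..n} A) y \<partial>lborel_n n)"
      by (rule emeasure_density) (auto simp del: One_nat_def intro!: sets_PiM_I_finite A')
    also have "\<dots> = (\<integral>\<^sup>+ y. (\<Prod>i\<in>{1..n}. ennreal (normal_density (m i) \<sigma> (y i)) * indicator (A i) (y i)) \<partial>lborel_n n)"
      by (intro nn_integral_cong)
         (simp del: One_nat_def
           add: ind[unfolded space_lborel_n[symmetric]] proposal_dens_def m_def prod_ennreal prod.distrib)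
    also have "\<dots> = (\<Prod>i\<in>{1..n}. \<integral>\<^sup>+ t. ennreal (normal_density (m i) \<sigma> t) * indicator (A i) t \<partial>lborel)"
      by (rule L.product_nn_integral_prod) auto
    also have "\<dots> = (\<Prod>i\<in>{1..n}. emeasure (N i) (A i))"
      unfolding N_def by (intro prod.cong refl, subst emeasure_density) (auto simp: A')
    finally show "emeasure (density (lborel_n n) (\<lambda>y. ennreal (proposal_dens alg g \<kappa> \<sigma> n x y))) (Pi\<^sub>E {1..n} A) =
      (\<Prod>i\<in>{1..n}. emeasure (N i) (A i))" .
  qed (simp_all del: One_nat_def add: setsN)
  finally show ?thesis .
qed

text \<open>The drift of SLA is \<open>\<sigma>\<^sup>2/2\<close> times the gradient of the logarithm of the reference density.\<close>

lemma proposal_mean_SLA_gradient: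
  assumes f: "\<And>t. f t = exp (- g t)" and g: "\<And>t. g field_differentiable (at t)"
    and i: "i \<in> {1..n}"
  shows "proposal_mean SLA g \<kappa> \<sigma> x i =
         x i + \<sigma>\<^sup>2 / 2 * deriv (\<lambda>t. ln (ref_dens f \<kappa> n (x(i := t)))) (x i)"
proof -
  have pos: "lam \<kappa> j > 0" if "j \<in> {1..n}" for j
    using that by (simp add: lam_def)
  define c where "c = (\<Sum>j\<in>{1..n}-{i}. ln (inverse (lam \<kappa> j)) - g (x j / lam \<kappa> j)) + ln (inverse (lam \<kappa> i))"
  have "ln (ref_dens f \<kappa> n (x(i := t))) = c - g (t / lam \<kappa> i)" for t
  proof -
    have "ln (ref_dens f \<kappa> n (x(i := t))) =
          (\<Sum>j\<in>{1..n}. ln (inverse (lam \<kappa> j) * f ((x(i:=t)) j / lam \<kappa> j)))"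
      unfolding ref_dens_def using pos by (subst ln_prod) (auto simp: f less_imp_neq[THEN not_sym])
    also have "\<dots> = (\<Sum>j\<in>{1..n}. ln (inverse (lam \<kappa> j)) - g ((x(i:=t)) j / lam \<kappa> j))"
      using pos by (intro sum.cong refl) (subst ln_mult_pos, auto simp: f)
    also have "\<dots> = c - g (t / lam \<kappa> i)"
      using i unfolding c_def by (subst sum.remove[of _ i]) auto
    finally show ?thesis .
  qed
  moreover have "((\<lambda>t. c - g (t / lam \<kappa> i)) has_real_derivative
                  - (deriv g (x i / lam \<kappa> i) * (1 / lam \<kappa> i))) (at (x i))"
    using pos[OF i]
    by (auto intro!: derivative_eq_intros DERIV_chain2[where f = g]
          g[THEN DERIV_deriv_iff_field_differentiable[THEN iffD2]])
  ultimately have "deriv (\<lambda>t. ln (ref_dens f \<kappa> n (x(i := t)))) (x i) =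
      - (deriv g (x i / lam \<kappa> i) * (1 / lam \<kappa> i))"
    by (simp add: DERIV_imp_deriv)
  then show ?thesis by (simp add: proposal_mean_def)
qed

definition mh_accept ::
  "('a \<Rightarrow> real) \<Rightarrow> ('a \<Rightarrow> 'a \<Rightarrow> real) \<Rightarrow> 'a \<Rightarrow> 'a \<Rightarrow> real" where
  "mh_accept p q x y =
     (if p x * q x y > 0 then min 1 (p y * q y x / (p x * q x y)) else 0)"

text \<open>
  One Metropolis--Hastings step from \<open>x\<close>, driven by Gaussian noise \<open>z\<close> and by a variable \<open>u\<close>,
  uniform on \<open>[0,1]\<close>, that realises the acceptance probability.
\<close>

definition mh_step ::
  "algorithm \<Rightarrow> (real \<Rightarrow> real) \<Rightarrow> (real \<Rightarrow> real) \<Rightarrow> real \<Rightarrow> (nat \<Rightarrow> (nat \<Rightarrow> real) \<Rightarrow> real) \<Rightarrow> real \<Rightarrow>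
   nat \<Rightarrow> (nat \<Rightarrow> real) \<Rightarrow> (nat \<Rightarrow> real) \<Rightarrow> real \<Rightarrow> (nat \<Rightarrow> real)" where
  "mh_step alg f g \<kappa> \<phi> \<sigma> n x z u =
     (let y = proposal alg g \<kappa> \<sigma> n x z in
      if u < mh_accept (target_dens f \<kappa> \<phi> n) (proposal_dens alg g \<kappa> \<sigma> n) x y then y else x)"

definition sq_jump ::
  "algorithm \<Rightarrow> (real \<Rightarrow> real) \<Rightarrow> (real \<Rightarrow> real) \<Rightarrow> real \<Rightarrow> (nat \<Rightarrow> (nat \<Rightarrow> real) \<Rightarrow> real) \<Rightarrow> (nat \<Rightarrow> real) \<Rightarrow>
   nat \<Rightarrow> nat \<Rightarrow> real" where
  "sq_jump alg f g \<kappa> \<phi> \<sigma> i n =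
     (\<integral>(x, z, u). (mh_step alg f g \<kappa> \<phi> (\<sigma> n) n x z u i - x i)\<^sup>2
        \<partial>(target f \<kappa> \<phi> n \<Otimes>\<^sub>M (std_gaussian n \<Otimes>\<^sub>M uniform_measure lborel {0..1})))"


section \<open>The limiting constants\<close>

definition E_dens :: "(real \<Rightarrow> real) \<Rightarrow> (real \<Rightarrow> real) \<Rightarrow> real" where
  "E_dens f h = (\<integral>X. h X \<partial>density lborel (\<lambda>t. ennreal (f t)))"

definition K_RWM :: "(real \<Rightarrow> real) \<Rightarrow> (real \<Rightarrow> real) \<Rightarrow> real" where
  "K_RWM f g = E_dens f (\<lambda>X. (deriv g X)\<^sup>2)"

definition K_SLA :: "(real \<Rightarrow> real) \<Rightarrow> (real \<Rightarrow> real) \<Rightarrow> real" where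
  "K_SLA f g = 1 / 48 * E_dens f (\<lambda>X. 3 * ((deriv ^^ 2) g X) ^ 3 + 5 * ((deriv ^^ 3) g X)\<^sup>2)"

definition I_exp :: "algorithm \<Rightarrow> real" where
  "I_exp alg = (case alg of RWM \<Rightarrow> 1 | SLA \<Rightarrow> 1 / 3)"

definition std_normal_cdf :: "real \<Rightarrow> real" where
  "std_normal_cdf = cdf std_normal_distribution"

definition acc_limit :: "algorithm \<Rightarrow> (real \<Rightarrow> real) \<Rightarrow> (real \<Rightarrow> real) \<Rightarrow> real \<Rightarrow> real \<Rightarrow> real" where
  "acc_limit alg f g \<kappa> l =
     (case alg of
        RWM \<Rightarrow> 2 * std_normal_cdf (- (l / 2) * sqrt (K_RWM f g / (1 + 2 * \<kappa>)))
      | SLA \<Rightarrow> 2 * std_normal_cdf (- (l ^ 3 / 2) * sqrt (K_SLA f g / (1 + 6 * \<kappa>))))"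

end

theory Submission
  imports Defs "HOL-Real_Asymp.Real_Asymp"
begin

text \<open>
  In the coordinates \<open>x j / lam \<kappa> j\<close> the reference measure is a product, and the log acceptance
  ratio is \<open>\<phi> x - \<phi> y\<close> plus a sum of independent terms \<open>R j\<close> with small parameter
  \<open>e j = \<sigma> * j powr \<kappa>\<close>. Taylor expansion gives \<open>R j = e j ^ a * C + O(e j ^ (a + 1))\<close> with \<open>a = 1\<close> for RWM,
  \<open>a = 3\<close> for SLA, where \<open>C\<close> has conditional mean zero given the state and second moment \<open>K\<close>.
  The mean of \<open>R j\<close> needs no further expansion: exchanging state and proposal maps \<open>R j\<close> to
  \<open>- R j\<close>, and testing the resulting identity \<open>E (H R) = E (exp R * H (- R))\<close> with an antisymmetric
  function yields \<open>E R = - E (R\<^sup>2) / 2 + O(E \<bar>R\<bar>\<^sup>3)\<close>.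

  Let \<open>\<psi> j\<close> be the characteristic function of \<open>R j\<close> conditional on the state. Both
  \<open>\<Prod> E (\<psi> j)\<close> and \<open>\<Prod> E \<bar>\<psi> j\<bar>\<^sup>2\<close> converge, to \<open>c\<close> and \<open>\<bar>c\<bar>\<^sup>2\<close>, so \<open>\<Prod> \<psi> j\<close> converges to the constant
  \<open>c\<close> in mean square, hence also under the target, whose density is bounded. By Levy's continuity
  theorem the sum is asymptotically normal with variance \<open>\<tau>\<^sup>2\<close> and mean \<open>- \<tau>\<^sup>2 / 2\<close>, which gives the
  acceptance rate \<open>2 * \<Phi> (- \<tau> / 2)\<close>; the difference of \<open>\<phi>\<close> vanishes in probability.
  Below the critical exponent, \<open>E (exp (R / 2)) \<le> exp (- c * e ^ (2 * a))\<close> in each coordinate, and the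
  product of these bounds decays faster than any power of \<open>n\<close>.
\<close>

section \<open>Functions of polynomial growth\<close>

text \<open>The coordinates are dependent under the target, so no limit theorem for independent
  summands applies there. Mean square convergence under the product measure is the form of the
  statement that survives a bounded change of measure, and (A) supplies the bound. The squared jump
  of the observed coordinate is correlated with the acceptance. As the squared noise has mean one,
  it is treated as a further probability weight, which alters a single factor. The mean of
  \<open>R j\<close> has the same order \<open>e j ^ (2 * a)\<close> as its variance, and for SLA a
  direct computation would carry the expansion to order six; reversibility reads the mean off the
  variance instead. The variances add up to the order
  \<open>n * (\<sigma> * n powr \<kappa>) ^ (2 * a)\<close>, which is constant exactly for \<rho> =
  2\<kappa> + 1/a: this is the origin of I = 1/a. The exponents in (B) lie below \<kappa> - 1/2,
  which makes \<open>j powr (2 * s - 2 * \<kappa>)\<close> summable, so the weighted norms of state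
  and proposal have second moments bounded uniformly in n.\<close>

definition growth :: "nat \<Rightarrow> (real \<Rightarrow> real \<Rightarrow> real \<Rightarrow> real) \<Rightarrow> bool" where
  "growth k F \<longleftrightarrow> (\<exists>A m. \<forall>e x z. 0 < e \<longrightarrow> e \<le> 1 \<longrightarrow>
     \<bar>F e x z\<bar> \<le> A * e ^ k * ((1 + \<bar>x\<bar>) * (1 + \<bar>z\<bar>)) ^ m)"

lemma growthI:
  assumes "\<And>e x z. 0 < e \<Longrightarrow> e \<le> 1 \<Longrightarrow> \<bar>F e x z\<bar> \<le> A * e ^ k * ((1 + \<bar>x\<bar>) * (1 + \<bar>z\<bar>)) ^ m"
  shows "growth k F"
  using assms unfolding growth_def by blast

lemma growthE:
  assumes "growth k F"
  obtains A m where "A \<ge> 0"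
    "\<And>e x z. 0 < e \<Longrightarrow> e \<le> 1 \<Longrightarrow> \<bar>F e x z\<bar> \<le> A * e ^ k * ((1 + \<bar>x\<bar>) * (1 + \<bar>z\<bar>)) ^ m"
proof -
  obtain A m where
    *: "\<And>e x z. 0 < e \<Longrightarrow> e \<le> 1 \<Longrightarrow> \<bar>F e x z\<bar> \<le> A * e ^ k * ((1 + \<bar>x\<bar>) * (1 + \<bar>z\<bar>)) ^ m"
    using assms unfolding growth_def by blast
  have "A \<ge> 0"
    using *[of 1 0 0] by simp
  then show thesis using that * by blast
qed

lemma one_le_base: "(1::real) \<le> (1 + \<bar>x\<bar>) * (1 + \<bar>z\<bar>)"
  using mult_mono[of 1 "1 + \<bar>x\<bar>" 1 "1 + \<bar>z\<bar>"] by simp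

lemma growth_mono:
  assumes "growth k H" "\<And>e x z. 0 < e \<Longrightarrow> e \<le> 1 \<Longrightarrow> \<bar>F e x z\<bar> \<le> \<bar>H e x z\<bar>"
  shows "growth k F"
  using assms unfolding growth_def by (meson order_trans)

lemma growth_cong:
  assumes "growth k H" "\<And>e x z. 0 < e \<Longrightarrow> e \<le> 1 \<Longrightarrow> F e x z = H e x z"
  shows "growth k F"
  by (rule growth_mono[OF assms(1)]) (simp add: assms(2))

text \<open>The restriction to e at most 1 in \<open>growth\<close> is what permits lower powers of
  e. Remainders of higher order are thereby absorbed into errors of a fixed order.\<close>

lemma growth_weaken:
  assumes "growth k F" "l \<le> k"
  shows "growth l F"
proof -
  obtain A m where A: "A \<ge> 0"
    "\<And>e x z. 0 < e \<Longrightarrow> e \<le> 1 \<Longrightarrow> \<bar>F e x z\<bar> \<le> A * e ^ k * ((1 + \<bar>x\<bar>) * (1 + \<bar>z\<bar>)) ^ m"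
    using growthE[OF assms(1)] by blast
  show ?thesis
  proof (rule growthI)
    fix e x z :: real assume e: "0 < e" "e \<le> 1"
    have "\<bar>F e x z\<bar> \<le> A * e ^ k * ((1 + \<bar>x\<bar>) * (1 + \<bar>z\<bar>)) ^ m" using A e by blast
    also have "\<dots> \<le> A * e ^ l * ((1 + \<bar>x\<bar>) * (1 + \<bar>z\<bar>)) ^ m"
      using A(1) e power_decreasing[OF assms(2), of e] by (intro mult_right_mono mult_left_mono) auto
    finally show "\<bar>F e x z\<bar> \<le> A * e ^ l * ((1 + \<bar>x\<bar>) * (1 + \<bar>z\<bar>)) ^ m" .
  qed
qed

lemma growth_add:
  assumes "growth k F" "growth k H"
  shows "growth k (\<lambda>e x z. F e x z + H e x z)"
proof -
  obtain A m where A: "A \<ge> 0"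
    "\<And>e x z. 0 < e \<Longrightarrow> e \<le> 1 \<Longrightarrow> \<bar>F e x z\<bar> \<le> A * e ^ k * ((1 + \<bar>x\<bar>) * (1 + \<bar>z\<bar>)) ^ m"
    using growthE[OF assms(1)] by blast
  obtain A' m' where A': "A' \<ge> 0"
    "\<And>e x z. 0 < e \<Longrightarrow> e \<le> 1 \<Longrightarrow> \<bar>H e x z\<bar> \<le> A' * e ^ k * ((1 + \<bar>x\<bar>) * (1 + \<bar>z\<bar>)) ^ m'"
    using growthE[OF assms(2)] by blast
  show ?thesis
  proof (rule growthI)
    fix e x z :: real assume e: "0 < e" "e \<le> 1"
    let ?B = "(1 + \<bar>x\<bar>) * (1 + \<bar>z\<bar>)"
    have "\<bar>F e x z + H e x z\<bar> \<le> A * e ^ k * ?B ^ m + A' * e ^ k * ?B ^ m'"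
      using A(2)[OF e, of x z] A'(2)[OF e, of x z] by linarith
    also have "\<dots> \<le> A * e ^ k * ?B ^ max m m' + A' * e ^ k * ?B ^ max m m'"
      using A(1) A'(1) e one_le_base[of x z]
      by (intro add_mono mult_left_mono power_increasing) auto
    finally show "\<bar>F e x z + H e x z\<bar> \<le> (A + A') * e ^ k * ?B ^ max m m'"
      by (simp add: algebra_simps)
  qed
qed

text \<open>Orders in e add. The single base (1 + |x|)(1 + |z|), which is at least 1, lets
  polynomial factors be merged by adding exponents, so exact degrees never have to be
  tracked.\<close>

lemma growth_mult:
  assumes "growth k F" "growth l H"
  shows "growth (k + l) (\<lambda>e x z. F e x z * H e x z)"
proof -
  obtain A m where A: "A \<ge> 0"
    "\<And>e x z. 0 < e \<Longrightarrow> e \<le> 1 \<Longrightarrow> \<bar>F e x z\<bar> \<le> A * e ^ k * ((1 + \<bar>x\<bar>) * (1 + \<bar>z\<bar>)) ^ m"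
    using growthE[OF assms(1)] by blast
  obtain A' m' where A': "A' \<ge> 0"
    "\<And>e x z. 0 < e \<Longrightarrow> e \<le> 1 \<Longrightarrow> \<bar>H e x z\<bar> \<le> A' * e ^ l * ((1 + \<bar>x\<bar>) * (1 + \<bar>z\<bar>)) ^ m'"
    using growthE[OF assms(2)] by blast
  show ?thesis
  proof (rule growthI)
    fix e x z :: real assume e: "0 < e" "e \<le> 1"
    let ?B = "(1 + \<bar>x\<bar>) * (1 + \<bar>z\<bar>)"
    have "\<bar>F e x z * H e x z\<bar> \<le> (A * e ^ k * ?B ^ m) * (A' * e ^ l * ?B ^ m')"
      unfolding abs_mult using A(2)[OF e, of x z] A'(2)[OF e, of x z]
      by (intro mult_mono) auto
    then show "\<bar>F e x z * H e x z\<bar> \<le> (A * A') * e ^ (k + l) * ?B ^ (m + m')"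
      by (simp add: power_add algebra_simps)
  qed
qed

lemma growth_const: "growth 0 (\<lambda>e x z. c)"
  by (rule growthI[of _ "\<bar>c\<bar>" 0 0]) auto

lemma growth_x: "growth 0 (\<lambda>e x z. x)"
proof (rule growthI[of _ 1 0 1])
  fix e x z :: real
  show "\<bar>x\<bar> \<le> 1 * e ^ 0 * ((1 + \<bar>x\<bar>) * (1 + \<bar>z\<bar>)) ^ 1"
    using mult_mono[of "1 + \<bar>x\<bar>" "1 + \<bar>x\<bar>" 1 "1 + \<bar>z\<bar>"] by simp
qed

lemma growth_z: "growth 0 (\<lambda>e x z. z)"
proof (rule growthI[of _ 1 0 1])
  fix e x z :: real
  show "\<bar>z\<bar> \<le> 1 * e ^ 0 * ((1 + \<bar>x\<bar>) * (1 + \<bar>z\<bar>)) ^ 1"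
    using mult_mono[of 1 "1 + \<bar>x\<bar>" "1 + \<bar>z\<bar>" "1 + \<bar>z\<bar>"] by simp
qed

lemma growth_e: "growth 1 (\<lambda>e x z. e)"
  by (rule growthI[of _ 1 1 0]) auto

lemma growth_cmult: "growth k F \<Longrightarrow> growth k (\<lambda>e x z. c * F e x z)"
  using growth_mult[OF growth_const[of c]] by simp

lemma growth_minus: "growth k F \<Longrightarrow> growth k (\<lambda>e x z. - F e x z)"
  using growth_cmult[of k F "-1"] by simp

lemma growth_diff: "growth k F \<Longrightarrow> growth k H \<Longrightarrow> growth k (\<lambda>e x z. F e x z - H e x z)"
  using growth_add[OF _ growth_minus, of k F H] by simp

lemma growth_power: "growth k F \<Longrightarrow> growth (k * n) (\<lambda>e x z. F e x z ^ n)"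
proof (induction n)
  case 0 show ?case using growth_const[of 1] by simp
next
  case (Suc n)
  show ?case using growth_mult[OF Suc(2) Suc.IH[OF Suc(2)]] by (simp add: algebra_simps)
qed

lemma growth_abs: "growth k F \<Longrightarrow> growth k (\<lambda>e x z. \<bar>F e x z\<bar>)"
  by (erule growth_mono) simp

lemma growth_epower: "growth k (\<lambda>e x z. e ^ k)"
  using growth_power[OF growth_e, of k] by simp

lemma growth_emult: "growth l F \<Longrightarrow> growth (k + l) (\<lambda>e x z. e ^ k * F e x z)"
  by (rule growth_mult[OF growth_epower])

lemma growth_ez: "growth 1 (\<lambda>e x z. e * z)"
  using growth_mult[OF growth_e growth_z] by simp

text \<open>Brings the polynomial bounds on g and its derivatives into the one-power form used by
  \<open>growth\<close>.\<close>

lemma poly_bound: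
  fixes P :: "real poly"
  shows "\<exists>A m. A \<ge> 0 \<and> (\<forall>t. \<bar>poly P t\<bar> \<le> A * (1 + \<bar>t\<bar>) ^ m)"
proof (induction P)
  case 0 show ?case by (intro exI[of _ 0] exI[of _ 0]) auto
next
  case (pCons a P)
  then obtain A m where A: "A \<ge> 0" "\<And>t. \<bar>poly P t\<bar> \<le> A * (1 + \<bar>t\<bar>) ^ m" by blast
  show ?case
  proof (intro exI[of _ "\<bar>a\<bar> + A"] exI[of _ "Suc m"] conjI allI)
    fix t :: real
    have "\<bar>poly (pCons a P) t\<bar> \<le> \<bar>a\<bar> * 1 + \<bar>t\<bar> * \<bar>poly P t\<bar>"
      by (auto simp: abs_mult[symmetric])
    also have "\<dots> \<le> \<bar>a\<bar> * (1 + \<bar>t\<bar>) ^ Suc m + (1 + \<bar>t\<bar>) * (A * (1 + \<bar>t\<bar>) ^ m)"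
      using A by (intro add_mono mult_left_mono mult_mono one_le_power) auto
    finally show "\<bar>poly (pCons a P) t\<bar> \<le> (\<bar>a\<bar> + A) * (1 + \<bar>t\<bar>) ^ Suc m"
      by (simp add: algebra_simps)
  qed (use A in auto)
qed

section \<open>One coordinate of the algorithms, in the scale of the density\<close>

text \<open>The drift in the coordinate divided by \<open>lam \<kappa> j\<close>, with e = \<sigma>
  / \<open>lam \<kappa> j\<close>: the factor 1 / \<open>lam \<kappa> j\<close> of the gradient is
  absorbed, and a coordinate depends on j only through e.\<close>

definition mean1 :: "algorithm \<Rightarrow> (real \<Rightarrow> real) \<Rightarrow> real \<Rightarrow> real \<Rightarrow> real" where
  "mean1 alg g e x = (case alg of RWM \<Rightarrow> x | SLA \<Rightarrow> x - e\<^sup>2 / 2 * deriv g x)"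

definition prop1 :: "algorithm \<Rightarrow> (real \<Rightarrow> real) \<Rightarrow> real \<Rightarrow> real \<Rightarrow> real \<Rightarrow> real" where
  "prop1 alg g e x z = mean1 alg g e x + e * z"

text \<open>
  The logarithm of \<open>f y * q(y, x) / (f x * q(x, y))\<close> for the proposal \<open>y\<close> driven by the noise \<open>z\<close>;
  the term \<open>z\<^sup>2 / 2\<close> is minus the exponent of \<open>q(x, y)\<close>.
\<close>

definition logratio :: "algorithm \<Rightarrow> (real \<Rightarrow> real) \<Rightarrow> real \<Rightarrow> real \<Rightarrow> real \<Rightarrow> real" where
  "logratio alg g e x z = g x - g (prop1 alg g e x z) + z\<^sup>2 / 2
     - ((x - mean1 alg g e (prop1 alg g e x z)) / e)\<^sup>2 / 2"

text \<open>The reciprocal of I. For SLA the orders one and two cancel, since the log ratio is the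
  error of a trapezoidal rule plus e^2 times an increment, both of third order.\<close>

definition lead_order :: "algorithm \<Rightarrow> nat" where
  "lead_order alg = (case alg of RWM \<Rightarrow> 1 | SLA \<Rightarrow> 3)"

text \<open>The coefficient of the leading power \<open>e ^ lead_order alg\<close> in the expansion of \<open>logratio\<close>.\<close>

definition lead :: "algorithm \<Rightarrow> (real \<Rightarrow> real) \<Rightarrow> real \<Rightarrow> real \<Rightarrow> real" where
  "lead alg g x z = (case alg of RWM \<Rightarrow> - (deriv g x * z)
     | SLA \<Rightarrow> (deriv ^^ 3) g x / 12 * z ^ 3 - deriv g x * (deriv ^^ 2) g x / 4 * z)"

lemma lead_order_pos: "lead_order alg \<ge> 1"
  by (cases alg) (auto simp: lead_order_def)

locale smooth_density =
  fixes f g :: "real \<Rightarrow> real"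
  assumes f_eq: "\<And>t. f t = exp (- g t)"
    and f_prob: "prob_space (density lborel (\<lambda>t. ennreal (f t)))"
    and g_smooth: "\<And>k t. (deriv ^^ k) g field_differentiable (at t)"
    and g_poly: "\<And>k. \<exists>P :: real poly. \<forall>t. \<bar>(deriv ^^ k) g t\<bar> \<le> poly P t"
    and f_moments: "\<And>k :: nat. integrable (density lborel (\<lambda>t. ennreal (f t))) (\<lambda>t. t ^ k)"
begin

abbreviation dg :: "nat \<Rightarrow> real \<Rightarrow> real" where "dg k \<equiv> (deriv ^^ k) g"

lemma dg_1: "dg 1 = deriv g"
  by simp

lemma dg_deriv: "(dg k has_real_derivative dg (Suc k) t) (at t)"
  using g_smooth[of k t] by (simp add: DERIV_deriv_iff_field_differentiable)

lemma dg_isCont: "isCont (dg k) t"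
  using dg_deriv DERIV_isCont by blast

lemma dg_measurable [measurable]: "dg k \<in> borel_measurable borel"
  by (intro borel_measurable_continuous_onI continuous_at_imp_continuous_on) (simp add: dg_isCont)

lemma g_measurable [measurable]: "g \<in> borel_measurable borel"
  using dg_measurable[of 0] by simp

lemma deriv_g_measurable [measurable]: "deriv g \<in> borel_measurable borel"
  using dg_measurable[of 1] by simp

lemma f_pos: "f t > 0"
  by (simp add: f_eq)

lemma f_measurable [measurable]: "f \<in> borel_measurable borel"
  using g_measurable by (simp add: f_eq[abs_def])

lemma dg_bound: "\<exists>A m. A \<ge> 0 \<and> (\<forall>t. \<bar>dg k t\<bar> \<le> A * (1 + \<bar>t\<bar>) ^ m)"
proof -
  obtain P :: "real poly" where P: "\<And>t. \<bar>dg k t\<bar> \<le> poly P t" using g_poly by blast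
  obtain A m where "A \<ge> 0" "\<And>t. \<bar>poly P t\<bar> \<le> A * (1 + \<bar>t\<bar>) ^ m" using poly_bound by blast
  then show ?thesis
    by (intro exI[of _ A] exI[of _ m]) (use P in \<open>auto intro: order_trans[OF P] order_trans[OF abs_ge_self]\<close>)
qed

text \<open>The displacement d is itself of order one in e, so the n-th power of d in the Lagrange
  remainder has order n. The intermediate point lies within |d| of x, so the derivative there is
  bounded by a power of 1 + |x| + |d|, which has order zero.\<close>

lemma growth_taylor:
  assumes d: "growth 1 d"
  shows "growth n (\<lambda>e x z. dg j (x + d e x z) - (\<Sum>m<n. dg (j + m) x / fact m * d e x z ^ m))"
proof -
  obtain A k where A: "A \<ge> 0" "\<And>t. \<bar>dg (j + n) t\<bar> \<le> A * (1 + \<bar>t\<bar>) ^ k"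
    using dg_bound by blast
  let ?H = "\<lambda>e x z. A * ((1 + \<bar>x\<bar> + \<bar>d e x z\<bar>) ^ k * d e x z ^ n)"
  have "growth 0 (\<lambda>e x z. 1 + \<bar>x\<bar> + \<bar>d e x z\<bar>)"
    by (intro growth_add growth_const growth_abs growth_x growth_weaken[OF d]) auto
  from growth_mult[OF growth_power[OF this, of k] growth_power[OF d, of n]]
  have H: "growth n ?H" by (intro growth_cmult) simp
  show ?thesis
  proof (rule growth_mono[OF H])
    fix e x z :: real
    let ?d = "d e x z"
    have "\<exists>t. \<bar>t\<bar> \<le> \<bar>?d\<bar> \<and> dg j (x + ?d) =
        (\<Sum>m<n. dg (j + m) (x + 0) / fact m * ?d ^ m) + dg (j + n) (x + t) / fact n * ?d ^ n"
    proof (rule Maclaurin_all_le[where f = "\<lambda>s. dg j (x + s)" and diff = "\<lambda>m s. dg (j + m) (x + s)"])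
      show "\<forall>m s. ((\<lambda>s. dg (j + m) (x + s)) has_real_derivative dg (j + Suc m) (x + s)) (at s)"
        using DERIV_shift[THEN iffD1, OF dg_deriv[of _ "_ + x"]] by (simp only: add.commute[of _ x] add_Suc_right) blast
    qed simp
    then obtain t where t: "\<bar>t\<bar> \<le> \<bar>?d\<bar>" "dg j (x + ?d) - (\<Sum>m<n. dg (j + m) x / fact m * ?d ^ m)
        = dg (j + n) (x + t) / fact n * ?d ^ n" by auto
    have "\<bar>dg (j + n) (x + t)\<bar> \<le> A * (1 + \<bar>x + t\<bar>) ^ k" using A by blast
    also have "\<dots> \<le> A * (1 + \<bar>x\<bar> + \<bar>?d\<bar>) ^ k"
      using t A by (intro mult_left_mono power_mono) auto
    finally have "\<bar>dg (j + n) (x + t)\<bar> / fact n \<le> A * (1 + \<bar>x\<bar> + \<bar>?d\<bar>) ^ k / 1"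
      by (intro frac_le) auto
    then have "\<bar>dg (j + n) (x + t) / fact n * ?d ^ n\<bar> \<le> A * (1 + \<bar>x\<bar> + \<bar>?d\<bar>) ^ k * \<bar>?d ^ n\<bar>"
      unfolding abs_mult by (intro mult_right_mono) auto
    with t A show "\<bar>dg j (x + ?d) - (\<Sum>m<n. dg (j + m) x / fact m * ?d ^ m)\<bar> \<le> \<bar>?H e x z\<bar>"
      by (simp add: abs_mult mult.assoc)
  qed
qed

lemma growth_dg: "growth 0 (\<lambda>e x z. dg k x)"
proof -
  \<comment> \<open>Displacement zero and n = 0: the Taylor sum is empty and the remainder is
    \<open>dg k x\<close> itself.\<close>
  have "growth 1 (\<lambda>e x z. 0)"
    by (rule growthI[of _ 0 1 0]) auto
  from growth_taylor[OF this, of 0 k] show ?thesis by simp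
qed

lemma growth_step: "growth 1 (\<lambda>e x z. prop1 alg g e x z - x)"
proof (cases alg)
  case RWM
  show ?thesis unfolding prop1_def mean1_def RWM
    using growth_ez by simp
next
  case SLA
  have "growth 2 (\<lambda>e x z. (1/2) * (e ^ 2 * dg 1 x))"
    by (intro growth_cmult) (use growth_emult[OF growth_dg[of 1], of 2] in simp)
  then have "growth 1 (\<lambda>e x z. (1/2) * (e ^ 2 * dg 1 x))"
    by (rule growth_weaken) simp
  from growth_diff[OF growth_ez this]
  show ?thesis unfolding prop1_def mean1_def SLA by (simp add: algebra_simps)
qed

lemma logratio_RWM: "e > 0 \<Longrightarrow> logratio RWM g e x z = g x - g (prop1 RWM g e x z)"
  by (simp add: logratio_def mean1_def prop1_def)

text \<open>Eliminating z in favour of y, the squares (y - x)^2 of the two Gaussian exponents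
  cancel. The cross terms with the drifts form the trapezoidal rule, and the squared drifts leave
  the term in e^2.\<close>

lemma logratio_SLA:
  fixes e x z :: real
  assumes "e > 0"
  defines "y \<equiv> prop1 SLA g e x z"
  shows "logratio SLA g e x z = g x - g y + (y - x) * (deriv g x + deriv g y) / 2
     + e\<^sup>2 / 8 * ((deriv g x)\<^sup>2 - (deriv g y)\<^sup>2)"
proof -
  have z: "z = (y - x + e\<^sup>2 / 2 * deriv g x) / e"
    using assms by (simp add: prop1_def mean1_def)
  have "z\<^sup>2 / 2 - ((x - (y - e\<^sup>2 / 2 * deriv g y)) / e)\<^sup>2 / 2 =
    (y - x) * (deriv g x + deriv g y) / 2 + e\<^sup>2 / 8 * ((deriv g x)\<^sup>2 - (deriv g y)\<^sup>2)"
    unfolding z using \<open>e > 0\<close> by (simp add: field_simps power2_eq_square)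
  then show ?thesis
    unfolding logratio_def y_def[symmetric] by (simp add: mean1_def)
qed

lemma growth_lead: "growth 0 (\<lambda>e x z. lead alg g x z)"
proof (cases alg)
  case RWM
  then show ?thesis
    using growth_minus[OF growth_mult[OF growth_dg[of 1] growth_z]] by (simp add: lead_def)
next
  case SLA
  have "growth 0 (\<lambda>e x z. 1/12 * (dg 3 x * z ^ 3) - 1/4 * (dg 1 x * dg 2 x * z))"
    using growth_mult[OF growth_dg[of 3] growth_power[OF growth_z, of 3]]
      growth_mult[OF growth_mult[OF growth_dg[of 1] growth_dg[of 2]] growth_z]
    by (intro growth_diff growth_cmult) simp_all
  then show ?thesis using SLA by (simp add: lead_def)
qed

lemma growth_logratio_RWM: "growth 2 (\<lambda>e x z. logratio RWM g e x z - e ^ 1 * lead RWM g x z)"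
proof -
  note T = growth_taylor[OF growth_step[of RWM], of 2 0]
  show ?thesis
  proof (rule growth_cong[OF growth_minus[OF T]])
    fix e x z :: real assume "0 < e" "e \<le> 1"
    then show "logratio RWM g e x z - e ^ 1 * lead RWM g x z =
      - (dg 0 (x + (prop1 RWM g e x z - x)) -
           (\<Sum>m<2. dg (0 + m) x / fact m * (prop1 RWM g e x z - x) ^ m))"
      by (simp add: logratio_RWM lead_def prop1_def mean1_def numeral_2_eq_2)
  qed
qed

text \<open>The trapezoidal rule for \<open>g y - g x\<close> has error \<open>- (y - x)^3 g''' x / 12\<close> up to fourth order.\<close>

lemma growth_logratio_SLA: "growth 4 (\<lambda>e x z. logratio SLA g e x z - e ^ 3 * lead SLA g x z)"
proof -
  define d where "d = (\<lambda>e x z. prop1 SLA g e x z - x)"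
  have d: "growth 1 d" unfolding d_def by (rule growth_step)
  have d': "growth 2 (\<lambda>e x z. - (1/2) * (e\<^sup>2 * dg 1 x))"
    by (intro growth_cmult) (use growth_emult[OF growth_dg[of 1], of 2] in simp)
  have d_eq: "d = (\<lambda>e x z. e * z + - (1/2) * (e\<^sup>2 * dg 1 x))"
    by (auto simp: d_def prop1_def mean1_def fun_eq_iff)
  \<comment> \<open>Each truncation depth is chosen so that every error has order 4:
    \<open>r0\<close> stands alone, \<open>r1\<close> comes with a factor \<open>d\<close>,
    \<open>s\<close> with e^2, and \<open>q\<close> enters squared with e^2.\<close>
  define r0 where "r0 = (\<lambda>e x z. dg 0 (x + d e x z) - (\<Sum>m<4. dg (0 + m) x / fact m * d e x z ^ m))"
  define r1 where "r1 = (\<lambda>e x z. dg 1 (x + d e x z) - (\<Sum>m<3. dg (1 + m) x / fact m * d e x z ^ m))"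
  define s where "s = (\<lambda>e x z. dg 1 (x + d e x z) - (\<Sum>m<2. dg (1 + m) x / fact m * d e x z ^ m))"
  define q where "q = (\<lambda>e x z. dg 1 (x + d e x z) - (\<Sum>m<1. dg (1 + m) x / fact m * d e x z ^ m))"
  define c where "c = (\<lambda>e x (z::real). - (1/2) * (e\<^sup>2 * dg 1 x))"
  have r0: "growth 4 r0" and r1: "growth 3 r1" and s: "growth 2 s" and q: "growth 1 q"
    unfolding r0_def r1_def s_def q_def by (intro growth_taylor d)+
  have c: "growth 2 c" unfolding c_def by (rule d')
  note ez = growth_ez
  have 1: "growth 4 (\<lambda>e x z. 1/2 * (d e x z * r1 e x z))"
    using growth_mult[OF d r1] by (intro growth_cmult) simp
  \<comment> \<open>The trapezoidal error gives g''' D^3 / 12. The factorised difference of the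
    cubes of D and e z, with c = D - e z of order 2, exchanges D for e z.\<close>
  have 2: "growth 4 (\<lambda>e x z. 1/12 * (dg 3 x * (c e x z * (d e x z ^ 2 + d e x z * (e * z) + (e * z) ^ 2))))"
  proof (intro growth_cmult)
    have "growth 2 (\<lambda>e x z. d e x z ^ 2 + d e x z * (e * z) + (e * z) ^ 2)"
      using growth_power[OF d, of 2] growth_power[OF ez, of 2] growth_mult[OF d ez]
      by (intro growth_add) (simp_all only: mult_1 one_add_one)
    from growth_mult[OF growth_dg[of 3] growth_mult[OF c this]]
    show "growth 4 (\<lambda>e x z. dg 3 x * (c e x z * (d e x z ^ 2 + d e x z * (e * z) + (e * z) ^ 2)))"
      by simp
  qed
  \<comment> \<open>With q = g' y - g' x, the e^2 term of the log ratio equals - e^2 (2 g' x q +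
    q^2) / 8. The part e z g'' x of q belongs to \<open>lead\<close>; what is left of q is g'' x * c
    + s.\<close>
  have 3: "growth 4 (\<lambda>e x z. 1/4 * (e ^ 2 * (dg 1 x * (dg 2 x * c e x z + s e x z))))"
  proof (intro growth_cmult)
    have "growth 2 (\<lambda>e x z. dg 2 x * c e x z + s e x z)"
      using growth_mult[OF growth_dg[of 2] c] s by (intro growth_add) (simp_all only: add_0)
    from growth_emult[OF growth_mult[OF growth_dg[of 1] this], of 2]
    show "growth 4 (\<lambda>e x z. (e ^ 2 * (dg 1 x * (dg 2 x * c e x z + s e x z))))" by simp
  qed
  have 4: "growth 4 (\<lambda>e x z. 1/8 * (e ^ 2 * q e x z ^ 2))"
    using growth_emult[OF growth_power[OF q, of 2], of 2] by (intro growth_cmult) simp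
  have "growth 4 (\<lambda>e x z. - r0 e x z + 1/2 * (d e x z * r1 e x z)
     + 1/12 * (dg 3 x * (c e x z * (d e x z ^ 2 + d e x z * (e * z) + (e * z) ^ 2)))
     - 1/4 * (e ^ 2 * (dg 1 x * (dg 2 x * c e x z + s e x z)))
     - 1/8 * (e ^ 2 * q e x z ^ 2))"
    by (intro growth_add growth_diff growth_minus r0 1 2 3 4)
  then show ?thesis
  proof (rule growth_cong)
    fix e x z :: real assume e: "0 < e" "e \<le> 1"
    define D where "D = d e x z"
    define y where "y = prop1 SLA g e x z"
    have y: "y = x + D" by (simp add: D_def d_def y_def)
    have Dc: "D = e * z + c e x z" by (simp add: D_def d_eq c_def)
    have R0: "r0 e x z = g y - (g x + dg 1 x * D + dg 2 x / 2 * D ^ 2 + dg 3 x / 6 * D ^ 3)"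
      unfolding r0_def D_def[symmetric] y
      by (simp add: eval_nat_numeral)
    have R1: "r1 e x z = dg 1 y - (dg 1 x + dg 2 x * D + dg 3 x / 2 * D ^ 2)"
      unfolding r1_def D_def[symmetric] y
      by (simp add: eval_nat_numeral)
    have S: "s e x z = dg 1 y - (dg 1 x + dg 2 x * D)"
      unfolding s_def D_def[symmetric] y
      by (simp add: eval_nat_numeral)
    have Q: "q e x z = dg 1 y - dg 1 x"
      unfolding q_def D_def[symmetric] y
      by simp
    have L: "logratio SLA g e x z = g x - g y + D * (dg 1 x + dg 1 y) / 2
     + e\<^sup>2 / 8 * ((dg 1 x)\<^sup>2 - (dg 1 y)\<^sup>2)"
      using logratio_SLA[OF e(1), of x z] unfolding y_def[symmetric] by (simp add: y)
    have cc: "c e x z = D - e * z" using Dc by simp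
    show "logratio SLA g e x z - e ^ 3 * lead SLA g x z =
      - r0 e x z + 1/2 * (d e x z * r1 e x z)
     + 1/12 * (dg 3 x * (c e x z * (d e x z ^ 2 + d e x z * (e * z) + (e * z) ^ 2)))
     - 1/4 * (e ^ 2 * (dg 1 x * (dg 2 x * c e x z + s e x z)))
     - 1/8 * (e ^ 2 * q e x z ^ 2)"
      unfolding L D_def[symmetric] R0 R1 S Q cc lead_def algorithm.case dg_1[symmetric]
      by (simp add: algebra_simps power2_eq_square power3_eq_cube add_divide_distrib diff_divide_distrib)
  qed
qed

lemma growth_logratio: "growth (Suc (lead_order alg)) (\<lambda>e x z. logratio alg g e x z - e ^ lead_order alg * lead alg g x z)"
  using growth_logratio_RWM growth_logratio_SLA
  by (cases alg) (simp_all add: lead_order_def numeral_2_eq_2 eval_nat_numeral)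

lemma growth_logratio': "growth (lead_order alg) (logratio alg g)"
proof -
  have "growth (lead_order alg) (\<lambda>e x z. (logratio alg g e x z - e ^ lead_order alg * lead alg g x z) + e ^ lead_order alg * lead alg g x z)"
    using growth_emult[OF growth_lead[of alg], of "lead_order alg"]
    by (intro growth_add growth_weaken[OF growth_logratio]) auto
  then show ?thesis by simp
qed

lemma mean1_measurable [measurable]: "mean1 alg g e \<in> borel_measurable borel"
  unfolding mean1_def by (cases alg) simp_all

lemma prop1_measurable [measurable (raw)]:
  assumes [measurable]: "h \<in> borel_measurable M" "k \<in> borel_measurable M"
  shows "(\<lambda>w. prop1 alg g e (h w) (k w)) \<in> borel_measurable M"
  unfolding prop1_def by measurable

lemma logratio_measurable [measurable (raw)]:
  assumes [measurable]: "h \<in> borel_measurable M" "k \<in> borel_measurable M"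
  shows "(\<lambda>w. logratio alg g e (h w) (k w)) \<in> borel_measurable M"
  unfolding logratio_def by measurable

lemma lead_measurable [measurable (raw)]:
  assumes [measurable]: "h \<in> borel_measurable M" "k \<in> borel_measurable M"
  shows "(\<lambda>w. lead alg g (h w) (k w)) \<in> borel_measurable M"
  unfolding lead_def by (cases alg) (simp_all, measurable)

end

section \<open>Integration by parts and the limiting constants\<close>

text \<open>Finite moments give integrability but no pointwise decay, so the decay is derived:
  u(t)(1 + t^2) has an integrable derivative and is therefore bounded, whence u vanishes at both
  ends like 1 / t^2.\<close>

lemma deriv_integral_zero:
  fixes u u' w' :: "real \<Rightarrow> real"
  assumes u: "\<And>t. (u has_real_derivative u' t) (at t)" "\<And>t. isCont u' t" "integrable lborel u'"
    and w: "\<And>t. ((\<lambda>t. u t * (1 + t\<^sup>2)) has_real_derivative w' t) (at t)" "\<And>t. isCont w' t"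
      "integrable lborel w'"
  shows "integral\<^sup>L lborel u' = 0"
proof -
  define K where "K = \<bar>u 0\<bar> + (\<integral>t. \<bar>w' t\<bar> \<partial>lborel)"
  have ind: "integrable lborel (\<lambda>t. w' t * indicator {a..b} t)" for a b
    using integrable_mult_indicator[OF _ w(3), of "{a..b}"] by (simp add: mult.commute)
  have le: "\<bar>\<integral>t. w' t * indicator {a..b} t \<partial>lborel\<bar> \<le> (\<integral>t. \<bar>w' t\<bar> \<partial>lborel)" for a b
  proof -
    have "\<bar>\<integral>t. w' t * indicator {a..b} t \<partial>lborel\<bar> \<le> (\<integral>t. \<bar>w' t * indicator {a..b} t\<bar> \<partial>lborel)"
      by (rule integral_abs_bound)
    also have "\<dots> \<le> (\<integral>t. \<bar>w' t\<bar> \<partial>lborel)"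
      using w(3) ind by (intro integral_mono) (auto simp: indicator_def)
    finally show ?thesis .
  qed
  have decay: "\<bar>u t\<bar> \<le> K / (1 + t\<^sup>2)" for t
  proof -
    have pos: "1 + t\<^sup>2 > 0"
      by (simp add: add_pos_nonneg)
    have "\<bar>u t * (1 + t\<^sup>2) - u 0 * (1 + 0\<^sup>2)\<bar> \<le> (\<integral>t. \<bar>w' t\<bar> \<partial>lborel)"
    proof (cases "t \<ge> 0")
      case True
      from integral_FTC_Icc_real[OF this w(1) w(2)] le[of 0 t] show ?thesis by simp
    next
      case False
      then have "t \<le> 0" by simp
      from integral_FTC_Icc_real[OF this w(1) w(2)] le[of t 0] show ?thesis by simp
    qed
    then have "\<bar>u t * (1 + t\<^sup>2)\<bar> \<le> K" unfolding K_def by (auto simp: abs_le_iff)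
    then have "\<bar>u t\<bar> * (1 + t\<^sup>2) \<le> K" using pos by (simp add: abs_mult)
    then show ?thesis using pos by (simp add: pos_le_divide_eq)
  qed
  have lim0: "(\<lambda>n::nat. u (real n)) \<longlonglongrightarrow> 0" "(\<lambda>n::nat. u (- real n)) \<longlonglongrightarrow> 0"
  proof -
    have K: "(\<lambda>n::nat. K / (1 + (real n)\<^sup>2)) \<longlonglongrightarrow> 0" by real_asymp
    show "(\<lambda>n::nat. u (real n)) \<longlonglongrightarrow> 0"
      by (rule Lim_null_comparison[OF _ K]) (use decay in auto)
    show "(\<lambda>n::nat. u (- real n)) \<longlonglongrightarrow> 0"
      by (rule Lim_null_comparison[OF _ K]) (use decay[of "- real n" for n] in auto)
  qed
  have "(\<lambda>n::nat. \<integral>t. u' t * indicator {- real n..real n} t \<partial>lborel) \<longlonglongrightarrow> integral\<^sup>L lborel u'"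
  proof (rule integral_dominated_convergence[where w = "\<lambda>t. \<bar>u' t\<bar>"])
    show "AE t in lborel. (\<lambda>n. u' t * indicator {- real n..real n} t) \<longlonglongrightarrow> u' t"
    proof (rule AE_I2)
      fix t :: real
      obtain m :: nat where m: "\<bar>t\<bar> \<le> real m" using real_arch_simple by blast
      have "eventually (\<lambda>n. u' t * indicator {- real n..real n} t = u' t) sequentially"
        using eventually_ge_at_top[of m] by eventually_elim (use m in \<open>auto simp: indicator_def\<close>)
      then show "(\<lambda>n. u' t * indicator {- real n..real n} t) \<longlonglongrightarrow> u' t"
        by (rule tendsto_eventually)
    qed
  qed (use u(3) in \<open>auto simp: indicator_def\<close>)
  moreover have "(\<integral>t. u' t * indicator {- real n..real n} t \<partial>lborel) = u (real n) - u (- real n)" for n :: nat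
    by (rule integral_FTC_Icc_real[OF _ u(1) u(2)]) simp
  ultimately have "(\<lambda>n::nat. u (real n) - u (- real n)) \<longlonglongrightarrow> integral\<^sup>L lborel u'" by simp
  moreover have "(\<lambda>n::nat. u (real n) - u (- real n)) \<longlonglongrightarrow> 0"
    using tendsto_diff[OF lim0] by simp
  ultimately show ?thesis by (rule LIMSEQ_unique)
qed

section \<open>Elementary inequalities for powers, tanh and exp\<close>

lemma one_plus_power_bound: "(1 + \<bar>t::real\<bar>) ^ m \<le> 2 ^ m * (1 + \<bar>t ^ m\<bar>)"
proof -
  have "(1 + \<bar>t\<bar>) ^ m \<le> (2 * max 1 \<bar>t\<bar>) ^ m" by (intro power_mono) auto
  also have "\<dots> = 2 ^ m * max 1 \<bar>t\<bar> ^ m" by (simp add: power_mult_distrib)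
  also have "max 1 \<bar>t\<bar> ^ m \<le> 1 + \<bar>t ^ m\<bar>" by (simp add: max_def power_abs)
  finally show ?thesis by simp
qed

lemma abs_tanh_le: "\<bar>tanh x\<bar> \<le> \<bar>x :: real\<bar>"
proof -
  have "(tanh y)\<^sup>2 \<le> 1" for y :: real
    by (simp add: abs_square_le_1 abs_le_iff less_imp_le[OF tanh_real_lt_1] minus_le_iff less_imp_le[OF tanh_real_gt_neg1])
  then have "norm (tanh x - tanh 0) \<le> 1 * norm (x - 0)"
    by (intro field_differentiable_bound[of UNIV tanh "\<lambda>y. 1 - (tanh y)\<^sup>2"])
       (auto intro!: derivative_eq_intros)
  then show ?thesis by simp
qed

text \<open>The derivative of tanh y - y is -(tanh y)^2, bounded by |tanh y| and hence by |x| on the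
  interval. The quadratic order becomes the cubic error of \<open>logratio_mean\<close> after
  multiplication by the log ratio.\<close>

lemma abs_tanh_diff_le: "\<bar>tanh x - x\<bar> \<le> (x :: real)\<^sup>2"
proof -
  have "norm ((tanh x - x) - (tanh 0 - 0)) \<le> \<bar>x\<bar> * norm (x - 0)"
  proof (rule field_differentiable_bound[of "cball 0 \<bar>x\<bar>" "\<lambda>y. tanh y - y" "\<lambda>y. - (tanh y)\<^sup>2"])
    fix y :: real assume y: "y \<in> cball 0 \<bar>x\<bar>"
    have "\<bar>tanh y\<bar> \<le> 1"
      by (auto simp: abs_le_iff less_imp_le[OF tanh_real_lt_1] less_imp_le[OF tanh_real_gt_neg1] minus_le_iff)
    then have "norm (- (tanh y)\<^sup>2) \<le> \<bar>tanh y\<bar>"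
      using mult_left_le[of "\<bar>tanh y\<bar>" "\<bar>tanh y\<bar>"] by (simp add: power2_eq_square)
    then show "norm (- (tanh y)\<^sup>2) \<le> \<bar>x\<bar>" using abs_tanh_le[of y] y by simp
  qed (auto intro!: derivative_eq_intros)
  then show ?thesis by (simp add: power2_eq_square)
qed

text \<open>Feeds \<open>logratio_hellinger\<close>, where the distance of exp(r/2) from 1 has to be
  bounded below by moments of r. For r = -2v < 0 the right-hand side is v^2 - 2v^3: for v at most 1
  it lies below (v(1 - v))^2, and for v > 1 it is negative.\<close>

lemma exp_half_bound: "(1 - exp (r / 2))\<^sup>2 \<ge> r\<^sup>2 / 4 - \<bar>r :: real\<bar> ^ 3 / 4"
proof (cases "r \<ge> 0")
  case True
  have "r / 2 \<le> exp (r / 2) - 1" using exp_ge_add_one_self[of "r / 2"] by linarith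
  then have "(r / 2)\<^sup>2 \<le> (exp (r / 2) - 1)\<^sup>2" using True by (intro power_mono) auto
  then have "r\<^sup>2 / 4 \<le> (1 - exp (r / 2))\<^sup>2" by (simp add: power_divide power2_commute)
  then show ?thesis using True by (smt (verit) zero_le_power divide_nonneg_nonneg)
next
  case False
  define v where "v = - r / 2"
  have v: "v > 0" "r = - 2 * v" using False by (auto simp: v_def)
  show ?thesis
  proof (cases "v \<le> 1")
    case True
    have "exp v \<ge> 1 + v" by (rule exp_ge_add_one_self)
    then have "exp (- v) \<le> 1 / (1 + v)" using v by (simp add: exp_minus field_simps)
    then have "1 - exp (- v) \<ge> v / (1 + v)" using v by (simp add: field_simps)
    moreover have "v / (1 + v) \<ge> v * (1 - v)" using v by (simp add: field_simps)
    ultimately have "(v * (1 - v))\<^sup>2 \<le> (1 - exp (- v))\<^sup>2" using v True by (intro power_mono) auto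
    moreover have "(v * (1 - v))\<^sup>2 = v\<^sup>2 - 2 * v ^ 3 + v ^ 4"
      by (simp add: algebra_simps power2_eq_square power3_eq_cube power4_eq_xxxx)
    moreover have "v ^ 4 \<ge> 0" by simp
    ultimately have "v\<^sup>2 - 2 * v ^ 3 \<le> (1 - exp (- v))\<^sup>2" by linarith
    then show ?thesis using v by (simp add: power_mult_distrib abs_mult)
  next
    case False
    then have "v ^ 2 * 1 \<le> v ^ 2 * v" using v by (intro mult_left_mono) auto
    then have "r\<^sup>2 / 4 - \<bar>r\<bar> ^ 3 / 4 \<le> 0"
      using v by (simp add: power_mult_distrib abs_mult power3_eq_cube power2_eq_square)
    then show ?thesis by (smt (verit) zero_le_power2)
  qed
qed

section \<open>Integration against the density and the Gaussian noise; the constants K\<close>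

context smooth_density begin

abbreviation F :: "real measure" where "F \<equiv> density lborel (\<lambda>t. ennreal (f t))"
abbreviation N :: "real measure" where "N \<equiv> std_normal_distribution"
abbreviation EE :: "(real \<Rightarrow> real \<Rightarrow> real) \<Rightarrow> real" where
  "EE h \<equiv> (\<integral>w. h (fst w) (snd w) \<partial>(F \<Otimes>\<^sub>M N))"

lemma N_prob: "prob_space N"
  by (rule prob_space_normal_density) simp

sublocale FN: pair_prob_space F N
  unfolding pair_prob_space_def pair_sigma_finite_def
  using f_prob N_prob prob_space_imp_sigma_finite by blast

lemma F_integrable_base: "integrable F (\<lambda>t. (1 + \<bar>t\<bar>) ^ m)"
proof (rule Bochner_Integration.integrable_bound)
  show "integrable F (\<lambda>t. 2 ^ m * (1 + \<bar>t ^ m\<bar>))"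
    using f_moments[of m] by (intro integrable_mult_right Bochner_Integration.integrable_add integrable_abs) auto
qed (auto intro!: order_trans[OF one_plus_power_bound])

lemma N_integrable_base: "integrable N (\<lambda>t. (1 + \<bar>t\<bar>) ^ m)"
proof (rule Bochner_Integration.integrable_bound)
  interpret N: prob_space N by (rule N_prob)
  show "integrable N (\<lambda>t. 2 ^ m * (1 + \<bar>t ^ m\<bar>))"
    using integrable_std_normal_distribution_moment[of m]
    by (intro integrable_mult_right Bochner_Integration.integrable_add integrable_abs) auto
qed (auto intro!: order_trans[OF one_plus_power_bound])

lemma FN_integrable_base: "integrable (F \<Otimes>\<^sub>M N) (\<lambda>w. ((1 + \<bar>fst w\<bar>) * (1 + \<bar>snd w\<bar>)) ^ m)"
proof (rule FN.Fubini_integrable)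
  show "integrable F (\<lambda>x. \<integral>y. norm (((1 + \<bar>fst (x, y)\<bar>) * (1 + \<bar>snd (x, y)\<bar>)) ^ m) \<partial>N)"
    using F_integrable_base[of m] by (simp add: power_mult_distrib abs_mult)
  show "AE x in F. integrable N (\<lambda>y. ((1 + \<bar>fst (x, y)\<bar>) * (1 + \<bar>snd (x, y)\<bar>)) ^ m)"
    using N_integrable_base[of m] by (simp add: power_mult_distrib)
qed measurable

lemma growth_integrable:
  assumes "growth k H" "0 < e" "e \<le> 1"
    and [measurable]: "(\<lambda>w. H e (fst w) (snd w)) \<in> borel_measurable (borel \<Otimes>\<^sub>M borel)"
  shows "integrable (F \<Otimes>\<^sub>M N) (\<lambda>w. H e (fst w) (snd w))"
proof -
  obtain A m where A: "A \<ge> 0"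
    "\<And>e x z. 0 < e \<Longrightarrow> e \<le> 1 \<Longrightarrow> \<bar>H e x z\<bar> \<le> A * e ^ k * ((1 + \<bar>x\<bar>) * (1 + \<bar>z\<bar>)) ^ m"
    using growthE[OF assms(1)] by blast
  show ?thesis
  proof (rule Bochner_Integration.integrable_bound)
    show "integrable (F \<Otimes>\<^sub>M N) (\<lambda>w. (A * e ^ k) * ((1 + \<bar>fst w\<bar>) * (1 + \<bar>snd w\<bar>)) ^ m)"
      using FN_integrable_base[of m] by (intro integrable_mult_right) auto
  qed (use A assms(2,3) in \<open>auto intro: order_trans[OF _ abs_ge_self]\<close>)
qed

lemma growth_integrable0:
  assumes "growth 0 (\<lambda>e x z. H x z)" "(\<lambda>w. H (fst w) (snd w)) \<in> borel_measurable (borel \<Otimes>\<^sub>M borel)"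
  shows "integrable (F \<Otimes>\<^sub>M N) (\<lambda>w. H (fst w) (snd w))"
  using growth_integrable[OF assms(1), of 1] assms(2) by simp

text \<open>Turns orders in e into bounds on expectations: all moments of the density and of the
  Gaussian are finite, so the polynomial factor integrates to a constant independent of e.\<close>

lemma growth_integral:
  assumes "growth k H"
    and [measurable]: "\<And>e. (\<lambda>w. H e (fst w) (snd w)) \<in> borel_measurable (borel \<Otimes>\<^sub>M borel)"
  shows "\<exists>D\<ge>0. \<forall>e. 0 < e \<longrightarrow> e \<le> 1 \<longrightarrow> EE (\<lambda>x z. \<bar>H e x z\<bar>) \<le> D * e ^ k"
proof -
  obtain A m where A: "A \<ge> 0"
    "\<And>e x z. 0 < e \<Longrightarrow> e \<le> 1 \<Longrightarrow> \<bar>H e x z\<bar> \<le> A * e ^ k * ((1 + \<bar>x\<bar>) * (1 + \<bar>z\<bar>)) ^ m"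
    using growthE[OF assms(1)] by blast
  let ?I = "\<integral>w. ((1 + \<bar>fst w\<bar>) * (1 + \<bar>snd w\<bar>)) ^ m \<partial>(F \<Otimes>\<^sub>M N)"
  have I: "?I \<ge> 0" by (rule integral_nonneg_AE) auto
  show ?thesis
  proof (intro exI[of _ "A * ?I"] conjI allI impI)
    show "0 \<le> A * ?I" using A I by simp
    fix e :: real assume e: "0 < e" "e \<le> 1"
    have "EE (\<lambda>x z. \<bar>H e x z\<bar>) \<le> (\<integral>w. (A * e ^ k) * ((1 + \<bar>fst w\<bar>) * (1 + \<bar>snd w\<bar>)) ^ m \<partial>(F \<Otimes>\<^sub>M N))"
      using growth_integrable[OF assms(1) e] FN_integrable_base[of m] A e
      by (intro integral_mono integrable_abs integrable_mult_right) auto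
    then show "EE (\<lambda>x z. \<bar>H e x z\<bar>) \<le> A * ?I * e ^ k"
      by (simp add: mult_ac)
  qed
qed

lemma growth_integrable_F:
  assumes "growth 0 (\<lambda>e x z. h x)" and [measurable]: "h \<in> borel_measurable borel"
  shows "integrable F h"
proof -
  obtain A m where A: "A \<ge> 0"
    "\<And>e x z. 0 < e \<Longrightarrow> e \<le> 1 \<Longrightarrow> \<bar>h x\<bar> \<le> A * e ^ 0 * ((1 + \<bar>x\<bar>) * (1 + \<bar>z :: real\<bar>)) ^ m"
    using growthE[OF assms(1)] by blast
  show ?thesis
  proof (rule Bochner_Integration.integrable_bound)
    show "integrable F (\<lambda>t. A * (1 + \<bar>t\<bar>) ^ m)"
      using F_integrable_base by (intro integrable_mult_right) auto
    show "AE x in F. norm (h x) \<le> norm (A * (1 + \<bar>x\<bar>) ^ m)"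
      using A(2)[of 1 _ 0] by (auto intro: order_trans[OF _ abs_ge_self])
  qed simp
qed

text \<open>Since f' = - g' f, the function f (h' - g' h) is the derivative of f h. Its integral
  vanishes by \<open>deriv_integral_zero\<close>, whose two integrability conditions follow from
  polynomial growth and the moments of f.\<close>

lemma integral_by_parts_F:
  assumes h: "\<And>t. (h has_real_derivative h' t) (at t)" "\<And>t. isCont h' t"
    and gr: "growth 0 (\<lambda>e x z. h x)" "growth 0 (\<lambda>e x z. h' x)"
  shows "(\<integral>t. deriv g t * h t \<partial>F) = (\<integral>t. h' t \<partial>F)"
proof -
  have ch: "isCont h t" for t using h(1) DERIV_isCont by blast
  have [measurable]: "h \<in> borel_measurable borel" "h' \<in> borel_measurable borel"
    by (intro borel_measurable_continuous_onI continuous_at_imp_continuous_on; simp add: ch h)+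
  have df: "(f has_real_derivative f t * (- deriv g t)) (at t)" for t
    unfolding f_eq[abs_def] using dg_deriv[of 0 t] by (auto intro!: derivative_eq_intros)
  have cf: "isCont f t" for t using df DERIV_isCont by blast
  have cg: "isCont (deriv g) t" for t using dg_isCont[where k = 1] by simp
  \<comment> \<open>\<open>f * k\<close> and \<open>f * l\<close> are the derivatives of
    \<open>f * h\<close> and of \<open>f * h * (1 + t\<^sup>2)\<close>.\<close>
  define k where "k = (\<lambda>t. h' t - deriv g t * h t)"
  define l where "l = (\<lambda>t. k t * (1 + t\<^sup>2) + 2 * t * h t)"
  have gk: "growth 0 (\<lambda>e x z. k x)"
    unfolding k_def using growth_mult[OF growth_dg[of 1] gr(1)] gr(2) by (intro growth_diff) auto
  have g2: "growth 0 (\<lambda>e x z. 1 + x\<^sup>2)"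
    using growth_power[OF growth_x, of 2] by (intro growth_add growth_const) simp
  have "growth 0 (\<lambda>e x z. 2 * (x * h x))"
    using growth_mult[OF growth_x gr(1)] by (intro growth_cmult) simp
  with growth_mult[OF gk g2] have gl: "growth 0 (\<lambda>e x z. l x)"
    unfolding l_def by (intro growth_add) (simp_all add: mult.assoc)
  have [measurable]: "k \<in> borel_measurable borel" "l \<in> borel_measurable borel"
    unfolding k_def l_def by measurable
  have int: "integrable lborel (\<lambda>t. f t * k t)" "integrable lborel (\<lambda>t. f t * l t)"
    using growth_integrable_F[OF gk] growth_integrable_F[OF gl] f_pos
    by (auto simp: integrable_density less_imp_le)
  have "(\<integral>t. f t * k t \<partial>lborel) = 0"
  proof (rule deriv_integral_zero[OF _ _ int(1) _ _ int(2)])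
    show "((\<lambda>t. f t * h t) has_real_derivative f t * k t) (at t)" for t
      by (auto intro!: derivative_eq_intros df h simp: k_def algebra_simps)
    show "((\<lambda>t. f t * h t * (1 + t\<^sup>2)) has_real_derivative f t * l t) (at t)" for t
      by (auto intro!: derivative_eq_intros df h simp: k_def l_def algebra_simps)
    show "isCont (\<lambda>t. f t * k t) t" "isCont (\<lambda>t. f t * l t) t" for t
      unfolding k_def l_def by (intro continuous_intros cf ch h cg)+
  qed
  then have "(\<integral>t. k t \<partial>F) = 0"
    using f_pos by (simp add: integral_density less_imp_le)
  moreover have "(\<integral>t. k t \<partial>F) = (\<integral>t. h' t \<partial>F) - (\<integral>t. deriv g t * h t \<partial>F)"
    unfolding k_def using growth_mult[OF growth_dg[of 1] gr(1)] gr
    by (intro Bochner_Integration.integral_diff growth_integrable_F) auto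
  ultimately show ?thesis by simp
qed

lemma EE_iterated:
  assumes "integrable (F \<Otimes>\<^sub>M N) (\<lambda>w. H (fst w) (snd w))"
  shows "EE H = (\<integral>x. \<integral>z. H x z \<partial>N \<partial>F)"
  using FN.integral_fst'[OF assms] by simp

lemma N_moments:
  "(\<integral>z. z \<partial>N) = 0" "(\<integral>z. z ^ 3 \<partial>N) = 0" "(\<integral>z. z\<^sup>2 \<partial>N) = 1" "(\<integral>z. z ^ 4 \<partial>N) = 3" "(\<integral>z. z ^ 6 \<partial>N) = 15"
  using integral_std_normal_distribution_moment_odd[of 1] integral_std_normal_distribution_moment_odd[of 3]
    std_normal_distribution_even_moments(1)[of 1]
    std_normal_distribution_even_moments(1)[of 2] std_normal_distribution_even_moments(1)[of 3]
  by (simp_all add: fact_numeral)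

lemma N_integrable_power: "integrable N (\<lambda>z. z ^ k)" "integrable N (\<lambda>z. z)"
  using integrable_std_normal_distribution_moment[of k] integrable_std_normal_distribution_moment[of 1] by auto

text \<open>\<open>lead\<close> is an odd polynomial in the noise. The centring holds for every
  state, which is more than a vanishing mean; \<open>psi_square_bound\<close> depends on it.\<close>

lemma lead_mean_zero: "(\<integral>z. lead alg g x z \<partial>N) = 0"
  by (cases alg) (simp_all add: lead_def N_moments N_integrable_power)

definition Kc :: "algorithm \<Rightarrow> real" where "Kc alg = EE (\<lambda>x z. (lead alg g x z)\<^sup>2)"

lemma growth_lead2: "growth 0 (\<lambda>e x z. (lead alg g x z)\<^sup>2)"
  using growth_power[OF growth_lead, of 2] by simp

lemma Kc_iterated: "Kc alg = (\<integral>x. \<integral>z. (lead alg g x z)\<^sup>2 \<partial>N \<partial>F)"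
  unfolding Kc_def by (intro EE_iterated growth_integrable0 growth_lead2) measurable

lemma Kc_RWM: "Kc RWM = K_RWM f g"
  unfolding Kc_iterated K_RWM_def E_dens_def by (simp add: lead_def power_mult_distrib N_moments)

lemma lead_SLA_second_moment:
  "(\<integral>z. (lead SLA g x z)\<^sup>2 \<partial>N) =
     5 / 48 * (dg 3 x)\<^sup>2 - 1 / 8 * (dg 1 x * dg 2 x * dg 3 x) + 1 / 16 * (dg 1 x * (dg 1 x * (dg 2 x)\<^sup>2))"
proof -
  have "(\<lambda>z. (lead SLA g x z)\<^sup>2) = (\<lambda>z. (dg 3 x)\<^sup>2 / 144 * z ^ 6 - dg 1 x * dg 2 x * dg 3 x / 24 * z ^ 4
    + dg 1 x * (dg 1 x * (dg 2 x)\<^sup>2) / 16 * z\<^sup>2)"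
    by (simp add: lead_def power2_diff power_mult_distrib power_divide fun_eq_iff)
       (simp add: power2_eq_square power3_eq_cube power4_eq_xxxx eval_nat_numeral algebra_simps)
  then show ?thesis
    by (simp add: N_integrable_power N_moments)
qed

lemma growth_dgs:
  "growth 0 (\<lambda>e x z. dg i x * dg j x)" "growth 0 (\<lambda>e x z. dg i x * dg j x * dg k x)"
  "growth 0 (\<lambda>e x z. dg i x * (dg j x * dg k x))"
  "growth 0 (\<lambda>e x z. (dg i x) ^ n)" "growth 0 (\<lambda>e x z. dg i x * (dg j x) ^ n)"
  "growth 0 (\<lambda>e x z. dg i x * (dg j x * (dg k x) ^ n))"
  using growth_mult[OF growth_dg growth_dg] growth_mult[OF growth_mult[OF growth_dg growth_dg] growth_dg]
    growth_power[OF growth_dg] growth_mult[OF growth_dg growth_mult[OF growth_dg growth_dg]]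
    growth_mult[OF growth_dg growth_power[OF growth_dg]]
    growth_mult[OF growth_dg growth_mult[OF growth_dg growth_power[OF growth_dg]]]
  by simp_all

text \<open>The second moment of \<open>lead\<close> contains g' g'' g''' and (g' g'')^2, which do
  not occur in the stated constant. Integrating by parts with h = g' (g'')^2 turns the second into
  (g'')^3 + 2 g' g'' g''', and the mixed terms, with weights 2 * 1/16 and - 1/8, cancel.\<close>

lemma Kc_SLA: "Kc SLA = K_SLA f g"
proof -
  have d: "(dg 1 has_real_derivative dg 2 t) (at t)" "(dg 2 has_real_derivative dg 3 t) (at t)" for t
    using dg_deriv[of 1 t] dg_deriv[of 2 t] by (simp_all add: numeral_2_eq_2 numeral_3_eq_3)
  have i: "integrable F (\<lambda>x. (dg 3 x)\<^sup>2)" "integrable F (\<lambda>x. dg 1 x * dg 2 x * dg 3 x)"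
    "integrable F (\<lambda>x. dg 1 x * (dg 1 x * (dg 2 x)\<^sup>2))" "integrable F (\<lambda>x. (dg 2 x) ^ 3)"
    by (intro growth_integrable_F growth_dgs; simp)+
  have "(\<integral>x. deriv g x * (dg 1 x * (dg 2 x)\<^sup>2) \<partial>F) = (\<integral>x. (dg 2 x) ^ 3 + 2 * (dg 1 x * dg 2 x * dg 3 x) \<partial>F)"
  proof (rule integral_by_parts_F)
    show "((\<lambda>x. dg 1 x * (dg 2 x)\<^sup>2) has_real_derivative (dg 2 t) ^ 3 + 2 * (dg 1 t * dg 2 t * dg 3 t)) (at t)" for t
      by (rule derivative_eq_intros d refl)+ (simp add: power2_eq_square power3_eq_cube)
    show "isCont (\<lambda>t. (dg 2 t) ^ 3 + 2 * (dg 1 t * dg 2 t * dg 3 t)) t" for t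
      by (intro continuous_intros dg_isCont)
  qed (intro growth_add growth_cmult growth_dgs)+
  also have "\<dots> = (\<integral>x. (dg 2 x) ^ 3 \<partial>F) + 2 * (\<integral>x. dg 1 x * dg 2 x * dg 3 x \<partial>F)"
    using i by (subst Bochner_Integration.integral_add) auto
  finally have *: "(\<integral>x. dg 1 x * (dg 1 x * (dg 2 x)\<^sup>2) \<partial>F) = \<dots>" by simp
  have "Kc SLA = 5 / 48 * (\<integral>x. (dg 3 x)\<^sup>2 \<partial>F) - 1 / 8 * (\<integral>x. dg 1 x * dg 2 x * dg 3 x \<partial>F)
     + 1 / 16 * (\<integral>x. dg 1 x * (dg 1 x * (dg 2 x)\<^sup>2) \<partial>F)"
    unfolding Kc_iterated lead_SLA_second_moment using i by simp
  also have "\<dots> = 5 / 48 * (\<integral>x. (dg 3 x)\<^sup>2 \<partial>F) + 1 / 16 * (\<integral>x. (dg 2 x) ^ 3 \<partial>F)"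
    unfolding * by (simp add: algebra_simps)
  also have "\<dots> = K_SLA f g"
    unfolding K_SLA_def E_dens_def using i by simp
  finally show ?thesis .
qed

text \<open>Shows that g' cannot vanish almost everywhere, the contradiction sought in
  \<open>Kc_pos\<close>.\<close>

lemma E_deriv_g_x: "(\<integral>x. deriv g x * x \<partial>F) = 1"
proof -
  have "(\<integral>x. deriv g x * x \<partial>F) = (\<integral>x. 1 \<partial>F)"
    by (rule integral_by_parts_F) (auto intro: growth_x growth_const)
  also have "\<dots> = 1" using FN.M1.prob_space by simp
  finally show ?thesis .
qed

text \<open>A vanishing constant would leave no decay rate in \<open>logratio_hellinger\<close>. It
  would force E (g')^2 = 0: at once for RWM, and for SLA through a sum of squares and two
  integrations by parts.\<close>

lemma Kc_pos: "Kc alg > 0"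
proof (rule ccontr)
  assume "\<not> Kc alg > 0"
  have K0: "Kc alg \<ge> 0" unfolding Kc_def by (rule integral_nonneg_AE) auto
  with \<open>\<not> Kc alg > 0\<close> have z: "Kc alg = 0" by simp
  have not_AE: "\<not> (AE x in F. deriv g x = 0)"
  proof
    assume "AE x in F. deriv g x = 0"
    then have "(\<integral>x. deriv g x * x \<partial>F) = (\<integral>x. 0 \<partial>F)" by (intro integral_cong_AE) auto
    then show False using E_deriv_g_x by simp
  qed
  show False
  proof (cases alg)
    case RWM
    with z have "(\<integral>x. (dg 1 x) ^ 2 \<partial>F) = 0" by (simp add: Kc_RWM K_RWM_def E_dens_def)
    moreover have "integrable F (\<lambda>x. (dg 1 x)^2)" by (intro growth_integrable_F growth_dgs) simp
    ultimately have "AE x in F. (dg 1 x) ^ 2 = 0" by (subst (asm) integral_nonneg_eq_0_iff_AE) auto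
    then show False using not_AE by simp
  next
    case SLA
    have d: "(dg 1 has_real_derivative dg 2 t) (at t)" "(dg 2 has_real_derivative dg 3 t) (at t)" for t
      using dg_deriv[of 1 t] dg_deriv[of 2 t] by (simp_all add: numeral_2_eq_2 numeral_3_eq_3)
    define q where "q = (\<lambda>x. 5 / 48 * (dg 3 x)\<^sup>2 - 1 / 8 * (dg 1 x * dg 2 x * dg 3 x)
       + 1 / 16 * (dg 1 x * (dg 1 x * (dg 2 x)\<^sup>2)))"
    \<comment> \<open>Completing the square, with 5/48 = 1/16 + 1/24. Both squares must then vanish
      almost everywhere.\<close>
    have q: "q x = 1 / 16 * (dg 1 x * dg 2 x - dg 3 x)\<^sup>2 + 1 / 24 * (dg 3 x)\<^sup>2" for x
      unfolding q_def by (simp add: field_simps power2_eq_square)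
    have "(\<integral>x. q x \<partial>F) = 0" using z unfolding SLA Kc_iterated lead_SLA_second_moment q_def .
    moreover have "integrable F q" unfolding q_def
      by (intro growth_integrable_F growth_add growth_diff growth_cmult growth_dgs) auto
    moreover have "q x \<ge> 0" for x unfolding q by simp
    ultimately have "AE x in F. q x = 0" by (subst (asm) integral_nonneg_eq_0_iff_AE) auto
    then have ae: "AE x in F. dg 3 x = 0 \<and> dg 1 x * dg 2 x = 0"
    proof eventually_elim
      case (elim x)
      then show ?case
        unfolding q by (auto simp: add_nonneg_eq_0_iff)
    qed
    have i: "integrable F (\<lambda>x. dg 2 x)" "integrable F (\<lambda>x. x * dg 3 x)" "integrable F (\<lambda>x. (dg 1 x)^2)"
      using growth_mult[OF growth_x growth_dg[of 3]] by (intro growth_integrable_F growth_dgs growth_dg; simp)+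
    \<comment> \<open>Testing with x g'' leaves E g'' alone, since g' g'' and g''' vanish almost
      everywhere; E (g')^2 = E g'' then finishes.\<close>
    have "(\<integral>x. deriv g x * (x * dg 2 x) \<partial>F) = (\<integral>x. dg 2 x + x * dg 3 x \<partial>F)"
    proof (rule integral_by_parts_F)
      show "((\<lambda>x. x * dg 2 x) has_real_derivative dg 2 t + t * dg 3 t) (at t)" for t
        by (rule derivative_eq_intros d refl)+ simp
      show "isCont (\<lambda>t. dg 2 t + t * dg 3 t) t" for t
        by (intro continuous_intros dg_isCont)
    qed (use growth_mult[OF growth_x growth_dg] in \<open>auto intro!: growth_add growth_dg\<close>)
    moreover have "(\<integral>x. deriv g x * (x * dg 2 x) \<partial>F) = (\<integral>x. 0 \<partial>F)"
      using ae by (intro integral_cong_AE) auto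
    moreover have "(\<integral>x. x * dg 3 x \<partial>F) = (\<integral>x. 0 \<partial>F)"
      using ae by (intro integral_cong_AE) auto
    ultimately have "(\<integral>x. dg 2 x \<partial>F) = 0" using i by simp
    moreover have "(\<integral>x. deriv g x * dg 1 x \<partial>F) = (\<integral>x. dg 2 x \<partial>F)"
      by (rule integral_by_parts_F) (intro d dg_isCont growth_dg)+
    ultimately have "(\<integral>x. (dg 1 x)^2 \<partial>F) = 0" by (simp add: power2_eq_square)
    with i(3) have "AE x in F. (dg 1 x) ^ 2 = 0" by (subst (asm) integral_nonneg_eq_0_iff_AE) auto
    then show False using not_AE by simp
  qed
qed

end

section \<open>Reversibility and the moments of the log ratio\<close>

lemma iexp_approx_1: "cmod (iexp y - (1 + \<i> * y)) \<le> y\<^sup>2 / 2"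
  using iexp_approx1[of y 1] by (simp add: numeral_2_eq_2)

lemma iexp_approx_2: "cmod (iexp y - (1 + \<i> * y - y\<^sup>2 / 2)) \<le> \<bar>y\<bar> ^ 3 / 6"
  using iexp_approx1[of y 2]
  by (simp add: numeral_2_eq_2 numeral_3_eq_3 power_mult_distrib algebra_simps)

lemma iexp_approx_0: "cmod (iexp y - 1) \<le> \<bar>y\<bar>"
  using iexp_approx1[of y 0] by simp

context smooth_density begin

text \<open>The substitution y = mean + e z replaces the noise by the proposal. Over the plane, the
  arguments of the joint density can be exchanged by Fubini's theorem, and nonnegative integrals
  avoid integrability conditions on H.\<close>

lemma nn_integral_proposal:
  assumes [measurable]: "(\<lambda>w. H (fst w) (snd w)) \<in> borel_measurable (borel \<Otimes>\<^sub>M borel)" and e: "e > 0"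
  shows "(\<integral>\<^sup>+w. H (fst w) (prop1 alg g e (fst w) (snd w)) \<partial>(F \<Otimes>\<^sub>M N)) =
    (\<integral>\<^sup>+x. \<integral>\<^sup>+y. ennreal (f x * normal_density (mean1 alg g e x) e y) * H x y \<partial>lborel \<partial>lborel)"
proof -
  have [measurable]: "(\<lambda>w. H (h w) (k w)) \<in> borel_measurable M"
    if "h \<in> borel_measurable M" "k \<in> borel_measurable M" for h k and M :: "'c measure"
    using measurable_compose[OF measurable_Pair[OF that] assms(1)] by simp
  have inner: "(\<integral>\<^sup>+z. H x (prop1 alg g e x z) \<partial>N) =
      (\<integral>\<^sup>+y. ennreal (normal_density (mean1 alg g e x) e y) * H x y \<partial>lborel)" for x
  proof -
    let ?m = "mean1 alg g e x"
    have d: "e * normal_density ?m e (?m + e * z) = std_normal_density z" for z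
      using e by (simp add: normal_density_def real_sqrt_mult power_mult_distrib)
    have "(\<integral>\<^sup>+y. ennreal (normal_density ?m e y) * H x y \<partial>lborel) =
      ennreal \<bar>e\<bar> * (\<integral>\<^sup>+z. ennreal (normal_density ?m e (?m + e * z)) * H x (?m + e * z) \<partial>lborel)"
      using e by (subst nn_integral_real_affine[where c = e and t = ?m]) auto
    also have "\<dots> = (\<integral>\<^sup>+z. ennreal \<bar>e\<bar> * (ennreal (normal_density ?m e (?m + e * z)) * H x (?m + e * z)) \<partial>lborel)"
      by (subst nn_integral_cmult) auto
    also have "\<dots> = (\<integral>\<^sup>+z. ennreal (std_normal_density z) * H x (?m + e * z) \<partial>lborel)"
      using e by (intro nn_integral_cong)
        (simp add: mult.assoc[symmetric] ennreal_mult[symmetric] d)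
    also have "\<dots> = (\<integral>\<^sup>+z. H x (prop1 alg g e x z) \<partial>N)"
      by (subst nn_integral_density) (auto simp: prop1_def)
    finally show ?thesis ..
  qed
  have "(\<integral>\<^sup>+w. H (fst w) (prop1 alg g e (fst w) (snd w)) \<partial>(F \<Otimes>\<^sub>M N)) =
      (\<integral>\<^sup>+x. \<integral>\<^sup>+z. H x (prop1 alg g e x z) \<partial>N \<partial>F)"
    by (subst FN.M2.nn_integral_fst[symmetric]) auto
  also have "\<dots> = (\<integral>\<^sup>+x. ennreal (f x) * (\<integral>\<^sup>+y. ennreal (normal_density (mean1 alg g e x) e y) * H x y \<partial>lborel) \<partial>lborel)"
    unfolding inner by (subst nn_integral_density) (auto simp: normal_density_def)
  also have "\<dots> = (\<integral>\<^sup>+x. \<integral>\<^sup>+y. ennreal (f x * normal_density (mean1 alg g e x) e y) * H x y \<partial>lborel \<partial>lborel)"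
    by (intro nn_integral_cong, subst nn_integral_cmult[symmetric])
       (auto simp: ennreal_mult' f_pos less_imp_le mult.assoc)
  finally show ?thesis .
qed

text \<open>Exchanging the current state with the proposal reverses the sign of the log ratio.\<close>

lemma logratio_swap:
  assumes [measurable]: "H \<in> borel_measurable borel" and e: "e > 0"
  shows "(\<integral>\<^sup>+w. H (logratio alg g e (fst w) (snd w)) \<partial>(F \<Otimes>\<^sub>M N)) =
    (\<integral>\<^sup>+w. ennreal (exp (logratio alg g e (fst w) (snd w))) * H (- logratio alg g e (fst w) (snd w)) \<partial>(F \<Otimes>\<^sub>M N))"
proof -
  define r where "r = (\<lambda>x y. g x - g y + ((y - mean1 alg g e x) / e)\<^sup>2 / 2 - ((x - mean1 alg g e y) / e)\<^sup>2 / 2)"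
  define p where "p = (\<lambda>x y. f x * normal_density (mean1 alg g e x) e y)"
  have [measurable]: "(\<lambda>w. r (h w) (k w)) \<in> borel_measurable M" "(\<lambda>w. p (h w) (k w)) \<in> borel_measurable M"
    if [measurable]: "h \<in> borel_measurable M" "k \<in> borel_measurable M" for h k and M :: "'c measure"
    unfolding r_def p_def normal_density_def by measurable
  have lr: "logratio alg g e x z = r x (prop1 alg g e x z)" for x z
    using e by (simp add: logratio_def r_def prop1_def)
  have r_anti: "r y x = - r x y" for x y by (simp add: r_def)
  \<comment> \<open>\<open>r\<close> is the logarithm of p(y, x) / p(x, y); the normalising
    constants of the two Gaussians agree because the step size does not depend on the state.\<close>
  have p_swap: "p y x = p x y * exp (r x y)" for x y
    using e by (simp add: p_def r_def f_eq normal_density_def exp_add[symmetric] power_divide)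
  have p_nn: "p x y \<ge> 0" for x y using f_pos[of x] by (simp add: p_def)
  have "(\<integral>\<^sup>+w. H (logratio alg g e (fst w) (snd w)) \<partial>(F \<Otimes>\<^sub>M N)) =
     (\<integral>\<^sup>+x. \<integral>\<^sup>+y. ennreal (p x y) * H (r x y) \<partial>lborel \<partial>lborel)"
    unfolding lr p_def by (rule nn_integral_proposal[OF _ e]) measurable
  also have "\<dots> = (\<integral>\<^sup>+y. \<integral>\<^sup>+x. ennreal (p x y) * H (r x y) \<partial>lborel \<partial>lborel)"
    by (rule lborel_pair.Fubini'[symmetric]) measurable
  also have "\<dots> = (\<integral>\<^sup>+x. \<integral>\<^sup>+y. ennreal (p x y) * (ennreal (exp (r x y)) * H (- r x y)) \<partial>lborel \<partial>lborel)"
    by (subst p_swap, subst r_anti) (simp add: ennreal_mult p_nn mult.assoc)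
  also have "\<dots> = (\<integral>\<^sup>+w. ennreal (exp (logratio alg g e (fst w) (snd w))) * H (- logratio alg g e (fst w) (snd w)) \<partial>(F \<Otimes>\<^sub>M N))"
    unfolding lr p_def
    by (rule nn_integral_proposal[OF _ e, where H = "\<lambda>x y. ennreal (exp (r x y)) * H (- r x y)", symmetric]) measurable
  finally show ?thesis .
qed

text \<open>The exchange applied to H = 1. Unit mean of exp R is the normalisation behind the
  Hellinger identity in \<open>logratio_hellinger\<close>.\<close>

lemma exp_logratio: "e > 0 \<Longrightarrow>
    (\<integral>\<^sup>+w. ennreal (exp (logratio alg g e (fst w) (snd w))) \<partial>(F \<Otimes>\<^sub>M N)) = 1"
  using logratio_swap[of "\<lambda>_. 1" e alg] FN.P.emeasure_space_1 by simp

lemma logratio_power: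
  "growth (lead_order alg * k) (\<lambda>e x z. logratio alg g e x z ^ k)"
  by (rule growth_power[OF growth_logratio'])

lemma logratio_power_integrable:
  "0 < e \<Longrightarrow> e \<le> 1 \<Longrightarrow> integrable (F \<Otimes>\<^sub>M N) (\<lambda>w. logratio alg g e (fst w) (snd w) ^ k)"
  by (rule growth_integrable[OF logratio_power]) measurable

text \<open>The function \<open>h r = r * (1 + tanh (r / 2))\<close> satisfies \<open>exp r * h (- r) = - h r\<close>, so that
  \<open>logratio_swap\<close> makes its expectation vanish; moreover \<open>h r = r + r^2 / 2 + O(r^3)\<close>.\<close>

lemma logratio_mean:
  assumes e: "0 < e" "e \<le> 1"
  shows "\<bar>EE (logratio alg g e) + EE (\<lambda>x z. (logratio alg g e x z)\<^sup>2) / 2\<bar>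
     \<le> EE (\<lambda>x z. \<bar>logratio alg g e x z ^ 3\<bar>)"
proof -
  let ?R = "\<lambda>w. logratio alg g e (fst w) (snd w)"
  define h where "h = (\<lambda>r::real. r * (1 + tanh (r / 2)))"
  have h_anti: "exp r * h (- r) = - h r" for r
  proof -
    have "exp r * (1 - tanh (r / 2)) = 1 + tanh (r / 2)"
      unfolding tanh_real_altdef by (simp add: field_simps exp_minus add_pos_pos[THEN less_imp_neq, THEN not_sym])
    then have "- r * (exp r * (1 - tanh (r / 2))) = - r * (1 + tanh (r / 2))" by (simp only:)
    then show ?thesis by (simp add: h_def mult.left_commute)
  qed
  have tanh_meas: "(tanh :: real \<Rightarrow> real) \<in> borel_measurable borel"
    unfolding tanh_real_altdef[abs_def] by measurable
  have [measurable]: "h \<in> borel_measurable borel"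
    unfolding h_def using tanh_meas by measurable
  \<comment> \<open>\<open>ennreal\<close> truncates negative values, so the integrals of
    \<open>ennreal (h R)\<close> and \<open>ennreal (- h R)\<close> are those of the positive and
    the negative part. Their equality makes the expectation of h R vanish.\<close>
  have "(\<integral>\<^sup>+w. ennreal (h (?R w)) \<partial>(F \<Otimes>\<^sub>M N)) = (\<integral>\<^sup>+w. ennreal (exp (?R w)) * ennreal (h (- ?R w)) \<partial>(F \<Otimes>\<^sub>M N))"
    using e by (intro logratio_swap) auto
  also have "\<dots> = (\<integral>\<^sup>+w. ennreal (- h (?R w)) \<partial>(F \<Otimes>\<^sub>M N))"
    by (simp add: ennreal_mult'[symmetric] h_anti)
  finally have *: "(\<integral>\<^sup>+w. ennreal (h (?R w)) \<partial>(F \<Otimes>\<^sub>M N)) = \<dots>" .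
  have R: "integrable (F \<Otimes>\<^sub>M N) ?R" "integrable (F \<Otimes>\<^sub>M N) (\<lambda>w. (?R w)\<^sup>2)" "integrable (F \<Otimes>\<^sub>M N) (\<lambda>w. \<bar>?R w ^ 3\<bar>)"
    using logratio_power_integrable[OF e, of alg 1] logratio_power_integrable[OF e, of alg 2]
     logratio_power_integrable[OF e, of alg 3] by simp_all
  have hb: "\<bar>r + r\<^sup>2 / 2 - h r\<bar> \<le> \<bar>r ^ 3\<bar>" for r
  proof -
    have "\<bar>r + r\<^sup>2 / 2 - h r\<bar> = \<bar>r\<bar> * \<bar>tanh (r / 2) - r / 2\<bar>"
      unfolding abs_mult[symmetric] by (subst abs_minus_cancel[symmetric]) (simp add: h_def algebra_simps power2_eq_square)
    also have "\<dots> \<le> \<bar>r\<bar> * (r / 2)\<^sup>2" by (intro mult_left_mono abs_tanh_diff_le) auto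
    also have "\<dots> \<le> \<bar>r\<bar> * r\<^sup>2" by (intro mult_left_mono) (simp_all add: power_divide)
    also have "\<dots> = \<bar>r ^ 3\<bar>" by (simp add: power2_eq_square power3_eq_cube abs_mult)
    finally show ?thesis .
  qed
  have hR: "integrable (F \<Otimes>\<^sub>M N) (\<lambda>w. h (?R w))"
  proof (rule Bochner_Integration.integrable_bound)
    show "integrable (F \<Otimes>\<^sub>M N) (\<lambda>w. 2 * \<bar>?R w\<bar>)" using R by simp
    have "\<bar>h r\<bar> \<le> 2 * \<bar>r\<bar>" for r
      using tanh_real_lt_1[of "r / 2"] tanh_real_gt_neg1[of "r / 2"]
        mult_left_mono[of "\<bar>1 + tanh (r / 2)\<bar>" 2 "\<bar>r\<bar>"] by (simp add: h_def abs_mult)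
    then show "AE w in F \<Otimes>\<^sub>M N. norm (h (?R w)) \<le> norm (2 * \<bar>?R w\<bar>)" by simp
  qed measurable
  have "(\<integral>w. h (?R w) \<partial>(F \<Otimes>\<^sub>M N)) = 0"
    using real_lebesgue_integral_def[OF hR] * by simp
  then have "\<bar>EE (logratio alg g e) + EE (\<lambda>x z. (logratio alg g e x z)\<^sup>2) / 2\<bar> =
     \<bar>\<integral>w. ?R w + (?R w)\<^sup>2 / 2 - h (?R w) \<partial>(F \<Otimes>\<^sub>M N)\<bar>"
    using R hR by simp
  also have "\<dots> \<le> (\<integral>w. \<bar>?R w + (?R w)\<^sup>2 / 2 - h (?R w)\<bar> \<partial>(F \<Otimes>\<^sub>M N))"
    by (rule integral_abs_bound)
  also have "\<dots> \<le> EE (\<lambda>x z. \<bar>logratio alg g e x z ^ 3\<bar>)"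
    using R hR hb by (intro integral_mono) auto
  finally show ?thesis .
qed

text \<open>All errors are recorded at the order 2a + 1, one above the main term e^(2a). The powers
  R^3 and R^4 have orders 3a and 4a, the squared remainder 2a + 2, all at least 2a + 1 because a is
  at least 1.\<close>

lemma growth_EE_bound:
  assumes "growth k H" "k \<ge> 2 * lead_order alg + 1"
    and "\<And>e. (\<lambda>w. H e (fst w) (snd w)) \<in> borel_measurable (borel \<Otimes>\<^sub>M borel)"
  shows "\<exists>D\<ge>0. \<forall>e. 0 < e \<longrightarrow> e \<le> 1 \<longrightarrow> EE (\<lambda>x z. \<bar>H e x z\<bar>) \<le> D * e ^ (2 * lead_order alg + 1)"
  by (rule growth_integral[OF growth_weaken[OF assms(1,2)] assms(3)])

text \<open>Writing C for \<open>lead\<close>, the difference R^2 - e^(2a) C^2 factors into terms of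
  orders a + 1 and a.\<close>

lemma logratio_second_moment:
  "\<exists>D\<ge>0. \<forall>e. 0 < e \<longrightarrow> e \<le> 1 \<longrightarrow>
     \<bar>EE (\<lambda>x z. (logratio alg g e x z)\<^sup>2) - Kc alg * e ^ (2 * lead_order alg)\<bar> \<le> D * e ^ (2 * lead_order alg + 1)"
proof -
  let ?R = "logratio alg g" and ?a = "lead_order alg"
  have "growth (2 * ?a + 1) (\<lambda>e x z. (?R e x z - e ^ ?a * lead alg g x z) * (?R e x z + e ^ ?a * lead alg g x z))"
    by (rule growth_weaken[OF growth_mult[OF growth_logratio growth_add[OF growth_logratio' growth_emult[OF growth_lead, of "?a", simplified]]]]) simp
  then have g: "growth (2 * ?a + 1) (\<lambda>e x z. (?R e x z)\<^sup>2 - e ^ (2 * ?a) * (lead alg g x z)\<^sup>2)"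
  proof (rule growth_cong)
    fix e x z :: real
    have "(e ^ ?a * lead alg g x z)\<^sup>2 = e ^ (2 * ?a) * (lead alg g x z)\<^sup>2"
      by (simp add: power_mult_distrib power_mult[symmetric] mult.commute)
    then show "(?R e x z)\<^sup>2 - e ^ (2 * ?a) * (lead alg g x z)\<^sup>2 =
      (?R e x z - e ^ ?a * lead alg g x z) * (?R e x z + e ^ ?a * lead alg g x z)"
      by (simp add: power2_eq_square algebra_simps)
  qed
  obtain D where D: "D \<ge> 0" "\<And>e. 0 < e \<Longrightarrow> e \<le> 1 \<Longrightarrow>
     EE (\<lambda>x z. \<bar>(?R e x z)\<^sup>2 - e ^ (2 * ?a) * (lead alg g x z)\<^sup>2\<bar>) \<le> D * e ^ (2 * ?a + 1)"
    using growth_EE_bound[OF g] by auto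
  show ?thesis
  proof (intro exI[of _ D] conjI allI impI D(1))
    fix e :: real assume e: "0 < e" "e \<le> 1"
    have i: "integrable (F \<Otimes>\<^sub>M N) (\<lambda>w. (lead alg g (fst w) (snd w))\<^sup>2)"
      by (rule growth_integrable0[OF growth_lead2]) measurable
    have eq: "EE (\<lambda>x z. (?R e x z)\<^sup>2) - Kc alg * e ^ (2 * ?a) = EE (\<lambda>x z. (?R e x z)\<^sup>2 - e ^ (2 * ?a) * (lead alg g x z)\<^sup>2)"
      unfolding Kc_def using logratio_power_integrable[OF e, of alg 2] i by simp
    show "\<bar>EE (\<lambda>x z. (?R e x z)\<^sup>2) - Kc alg * e ^ (2 * ?a)\<bar> \<le> D * e ^ (2 * ?a + 1)"
      unfolding eq by (rule order_trans[OF integral_abs_bound D(2)[OF e]])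
  qed
qed

lemma logratio_third_moment:
  "\<exists>D\<ge>0. \<forall>e. 0 < e \<longrightarrow> e \<le> 1 \<longrightarrow>
     EE (\<lambda>x z. \<bar>logratio alg g e x z ^ 3\<bar>) \<le> D * e ^ (2 * lead_order alg + 1)"
  by (rule growth_EE_bound[OF logratio_power]) (use lead_order_pos[of alg] in auto)

lemma logratio_fourth_moment:
  "\<exists>D\<ge>0. \<forall>e. 0 < e \<longrightarrow> e \<le> 1 \<longrightarrow>
     EE (\<lambda>x z. \<bar>logratio alg g e x z ^ 4\<bar>) \<le> D * e ^ (2 * lead_order alg + 1)"
  by (rule growth_EE_bound[OF logratio_power]) (use lead_order_pos[of alg] in auto)

lemma logratio_remainder_moment:
  "\<exists>D\<ge>0. \<forall>e. 0 < e \<longrightarrow> e \<le> 1 \<longrightarrow>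
     EE (\<lambda>x z. \<bar>(logratio alg g e x z - e ^ lead_order alg * lead alg g x z)\<^sup>2\<bar>) \<le> D * e ^ (2 * lead_order alg + 1)"
  by (rule growth_EE_bound[OF growth_power[OF growth_logratio]]) auto

lemma logratio_first_moment:
  "\<exists>D\<ge>0. \<forall>e. 0 < e \<longrightarrow> e \<le> 1 \<longrightarrow> EE (\<lambda>x z. z\<^sup>2 * \<bar>logratio alg g e x z\<bar>) \<le> D * e"
proof -
  have "growth 1 (\<lambda>e x z. z\<^sup>2 * \<bar>logratio alg g e x z\<bar>)"
    by (rule growth_weaken[OF growth_mult[OF growth_power[OF growth_z] growth_abs[OF growth_logratio']]]) (use lead_order_pos[of alg] in auto)
  from growth_integral[OF this] show ?thesis by (simp add: abs_mult)
qed

definition psi :: "algorithm \<Rightarrow> real \<Rightarrow> real \<Rightarrow> real \<Rightarrow> complex" where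
  "psi alg t e x = (\<integral>z. iexp (t * logratio alg g e x z) \<partial>N)"

text \<open>The weight z^2 is the leading part of the squared jump of the observed coordinate. It
  has mean one under the Gaussian, so \<open>psiw\<close> is again a characteristic function, under
  a reweighted noise.\<close>

definition psiw :: "algorithm \<Rightarrow> real \<Rightarrow> real \<Rightarrow> real \<Rightarrow> complex" where
  "psiw alg t e x = (\<integral>z. of_real (z\<^sup>2) * iexp (t * logratio alg g e x z) \<partial>N)"

text \<open>As exp R has mean one, 1 - E exp(R/2) is half of E (1 - exp(R/2))^2. By
  \<open>exp_half_bound\<close> this is at least (E R^2 - E |R|^3) / 8, whose main term is
  \<open>Kc alg * e ^ (2 * lead_order alg) / 8\<close>.\<close>

lemma logratio_hellinger:
  "\<exists>c>0. \<exists>e0>0. e0 \<le> 1 \<and> (\<forall>e. 0 < e \<longrightarrow> e \<le> e0 \<longrightarrow>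
     (\<integral>\<^sup>+w. ennreal (exp (logratio alg g e (fst w) (snd w) / 2)) \<partial>(F \<Otimes>\<^sub>M N)) \<le> ennreal (exp (- c * e ^ (2 * lead_order alg))))"
proof -
  let ?a = "lead_order alg" let ?V = "Kc alg"
  obtain D1 where D1: "D1 \<ge> 0" "\<And>e. 0 < e \<Longrightarrow> e \<le> 1 \<Longrightarrow>
     \<bar>EE (\<lambda>x z. (logratio alg g e x z)\<^sup>2) - ?V * e ^ (2 * ?a)\<bar> \<le> D1 * e ^ (2 * ?a + 1)"
    using logratio_second_moment by blast
  obtain D2 where D2: "D2 \<ge> 0" "\<And>e. 0 < e \<Longrightarrow> e \<le> 1 \<Longrightarrow>
     EE (\<lambda>x z. \<bar>logratio alg g e x z ^ 3\<bar>) \<le> D2 * e ^ (2 * ?a + 1)"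
    using logratio_third_moment by blast
  \<comment> \<open>Half of the main term V / 8 is given up to the errors; \<open>e0\<close> is
    small enough for them not to exceed that half.\<close>
  define c where "c = ?V / 16"
  define e0 where "e0 = min 1 (?V / (2 * (D1 + D2 + 1)))"
  have e0: "e0 > 0" "e0 \<le> 1" "(D1 + D2) * e0 \<le> ?V / 2"
  proof -
    show "e0 > 0" "e0 \<le> 1" using Kc_pos[of alg] D1(1) D2(1) by (auto simp: e0_def)
    have "(D1 + D2) * e0 \<le> (D1 + D2) * (?V / (2 * (D1 + D2 + 1)))"
      unfolding e0_def using D1(1) D2(1) by (intro mult_left_mono) auto
    also have "\<dots> \<le> ?V / 2"
      using Kc_pos[of alg] D1(1) D2(1) by (simp add: field_simps)
    finally show "(D1 + D2) * e0 \<le> ?V / 2" .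
  qed
  have "c > 0" using Kc_pos by (simp add: c_def)
  moreover have "(\<integral>\<^sup>+w. ennreal (exp (logratio alg g e (fst w) (snd w) / 2)) \<partial>(F \<Otimes>\<^sub>M N)) \<le> ennreal (exp (- c * e ^ (2 * lead_order alg)))"
    if e: "0 < e" "e \<le> e0" for e
  proof -
    have e1: "0 < e" "e \<le> 1" using e e0 by auto
    let ?R = "\<lambda>w. logratio alg g e (fst w) (snd w)"
    let ?h = "\<integral>\<^sup>+w. ennreal (exp (?R w / 2)) \<partial>(F \<Otimes>\<^sub>M N)"
    let ?q = "\<integral>\<^sup>+w. ennreal ((1 - exp (?R w / 2))\<^sup>2 / 2) \<partial>(F \<Otimes>\<^sub>M N)"
    define hh :: real where "hh = 1 / 2"
    have hh: "hh \<ge> 0" by (simp add: hh_def)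
    \<comment> \<open>With x = exp(R/2), x + (1 - x)^2 / 2 = (1 + x^2) / 2. The two nonnegative
      integrals add up to 1, so both are finite.\<close>
    have "?h + ?q = (\<integral>\<^sup>+w. ennreal (exp (?R w / 2)) + ennreal ((1 - exp (?R w / 2))\<^sup>2 / 2) \<partial>(F \<Otimes>\<^sub>M N))"
      by (rule nn_integral_add[symmetric]) measurable
    also have "\<dots> = (\<integral>\<^sup>+w. ennreal hh * (1 + ennreal (exp (?R w))) \<partial>(F \<Otimes>\<^sub>M N))"
    proof (rule nn_integral_cong)
      fix w
      let ?x = "exp (?R w / 2)"
      have "exp (?R w) = ?x\<^sup>2" by (simp add: power2_eq_square exp_add[symmetric])
      then have *: "?x + (1 - ?x)\<^sup>2 / 2 = hh * (1 + exp (?R w))"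
        by (simp add: hh_def power2_eq_square field_simps)
      have "ennreal ?x + ennreal ((1 - ?x)\<^sup>2 / 2) = ennreal (?x + (1 - ?x)\<^sup>2 / 2)"
        by (rule ennreal_plus[symmetric]) simp_all
      also have "\<dots> = ennreal hh * ennreal (1 + exp (?R w))"
        unfolding * by (rule ennreal_mult) (simp_all add: hh add_nonneg_nonneg)
      also have "ennreal (1 + exp (?R w)) = 1 + ennreal (exp (?R w))" by simp
      finally show "ennreal ?x + ennreal ((1 - ?x)\<^sup>2 / 2) = ennreal hh * (1 + ennreal (exp (?R w)))" .
    qed
    also have "\<dots> = ennreal hh * (1 + 1)"
      using exp_logratio[OF e1(1), of alg] FN.P.emeasure_space_1
      by (subst nn_integral_cmult, measurable) (subst nn_integral_add, auto)
    also have "\<dots> = ennreal hh * ennreal 2" by simp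
    also have "\<dots> = ennreal 1" using hh by (subst ennreal_mult[symmetric]) (simp_all add: hh_def)
    finally have hq: "?h + ?q = ennreal 1" .
    have "?h + ?q \<noteq> \<infinity>" unfolding hq by simp
    then have hfin: "?h \<noteq> \<infinity>" "?q \<noteq> \<infinity>" by auto
    define H where "H = enn2real ?h"
    define Q where "Q = enn2real ?q"
    have HQ: "?h = ennreal H" "?q = ennreal Q" "H \<ge> 0" "Q \<ge> 0"
      using hfin by (auto simp: H_def Q_def less_top)
    have "ennreal (H + Q) = ennreal 1" using hq unfolding HQ(1,2) ennreal_plus[OF HQ(3,4), symmetric] .
    then have "H + Q = 1" using HQ(3,4) by (simp del: ennreal_1 ennreal_plus add: ennreal_inj)
    have Ri: "integrable (F \<Otimes>\<^sub>M N) (\<lambda>w. (?R w)\<^sup>2)" "integrable (F \<Otimes>\<^sub>M N) (\<lambda>w. \<bar>?R w ^ 3\<bar>)"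
      using logratio_power_integrable[OF e1, of alg 2] logratio_power_integrable[OF e1, of alg 3] by simp_all
    have eq8: "EE (\<lambda>x z. (logratio alg g e x z)\<^sup>2) / 8 - EE (\<lambda>x z. \<bar>logratio alg g e x z ^ 3\<bar>) / 8
        = (\<integral>w. (?R w)\<^sup>2 / 8 - \<bar>?R w ^ 3\<bar> / 8 \<partial>(F \<Otimes>\<^sub>M N))"
      using Ri by simp
    have "ennreal (\<integral>w. (?R w)\<^sup>2 / 8 - \<bar>?R w ^ 3\<bar> / 8 \<partial>(F \<Otimes>\<^sub>M N)) \<le> (\<integral>\<^sup>+w. ennreal ((?R w)\<^sup>2 / 8 - \<bar>?R w ^ 3\<bar> / 8) \<partial>(F \<Otimes>\<^sub>M N))"
    proof -
      have i: "integrable (F \<Otimes>\<^sub>M N) (\<lambda>w. (?R w)\<^sup>2 / 8 - \<bar>?R w ^ 3\<bar> / 8)"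
        using Ri by simp
      have "(\<integral>w. (?R w)\<^sup>2 / 8 - \<bar>?R w ^ 3\<bar> / 8 \<partial>(F \<Otimes>\<^sub>M N)) \<le> (\<integral>w. max 0 ((?R w)\<^sup>2 / 8 - \<bar>?R w ^ 3\<bar> / 8) \<partial>(F \<Otimes>\<^sub>M N))"
        using i by (intro integral_mono integrable_max) auto
      then show ?thesis
        using i nn_integral_eq_integral[of "F \<Otimes>\<^sub>M N" "\<lambda>w. max 0 ((?R w)\<^sup>2 / 8 - \<bar>?R w ^ 3\<bar> / 8)"]
        by (auto simp: ennreal_leI)
    qed
    also have "\<dots> \<le> ?q"
    proof (intro nn_integral_mono ennreal_leI)
      fix w
      show "(?R w)\<^sup>2 / 8 - \<bar>?R w ^ 3\<bar> / 8 \<le> (1 - exp (?R w / 2))\<^sup>2 / 2"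
        using exp_half_bound[of "?R w"] unfolding power_abs by linarith
    qed
    finally have "EE (\<lambda>x z. (logratio alg g e x z)\<^sup>2) / 8 - EE (\<lambda>x z. \<bar>logratio alg g e x z ^ 3\<bar>) / 8 \<le> Q"
      unfolding eq8 HQ(2) using HQ(4) by (simp only: ennreal_le_iff)
    moreover have "EE (\<lambda>x z. (logratio alg g e x z)\<^sup>2) \<ge> ?V * e ^ (2 * ?a) - D1 * e ^ (2 * ?a + 1)"
      using D1(2)[OF e1] by linarith
    moreover have "(D1 + D2) * e ^ (2 * ?a + 1) \<le> ?V / 2 * e ^ (2 * ?a)"
    proof -
      have "(D1 + D2) * e \<le> ?V / 2" using e0(3) mult_left_mono[OF e(2), of "D1 + D2"] D1(1) D2(1) by linarith
      from mult_right_mono[OF this, of "e ^ (2 * ?a)"] e show ?thesis by (simp add: mult_ac)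
    qed
    ultimately have "Q \<ge> c * e ^ (2 * ?a)"
      using D2(2)[OF e1] by (simp add: c_def algebra_simps)
    then have "H \<le> 1 + (- c * e ^ (2 * ?a))" using \<open>H + Q = 1\<close> by simp
    also have "\<dots> \<le> exp (- c * e ^ (2 * ?a))" by (rule exp_ge_add_one_self)
    finally show "?h \<le> ennreal (exp (- c * e ^ (2 * ?a)))" unfolding HQ by (rule ennreal_leI)
  qed
  ultimately show ?thesis using e0(1,2) by blast
qed

end

section \<open>Conditional characteristic functions of one coordinate\<close>

lemma (in prob_space) square_integral_le:
  fixes X :: "'a \<Rightarrow> real"
  assumes "integrable M X" "integrable M (\<lambda>x. (X x)\<^sup>2)"
  shows "(integral\<^sup>L M X)\<^sup>2 \<le> (\<integral>x. (X x)\<^sup>2 \<partial>M)"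
proof -
  define c where "c = integral\<^sup>L M X"
  have "0 \<le> (\<integral>x. (X x - c)\<^sup>2 \<partial>M)" by (rule integral_nonneg_AE) auto
  also have "(\<lambda>x. (X x - c)\<^sup>2) = (\<lambda>x. (X x)\<^sup>2 - 2 * c * X x + c\<^sup>2)"
    by (simp add: power2_diff fun_eq_iff)
  also have "(\<integral>x. (X x)\<^sup>2 - 2 * c * X x + c\<^sup>2 \<partial>M) = (\<integral>x. (X x)\<^sup>2 \<partial>M) - 2 * c * c + c\<^sup>2"
    using assms by (simp add: prob_space c_def[symmetric])
  finally show ?thesis by (simp add: c_def[symmetric] power2_eq_square)
qed

lemma cmod_square_diff_one:
  assumes "cmod z \<le> 1"
  shows "\<bar>(cmod z)\<^sup>2 - 1\<bar> \<le> 2 * cmod (z - 1)"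
proof -
  have "(cmod z)\<^sup>2 - 1 = (cmod z - 1) * (cmod z + 1)"
    by (simp add: power2_eq_square algebra_simps)
  then have "\<bar>(cmod z)\<^sup>2 - 1\<bar> = \<bar>cmod z - 1\<bar> * (cmod z + 1)"
    by (simp add: abs_mult)
  also have "\<dots> \<le> cmod (z - 1) * 2"
    using norm_triangle_ineq3[of z 1] assms by (intro mult_mono) auto
  finally show ?thesis by simp
qed

lemma cmod_square_expand: "(cmod z)\<^sup>2 = 1 + 2 * Re (z - 1) + (cmod (z - 1))\<^sup>2"
  unfolding cmod_power2 by (simp add: power2_eq_square algebra_simps)

lemma cmod_triangle3: "cmod (a + b - c) \<le> cmod a + cmod b + cmod c"
  using norm_triangle_ineq4[of "a + b" c] norm_triangle_ineq[of a b] by linarith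

context smooth_density begin

lemma growth_integrable_z:
  assumes "growth k H" "0 < e" "e \<le> 1"
    and [measurable]: "(\<lambda>z. H e x z) \<in> borel_measurable borel"
  shows "integrable N (\<lambda>z. H e x z)"
proof -
  obtain A m where A: "A \<ge> 0"
    "\<And>e x z. 0 < e \<Longrightarrow> e \<le> 1 \<Longrightarrow> \<bar>H e x z\<bar> \<le> A * e ^ k * ((1 + \<bar>x\<bar>) * (1 + \<bar>z\<bar>)) ^ m"
    using growthE[OF assms(1)] by blast
  show ?thesis
  proof (rule Bochner_Integration.integrable_bound)
    show "integrable N (\<lambda>z. (A * e ^ k * (1 + \<bar>x\<bar>) ^ m) * (1 + \<bar>z\<bar>) ^ m)"
      using N_integrable_base[of m] by (intro integrable_mult_right) auto
  qed (use A(1) A(2)[OF assms(2,3)] assms(2) in \<open>auto simp: power_mult_distrib mult.assoc\<close>)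
qed

lemma logratio_integrable_z:
  assumes "0 < e" "e \<le> 1"
  shows "integrable N (\<lambda>z. logratio alg g e x z)" "integrable N (\<lambda>z. (logratio alg g e x z) ^ k)"
    "integrable N (\<lambda>z. z\<^sup>2 * \<bar>logratio alg g e x z\<bar>)" "integrable N (\<lambda>z. lead alg g x z)"
    "integrable N (\<lambda>z. (logratio alg g e x z - e ^ lead_order alg * lead alg g x z)\<^sup>2)"
proof -
  note e = assms
  show "integrable N (\<lambda>z. logratio alg g e x z)"
    by (rule growth_integrable_z[OF growth_logratio' e]) measurable
  show "integrable N (\<lambda>z. (logratio alg g e x z) ^ k)"
    by (rule growth_integrable_z[OF logratio_power e]) measurable
  show "integrable N (\<lambda>z. z\<^sup>2 * \<bar>logratio alg g e x z\<bar>)"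
    by (rule growth_integrable_z[OF growth_mult[OF growth_power[OF growth_z] growth_abs[OF growth_logratio']] e]) measurable
  show "integrable N (\<lambda>z. lead alg g x z)"
    using growth_integrable_z[OF growth_lead e] by simp
  show "integrable N (\<lambda>z. (logratio alg g e x z - e ^ lead_order alg * lead alg g x z)\<^sup>2)"
    by (rule growth_integrable_z[OF growth_power[OF growth_logratio] e]) measurable
qed

lemma psi_measurable [measurable]:
  "psi alg t e \<in> borel_measurable borel" "psiw alg t e \<in> borel_measurable borel"
  unfolding psi_def psiw_def by measurable

lemma iexp_integrable:
  "integrable N (\<lambda>z. iexp (t * logratio alg g e x z))"
  "integrable N (\<lambda>z. of_real (z\<^sup>2) * iexp (t * logratio alg g e x z))"
proof -
  show "integrable N (\<lambda>z. iexp (t * logratio alg g e x z))"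
    by (rule FN.M2.integrable_const_bound[of _ 1]) auto
  show "integrable N (\<lambda>z. of_real (z\<^sup>2) * iexp (t * logratio alg g e x z))"
    by (rule Bochner_Integration.integrable_bound[OF N_integrable_power(1)[of 2]])
       (auto simp: norm_mult norm_power)
qed

lemma cmod_psi_le_1: "cmod (psi alg t e x) \<le> 1"
proof -
  have "cmod (psi alg t e x) \<le> (\<integral>z. cmod (iexp (t * logratio alg g e x z)) \<partial>N)"
    unfolding psi_def by (rule integral_norm_bound)
  then show ?thesis using FN.M2.prob_space by simp
qed

lemma cmod_psiw_le_1: "cmod (psiw alg t e x) \<le> 1"
proof -
  have "cmod (psiw alg t e x) \<le> (\<integral>z. cmod (of_real (z\<^sup>2) * iexp (t * logratio alg g e x z)) \<partial>N)"
    unfolding psiw_def by (rule integral_norm_bound)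
  also have "\<dots> = 1" by (simp add: norm_mult norm_power N_moments)
  finally show ?thesis .
qed

lemma psi_integrable:
  "integrable F (psi alg t e)" "integrable F (psiw alg t e)"
  "integrable F (\<lambda>x. (cmod (psi alg t e x))\<^sup>2)" "integrable F (\<lambda>x. (cmod (psiw alg t e x))\<^sup>2)"
  by (rule FN.M1.integrable_const_bound[of _ 1],
    simp_all add: cmod_psi_le_1 cmod_psiw_le_1 abs_square_le_1 power_le_one)+

text \<open>In 1 + i t m1 - t^2 m2 / 2 the mean m1 is replaced by - m2 / 2 through
  \<open>logratio_mean\<close>, so that only the second moment needs an expansion. This fixes the
  ratio between mean and variance of the limit law.\<close>

lemma psi_mean:
  "\<exists>D\<ge>0. \<forall>e. 0 < e \<longrightarrow> e \<le> 1 \<longrightarrow>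
     cmod ((\<integral>x. psi alg t e x \<partial>F) - (1 - (\<i> * t + t\<^sup>2) / 2 * (Kc alg * e ^ (2 * lead_order alg)))) \<le> D * e ^ (2 * lead_order alg + 1)"
proof -
  let ?a = "lead_order alg" and ?V = "Kc alg"
  obtain D1 where D1: "D1 \<ge> 0" "\<And>e. 0 < e \<Longrightarrow> e \<le> 1 \<Longrightarrow>
     \<bar>EE (\<lambda>x z. (logratio alg g e x z)\<^sup>2) - ?V * e ^ (2 * ?a)\<bar> \<le> D1 * e ^ (2 * ?a + 1)"
    using logratio_second_moment by blast
  obtain D2 where D2: "D2 \<ge> 0" "\<And>e. 0 < e \<Longrightarrow> e \<le> 1 \<Longrightarrow>
     EE (\<lambda>x z. \<bar>logratio alg g e x z ^ 3\<bar>) \<le> D2 * e ^ (2 * ?a + 1)"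
    using logratio_third_moment by blast
  define T where "T = \<bar>t\<bar> + t\<^sup>2"
  have T: "T \<ge> 0" by (simp add: T_def)
  \<comment> \<open>In order: the error of the mean, of the second moment, and of the Taylor
    expansion of the exponential.\<close>
  define D where "D = \<bar>t\<bar> * D2 + T / 2 * D1 + \<bar>t\<bar> ^ 3 / 6 * D2"
  show ?thesis
  proof (intro exI[of _ D] conjI allI impI)
    show "D \<ge> 0" using D1(1) D2(1) T by (simp add: D_def)
    fix e :: real assume e: "0 < e" "e \<le> 1"
    let ?R = "\<lambda>w. logratio alg g e (fst w) (snd w)"
    let ?E = "e ^ (2 * ?a + 1)"
    define m1 where "m1 = EE (logratio alg g e)"
    define m2 where "m2 = EE (\<lambda>x z. (logratio alg g e x z)\<^sup>2)"
    define m3 where "m3 = EE (\<lambda>x z. \<bar>logratio alg g e x z ^ 3\<bar>)"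
    have R: "integrable (F \<Otimes>\<^sub>M N) ?R" "integrable (F \<Otimes>\<^sub>M N) (\<lambda>w. (?R w)\<^sup>2)" "integrable (F \<Otimes>\<^sub>M N) (\<lambda>w. \<bar>?R w ^ 3\<bar>)"
      using logratio_power_integrable[OF e, of alg 1] logratio_power_integrable[OF e, of alg 2]
       logratio_power_integrable[OF e, of alg 3] by simp_all
    have Rc: "integrable (F \<Otimes>\<^sub>M N) (\<lambda>w. complex_of_real (?R w))" "integrable (F \<Otimes>\<^sub>M N) (\<lambda>w. complex_of_real ((?R w)\<^sup>2))"
      by (rule integrable_of_real[OF R(1)], rule integrable_of_real[OF R(2)])
    have iR: "integrable (F \<Otimes>\<^sub>M N) (\<lambda>w. iexp (t * ?R w))"
      by (rule FN.P.integrable_const_bound[of _ 1]) auto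
    have P: "(\<integral>x. psi alg t e x \<partial>F) = (\<integral>w. iexp (t * ?R w) \<partial>(F \<Otimes>\<^sub>M N))"
      unfolding psi_def using FN.integral_fst'[OF iR] by simp
    let ?p = "\<lambda>w. 1 + \<i> * t * complex_of_real (?R w) - t\<^sup>2 / 2 * complex_of_real ((?R w)\<^sup>2)"
    have ip: "integrable (F \<Otimes>\<^sub>M N) ?p"
      using Rc by (intro Bochner_Integration.integrable_add Bochner_Integration.integrable_diff integrable_mult_right) auto
    have Ip: "(\<integral>w. ?p w \<partial>(F \<Otimes>\<^sub>M N)) = 1 + \<i> * t * m1 - t\<^sup>2 / 2 * m2"
    proof -
      have "(\<integral>w. ?p w \<partial>(F \<Otimes>\<^sub>M N)) = (\<integral>w. 1 + \<i> * t * complex_of_real (?R w) \<partial>(F \<Otimes>\<^sub>M N))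
          - (\<integral>w. t\<^sup>2 / 2 * complex_of_real ((?R w)\<^sup>2) \<partial>(F \<Otimes>\<^sub>M N))"
        using Rc by (intro Bochner_Integration.integral_diff Bochner_Integration.integrable_add integrable_mult_right) auto
      also have "(\<integral>w. 1 + \<i> * t * complex_of_real (?R w) \<partial>(F \<Otimes>\<^sub>M N)) = 1 + \<i> * t * m1"
        using Rc FN.P.prob_space by (subst Bochner_Integration.integral_add) (auto simp: m1_def)
      also have "(\<integral>w. t\<^sup>2 / 2 * complex_of_real ((?R w)\<^sup>2) \<partial>(F \<Otimes>\<^sub>M N)) = t\<^sup>2 / 2 * m2"
        by (simp only: integral_mult_right_zero integral_complex_of_real m2_def of_real_mult)
      finally show ?thesis .
    qed
    have err: "cmod ((\<integral>x. psi alg t e x \<partial>F) - (1 + \<i> * t * m1 - t\<^sup>2 / 2 * m2)) \<le> \<bar>t\<bar> ^ 3 / 6 * m3"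
    proof -
      have "cmod ((\<integral>x. psi alg t e x \<partial>F) - (1 + \<i> * t * m1 - t\<^sup>2 / 2 * m2)) = cmod (\<integral>w. iexp (t * ?R w) - ?p w \<partial>(F \<Otimes>\<^sub>M N))"
        unfolding P Ip[symmetric] using iR ip by (subst Bochner_Integration.integral_diff) auto
      also have "\<dots> \<le> (\<integral>w. cmod (iexp (t * ?R w) - ?p w) \<partial>(F \<Otimes>\<^sub>M N))" by (rule integral_norm_bound)
      also have "\<dots> \<le> (\<integral>w. \<bar>t\<bar> ^ 3 / 6 * \<bar>?R w ^ 3\<bar> \<partial>(F \<Otimes>\<^sub>M N))"
      proof (rule integral_mono)
        fix w
        show "cmod (iexp (t * ?R w) - ?p w) \<le> \<bar>t\<bar> ^ 3 / 6 * \<bar>?R w ^ 3\<bar>"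
          using iexp_approx_2[of "t * ?R w"] by (simp add: power_mult_distrib abs_mult power_abs algebra_simps)
      qed (use R iR ip in \<open>auto intro!: integrable_norm\<close>)
      finally show ?thesis by (simp add: m3_def)
    qed
    have b1: "\<bar>m1 + m2 / 2\<bar> \<le> D2 * ?E"
      unfolding m1_def m2_def by (rule order_trans[OF logratio_mean[OF e] D2(2)[OF e]])
    have b2: "\<bar>m2 - ?V * e ^ (2 * ?a)\<bar> \<le> D1 * ?E" unfolding m2_def by (rule D1(2)[OF e])
    have b3: "m3 \<le> D2 * ?E" unfolding m3_def by (rule D2(2)[OF e])
    let ?P = "\<integral>x. psi alg t e x \<partial>F"
    have "?P - (1 - (\<i> * t + t\<^sup>2) / 2 * (?V * e ^ (2 * ?a))) =
       (?P - (1 + \<i> * t * m1 - t\<^sup>2 / 2 * m2)) + \<i> * t * of_real (m1 + m2 / 2) - (\<i> * t + t\<^sup>2) / 2 * of_real (m2 - ?V * e ^ (2 * ?a))"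
      by (simp add: algebra_simps add_divide_distrib)
    then have "cmod (?P - (1 - (\<i> * t + t\<^sup>2) / 2 * (?V * e ^ (2 * ?a)))) \<le>
      cmod (?P - (1 + \<i> * t * m1 - t\<^sup>2 / 2 * m2)) + cmod (\<i> * t * of_real (m1 + m2 / 2)) + cmod ((\<i> * t + t\<^sup>2) / 2 * of_real (m2 - ?V * e ^ (2 * ?a)))"
      by (simp only: cmod_triangle3)
    also have "\<dots> \<le> \<bar>t\<bar> ^ 3 / 6 * (D2 * ?E) + \<bar>t\<bar> * (D2 * ?E) + T / 2 * (D1 * ?E)"
    proof (intro add_mono)
      show "cmod (?P - (1 + \<i> * t * m1 - t\<^sup>2 / 2 * m2)) \<le> \<bar>t\<bar> ^ 3 / 6 * (D2 * ?E)"
        by (rule order_trans[OF err]) (intro mult_left_mono b3, simp)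
      have "cmod (\<i> * t * of_real (m1 + m2 / 2)) = \<bar>t\<bar> * \<bar>m1 + m2 / 2\<bar>"
        by (simp only: norm_mult norm_of_real) simp
      then show "cmod (\<i> * t * of_real (m1 + m2 / 2)) \<le> \<bar>t\<bar> * (D2 * ?E)"
        using b1 by (simp add: mult_left_mono)
      have "cmod (\<i> * t + t\<^sup>2) \<le> T"
        unfolding T_def by (rule order_trans[OF norm_triangle_ineq]) (simp add: norm_mult norm_power)
      then have "cmod ((\<i> * t + t\<^sup>2) / 2) \<le> T / 2" by (simp add: norm_divide)
      then show "cmod ((\<i> * t + t\<^sup>2) / 2 * of_real (m2 - ?V * e ^ (2 * ?a))) \<le> T / 2 * (D1 * ?E)"
        unfolding norm_mult norm_of_real using b2 T by (intro mult_mono) auto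
    qed
    also have "\<dots> = D * ?E" by (simp add: D_def algebra_simps)
    finally show "cmod (?P - (1 - (\<i> * t + t\<^sup>2) / 2 * (?V * e ^ (2 * ?a)))) \<le> D * ?E" .
  qed
qed

text \<open>The leading term is conditionally centred, so the conditional mean of R is that of the
  remainder, of order a + 1 rather than a. Fluctuations of \<open>psi\<close> over the state
  therefore enter |psi - 1|^2 only beyond the order 2a.\<close>

lemma psi_square_bound:
  assumes e: "0 < e" "e \<le> 1"
  shows "(cmod (psi alg t e x - 1))\<^sup>2 \<le>
     2 * t\<^sup>2 * (\<integral>z. (logratio alg g e x z - e ^ lead_order alg * lead alg g x z)\<^sup>2 \<partial>N) + t ^ 4 / 2 * (\<integral>z. logratio alg g e x z ^ 4 \<partial>N)"
proof -
  let ?R = "logratio alg g e x"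
  note i = logratio_integrable_z[OF e, of alg x]
  have ic: "integrable N (\<lambda>z. complex_of_real (?R z))" using i(1) by (rule integrable_of_real)
  define a where "a = \<bar>integral\<^sup>L N ?R\<bar>"
  define b where "b = (\<integral>z. (?R z)\<^sup>2 \<partial>N)"
  have a: "a\<^sup>2 \<le> (\<integral>z. (?R z - e ^ lead_order alg * lead alg g x z)\<^sup>2 \<partial>N)"
  proof -
    have "integral\<^sup>L N ?R = (\<integral>z. ?R z - e ^ lead_order alg * lead alg g x z \<partial>N)"
      using i by (simp add: lead_mean_zero)
    then show ?thesis unfolding a_def power2_abs
      using FN.M2.square_integral_le[OF Bochner_Integration.integrable_diff[OF i(1) integrable_mult_right[OF i(4)]] i(5)]
      by (simp only:)
  qed
  have b: "b\<^sup>2 \<le> (\<integral>z. ?R z ^ 4 \<partial>N)"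
    unfolding b_def using FN.M2.square_integral_le[of "\<lambda>z. (?R z)\<^sup>2"] i(2)[of 2] i(2)[of 4] by simp
  have eq: "psi alg t e x - 1 - \<i> * t * integral\<^sup>L N ?R = (\<integral>z. iexp (t * ?R z) - (1 + \<i> * t * complex_of_real (?R z)) \<partial>N)"
    using iexp_integrable[of t alg e x] ic FN.M2.prob_space unfolding psi_def
    by (subst Bochner_Integration.integral_diff) (auto simp: Bochner_Integration.integral_add)
  have "cmod (psi alg t e x - 1 - \<i> * t * integral\<^sup>L N ?R) \<le> (\<integral>z. cmod (iexp (t * ?R z) - (1 + \<i> * t * complex_of_real (?R z))) \<partial>N)"
    unfolding eq by (rule integral_norm_bound)
  also have "\<dots> \<le> (\<integral>z. t\<^sup>2 / 2 * (?R z)\<^sup>2 \<partial>N)"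
  proof (rule integral_mono)
    fix z show "cmod (iexp (t * ?R z) - (1 + \<i> * t * complex_of_real (?R z))) \<le> t\<^sup>2 / 2 * (?R z)\<^sup>2"
      using iexp_approx_1[of "t * ?R z"] by (simp add: power_mult_distrib mult.assoc)
  qed (use i(2)[of 2] iexp_integrable[of t alg e x] ic in \<open>auto intro!: integrable_norm\<close>)
  finally have c: "cmod (psi alg t e x - 1 - \<i> * t * integral\<^sup>L N ?R) \<le> t\<^sup>2 / 2 * b" by (simp add: b_def)
  have "cmod (psi alg t e x - 1) \<le> cmod (psi alg t e x - 1 - \<i> * t * integral\<^sup>L N ?R) + cmod (\<i> * t * integral\<^sup>L N ?R)"
    using norm_triangle_ineq[of "psi alg t e x - 1 - \<i> * t * integral\<^sup>L N ?R" "\<i> * t * integral\<^sup>L N ?R"] by simp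
  also have "cmod (\<i> * t * integral\<^sup>L N ?R) = \<bar>t\<bar> * a" by (simp add: norm_mult a_def)
  finally have "cmod (psi alg t e x - 1) \<le> t\<^sup>2 / 2 * b + \<bar>t\<bar> * a" using c by linarith
  then have "(cmod (psi alg t e x - 1))\<^sup>2 \<le> (t\<^sup>2 / 2 * b + \<bar>t\<bar> * a)\<^sup>2" by (intro power_mono) auto
  also have "\<dots> \<le> 2 * (t\<^sup>2 / 2 * b)\<^sup>2 + 2 * (\<bar>t\<bar> * a)\<^sup>2"
    using sum_squares_bound[of "t\<^sup>2 / 2 * b" "\<bar>t\<bar> * a"] by (simp add: power2_sum)
  also have "\<dots> = t ^ 4 / 2 * b\<^sup>2 + 2 * t\<^sup>2 * a\<^sup>2"
    by (simp add: power_mult_distrib power_divide power_mult[symmetric])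
  also have "\<dots> \<le> t ^ 4 / 2 * (\<integral>z. ?R z ^ 4 \<partial>N) + 2 * t\<^sup>2 * (\<integral>z. (?R z - e ^ lead_order alg * lead alg g x z)\<^sup>2 \<partial>N)"
    by (intro add_mono mult_left_mono a b) auto
  finally show ?thesis by simp
qed

text \<open>In |psi|^2 = 1 + 2 Re(psi - 1) + |psi - 1|^2 the last term is negligible by
  \<open>psi_square_bound\<close>. Hence E |psi|^2 and |E psi|^2 agree up to the order 2a, which
  makes the product of the conditional characteristic functions nonrandom in the limit.\<close>

lemma psi_norm_mean:
  "\<exists>D\<ge>0. \<forall>e. 0 < e \<longrightarrow> e \<le> 1 \<longrightarrow>
     \<bar>(\<integral>x. (cmod (psi alg t e x))\<^sup>2 \<partial>F) - (1 - t\<^sup>2 * (Kc alg * e ^ (2 * lead_order alg)))\<bar> \<le> D * e ^ (2 * lead_order alg + 1)"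
proof -
  let ?a = "lead_order alg" and ?V = "Kc alg"
  obtain D1 where D1: "D1 \<ge> 0" "\<And>e. 0 < e \<Longrightarrow> e \<le> 1 \<Longrightarrow>
     cmod ((\<integral>x. psi alg t e x \<partial>F) - (1 - (\<i> * t + t\<^sup>2) / 2 * (?V * e ^ (2 * ?a)))) \<le> D1 * e ^ (2 * ?a + 1)"
    using psi_mean by blast
  obtain D2 where D2: "D2 \<ge> 0" "\<And>e. 0 < e \<Longrightarrow> e \<le> 1 \<Longrightarrow>
     EE (\<lambda>x z. \<bar>(logratio alg g e x z - e ^ ?a * lead alg g x z)\<^sup>2\<bar>) \<le> D2 * e ^ (2 * ?a + 1)"
    using logratio_remainder_moment by blast
  obtain D3 where D3: "D3 \<ge> 0" "\<And>e. 0 < e \<Longrightarrow> e \<le> 1 \<Longrightarrow>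
     EE (\<lambda>x z. \<bar>logratio alg g e x z ^ 4\<bar>) \<le> D3 * e ^ (2 * ?a + 1)"
    using logratio_fourth_moment by blast
  define D where "D = 2 * D1 + (2 * t\<^sup>2 * D2 + t ^ 4 / 2 * D3)"
  show ?thesis
  proof (intro exI[of _ D] conjI allI impI)
    show "D \<ge> 0" using D1(1) D2(1) D3(1) by (simp add: D_def)
    fix e :: real assume e: "0 < e" "e \<le> 1"
    let ?E = "e ^ (2 * ?a + 1)"
    let ?P = "\<integral>x. psi alg t e x \<partial>F"
    let ?r = "\<lambda>w. (logratio alg g e (fst w) (snd w) - e ^ ?a * lead alg g (fst w) (snd w))\<^sup>2"
    let ?q = "\<lambda>w. logratio alg g e (fst w) (snd w) ^ 4"
    have i1: "integrable F (\<lambda>x. psi alg t e x - 1)"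
      using psi_integrable(1) by (intro Bochner_Integration.integrable_diff) auto
    have "cmod (psi alg t e x - 1) \<le> 2" for x
      using norm_triangle_ineq4[of "psi alg t e x" 1] cmod_psi_le_1[of alg t e x] by simp
    then have "(cmod (psi alg t e x - 1))\<^sup>2 \<le> 2\<^sup>2" for x
      by (intro power_mono) auto
    then have i2: "integrable F (\<lambda>x. (cmod (psi alg t e x - 1))\<^sup>2)"
      by (intro FN.M1.integrable_const_bound[of _ 4]) auto
    have eq: "(\<integral>x. (cmod (psi alg t e x))\<^sup>2 \<partial>F) = 1 + 2 * Re (?P - 1) + (\<integral>x. (cmod (psi alg t e x - 1))\<^sup>2 \<partial>F)"
    proof -
      have "(\<integral>x. (cmod (psi alg t e x))\<^sup>2 \<partial>F) = (\<integral>x. 1 + 2 * Re (psi alg t e x - 1) + (cmod (psi alg t e x - 1))\<^sup>2 \<partial>F)"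
        by (subst cmod_square_expand) simp
      also have "\<dots> = 1 + 2 * (\<integral>x. Re (psi alg t e x - 1) \<partial>F) + (\<integral>x. (cmod (psi alg t e x - 1))\<^sup>2 \<partial>F)"
        using i1 i2 integrable_Re[OF i1] FN.M1.prob_space
        by (subst Bochner_Integration.integral_add) (auto simp del: minus_complex.simps one_complex.simps)
      also have "(\<integral>x. Re (psi alg t e x - 1) \<partial>F) = Re (?P - 1)"
        using integral_Re[OF i1] psi_integrable(1)[of alg t e] FN.M1.prob_space
        by (simp del: minus_complex.simps one_complex.simps)
      finally show ?thesis .
    qed
    have b1: "\<bar>2 * Re (?P - 1) - (- t\<^sup>2 * (?V * e ^ (2 * ?a)))\<bar> \<le> 2 * (D1 * ?E)"
    proof -
      have "Re (?P - (1 - (\<i> * t + t\<^sup>2) / 2 * (?V * e ^ (2 * ?a)))) = Re (?P - 1) + t\<^sup>2 / 2 * (?V * e ^ (2 * ?a))"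
        by (simp add: power2_eq_square)
      moreover have "\<bar>Re (?P - (1 - (\<i> * t + t\<^sup>2) / 2 * (?V * e ^ (2 * ?a))))\<bar> \<le> D1 * ?E"
        by (rule order_trans[OF abs_Re_le_cmod D1(2)[OF e]])
      ultimately show ?thesis by linarith
    qed
    have ir: "integrable (F \<Otimes>\<^sub>M N) ?r"
      by (rule growth_integrable[OF growth_power[OF growth_logratio] e]) measurable
    have iq: "integrable (F \<Otimes>\<^sub>M N) ?q"
      by (rule logratio_power_integrable[OF e])
    have "(\<integral>x. (cmod (psi alg t e x - 1))\<^sup>2 \<partial>F) \<le> (\<integral>x. 2 * t\<^sup>2 * (\<integral>z. ?r (x, z) \<partial>N) + t ^ 4 / 2 * (\<integral>z. ?q (x, z) \<partial>N) \<partial>F)"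
      using psi_square_bound[OF e, of alg t] i2 FN.integrable_fst'[OF ir] FN.integrable_fst'[OF iq]
      by (intro integral_mono) auto
    also have "\<dots> = 2 * t\<^sup>2 * (\<integral>x. (\<integral>z. ?r (x, z) \<partial>N) \<partial>F) + t ^ 4 / 2 * (\<integral>x. (\<integral>z. ?q (x, z) \<partial>N) \<partial>F)"
      using FN.integrable_fst'[OF ir] FN.integrable_fst'[OF iq]
      by (subst Bochner_Integration.integral_add) auto
    also have "\<dots> = 2 * t\<^sup>2 * integral\<^sup>L (F \<Otimes>\<^sub>M N) ?r + t ^ 4 / 2 * integral\<^sup>L (F \<Otimes>\<^sub>M N) ?q"
      unfolding FN.integral_fst'[OF ir] FN.integral_fst'[OF iq] ..
    also have "\<dots> \<le> 2 * t\<^sup>2 * (D2 * ?E) + t ^ 4 / 2 * (D3 * ?E)"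
      using D2(2)[OF e] D3(2)[OF e] by (intro add_mono mult_left_mono) auto
    finally have b2: "(\<integral>x. (cmod (psi alg t e x - 1))\<^sup>2 \<partial>F) \<le> (2 * t\<^sup>2 * D2 + t ^ 4 / 2 * D3) * ?E"
      by (simp add: algebra_simps)
    have b3: "0 \<le> (\<integral>x. (cmod (psi alg t e x - 1))\<^sup>2 \<partial>F)" by (rule integral_nonneg_AE) auto
    show "\<bar>(\<integral>x. (cmod (psi alg t e x))\<^sup>2 \<partial>F) - (1 - t\<^sup>2 * (?V * e ^ (2 * ?a)))\<bar> \<le> D * ?E"
      unfolding eq D_def using b1 b2 b3 by (simp only: distrib_right)
  qed
qed

text \<open>The order e suffices: the weight sits in one coordinate only, and a single factor may be
  replaced by 1 in the limit.\<close>

lemma psiw_mean: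
  "\<exists>D\<ge>0. \<forall>e. 0 < e \<longrightarrow> e \<le> 1 \<longrightarrow>
     cmod ((\<integral>x. psiw alg t e x \<partial>F) - 1) \<le> D * e \<and> \<bar>(\<integral>x. (cmod (psiw alg t e x))\<^sup>2 \<partial>F) - 1\<bar> \<le> D * e"
proof -
  obtain D1 where D1: "D1 \<ge> 0" "\<And>e. 0 < e \<Longrightarrow> e \<le> 1 \<Longrightarrow>
     EE (\<lambda>x z. z\<^sup>2 * \<bar>logratio alg g e x z\<bar>) \<le> D1 * e"
    using logratio_first_moment by blast
  show ?thesis
  proof (intro exI[of _ "2 * \<bar>t\<bar> * D1"] conjI allI impI)
    show "2 * \<bar>t\<bar> * D1 \<ge> 0" using D1 by simp
    fix e :: real assume e: "0 < e" "e \<le> 1"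
    let ?R = "logratio alg g e"
    have z2: "integrable N (\<lambda>z. complex_of_real (z\<^sup>2))"
      using N_integrable_power(1)[of 2] by (rule integrable_of_real)
    have Z1: "(\<integral>z. complex_of_real (z\<^sup>2) \<partial>N) = 1"
      by (simp only: integral_complex_of_real N_moments of_real_1)
    have ptw: "cmod (psiw alg t e x - 1) \<le> \<bar>t\<bar> * (\<integral>z. z\<^sup>2 * \<bar>?R x z\<bar> \<partial>N)" for x
    proof -
      have eq: "psiw alg t e x - 1 = (\<integral>z. of_real (z\<^sup>2) * iexp (t * ?R x z) - of_real (z\<^sup>2) \<partial>N)"
        unfolding psiw_def using iexp_integrable(2) z2 Z1 by (subst Bochner_Integration.integral_diff) auto
      have "cmod (psiw alg t e x - 1) \<le> (\<integral>z. cmod (of_real (z\<^sup>2) * iexp (t * ?R x z) - of_real (z\<^sup>2)) \<partial>N)"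
        unfolding eq by (rule integral_norm_bound)
      also have "\<dots> \<le> (\<integral>z. \<bar>t\<bar> * (z\<^sup>2 * \<bar>?R x z\<bar>) \<partial>N)"
      proof (rule integral_mono)
        fix z
        have "cmod (of_real (z\<^sup>2) * iexp (t * ?R x z) - of_real (z\<^sup>2)) = z\<^sup>2 * cmod (iexp (t * ?R x z) - 1)"
          by (subst (2) mult.commute, subst mult_1_right[of "of_real (z\<^sup>2)", symmetric], subst right_diff_distrib[symmetric])
             (simp add: norm_mult norm_power mult.commute)
        also have "\<dots> \<le> z\<^sup>2 * (\<bar>t\<bar> * \<bar>?R x z\<bar>)"
          using iexp_approx_0[of "t * ?R x z"] by (intro mult_left_mono) (auto simp: abs_mult)
        finally show "cmod (of_real (z\<^sup>2) * iexp (t * ?R x z) - of_real (z\<^sup>2)) \<le> \<bar>t\<bar> * (z\<^sup>2 * \<bar>?R x z\<bar>)"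
          by (simp add: mult_ac)
      qed (use logratio_integrable_z(3)[OF e, of alg x] iexp_integrable(2)[of t alg e x] z2 in \<open>auto intro!: integrable_norm Bochner_Integration.integrable_diff\<close>)
      finally show ?thesis by simp
    qed
    have gi: "integrable (F \<Otimes>\<^sub>M N) (\<lambda>w. (snd w)\<^sup>2 * \<bar>?R (fst w) (snd w)\<bar>)"
      by (rule growth_integrable[OF growth_mult[OF growth_power[OF growth_z] growth_abs[OF growth_logratio']] e]) measurable
    have ipw: "integrable F (\<lambda>x. psiw alg t e x - 1)"
      using psi_integrable(2) by (intro Bochner_Integration.integrable_diff) auto
    have B: "(\<integral>x. cmod (psiw alg t e x - 1) \<partial>F) \<le> \<bar>t\<bar> * (D1 * e)"
    proof -
      have "(\<integral>x. cmod (psiw alg t e x - 1) \<partial>F) \<le> (\<integral>x. \<bar>t\<bar> * (\<integral>z. z\<^sup>2 * \<bar>?R x z\<bar> \<partial>N) \<partial>F)"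
        using FN.integrable_fst'[OF gi] ptw ipw by (intro integral_mono) auto
      also have "\<dots> = \<bar>t\<bar> * EE (\<lambda>x z. z\<^sup>2 * \<bar>?R x z\<bar>)"
        using FN.integral_fst'[OF gi] by simp
      also have "\<dots> \<le> \<bar>t\<bar> * (D1 * e)" by (intro mult_left_mono D1(2)[OF e]) auto
      finally show ?thesis .
    qed
    have "(\<integral>x. psiw alg t e x \<partial>F) - 1 = (\<integral>x. psiw alg t e x - 1 \<partial>F)"
      using psi_integrable(2)[of alg t e] FN.M1.prob_space by (subst Bochner_Integration.integral_diff) auto
    then have "cmod ((\<integral>x. psiw alg t e x \<partial>F) - 1) \<le> (\<integral>x. cmod (psiw alg t e x - 1) \<partial>F)"
      using integral_norm_bound[of F "\<lambda>x. psiw alg t e x - 1"] by simp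
    also note B
    also have "\<bar>t\<bar> * (D1 * e) \<le> 2 * \<bar>t\<bar> * D1 * e" using D1(1) e by (simp add: mult_ac)
    finally show "cmod ((\<integral>x. psiw alg t e x \<partial>F) - 1) \<le> 2 * \<bar>t\<bar> * D1 * e" .
    have "(\<integral>x. (cmod (psiw alg t e x))\<^sup>2 \<partial>F) - 1 = (\<integral>x. (cmod (psiw alg t e x))\<^sup>2 - 1 \<partial>F)"
      using psi_integrable(4)[of alg t e] FN.M1.prob_space by (subst Bochner_Integration.integral_diff) auto
    then have "\<bar>(\<integral>x. (cmod (psiw alg t e x))\<^sup>2 \<partial>F) - 1\<bar> \<le> (\<integral>x. \<bar>(cmod (psiw alg t e x))\<^sup>2 - 1\<bar> \<partial>F)"
      using integral_abs_bound[of F "\<lambda>x. (cmod (psiw alg t e x))\<^sup>2 - 1"] by simp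
    also have "\<dots> \<le> (\<integral>x. 2 * cmod (psiw alg t e x - 1) \<partial>F)"
      using cmod_square_diff_one[OF cmod_psiw_le_1] psi_integrable(4)[of alg t e] ipw
      by (intro integral_mono integrable_abs Bochner_Integration.integrable_diff) auto
    also have "\<dots> \<le> 2 * (\<bar>t\<bar> * (D1 * e))" using B by simp
    finally show "\<bar>(\<integral>x. (cmod (psiw alg t e x))\<^sup>2 \<partial>F) - 1\<bar> \<le> 2 * \<bar>t\<bar> * D1 * e" by (simp add: mult_ac)
  qed
qed

end

section \<open>The limit law of the log ratio\<close>

lemma nn_integral_std_normal_reflect:
  assumes [measurable]: "h \<in> borel_measurable borel"
  shows "(\<integral>\<^sup>+z. ennreal (std_normal_density z) * h (- z) \<partial>lborel) = (\<integral>\<^sup>+z. ennreal (std_normal_density z) * h z \<partial>lborel)"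
proof -
  have "(\<integral>\<^sup>+z. ennreal (std_normal_density z) * h z \<partial>lborel) =
      ennreal \<bar>-1\<bar> * (\<integral>\<^sup>+z. ennreal (std_normal_density (0 + -1 * z)) * h (0 + -1 * z) \<partial>lborel)"
    by (rule nn_integral_real_affine) auto
  then show ?thesis by (simp add: normal_density_def)
qed

lemma nn_integral_std_normal_atMost:
  "(\<integral>\<^sup>+z. ennreal (std_normal_density z) * indicator {..a} z \<partial>lborel) = ennreal (std_normal_cdf a)"
proof -
  interpret N: real_distribution std_normal_distribution by (rule real_dist_normal_dist)
  have "(\<integral>\<^sup>+z. ennreal (std_normal_density z) * indicator {..a} z \<partial>lborel) = emeasure std_normal_distribution {..a}"
    by (subst emeasure_density) auto
  then show ?thesis
    by (simp add: std_normal_cdf_def cdf_def N.emeasure_eq_measure)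
qed

text \<open>If \<open>Y\<close> is normal with mean \<open>- \<tau>\<^sup>2 / 2\<close> and variance \<open>\<tau>\<^sup>2\<close>, then \<open>exp Y\<close> is the
  density of the shift of the Gaussian by \<open>\<tau>\<close>.\<close>

lemma gaussian_acceptance:
  assumes tau: "\<tau> \<ge> 0"
  shows "(\<integral>z. min 1 (exp (\<tau> * z - \<tau>\<^sup>2 / 2)) \<partial>std_normal_distribution) = 2 * std_normal_cdf (- (\<tau> / 2))"
proof -
  interpret N: real_distribution std_normal_distribution by (rule real_dist_normal_dist)
  let ?m = "\<lambda>z. min 1 (exp (\<tau> * z - \<tau>\<^sup>2 / 2)) :: real"
  have nn: "std_normal_cdf a \<ge> 0" for a by (simp add: std_normal_cdf_def cdf_def)
  \<comment> \<open>The exponent changes sign at z = \<tau> / 2. Above, the Gaussian keeps its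
    density; below, the exponential shifts it by \<tau>. Each of the two tails has mass \<Phi>(-
    \<tau> / 2).\<close>
  have sp: "std_normal_density z * ?m z =
      std_normal_density z * indicator {\<tau> / 2<..} z + std_normal_density (z - \<tau>) * indicator {..\<tau> / 2} z" for z
  proof -
    have d: "std_normal_density z * exp (\<tau> * z - \<tau>\<^sup>2 / 2) = std_normal_density (z - \<tau>)"
      by (simp add: normal_density_def exp_add[symmetric] power2_diff field_simps)
    show ?thesis
    proof (cases "z > \<tau> / 2")
      case True
      then have "\<tau> * (\<tau> / 2) \<le> \<tau> * z" using tau by (intro mult_left_mono) auto
      then have "exp (\<tau> * z - \<tau>\<^sup>2 / 2) \<ge> 1" by (simp add: power2_eq_square)
      then show ?thesis using True by simp
    next
      case False
      then have "\<tau> * z \<le> \<tau> * (\<tau> / 2)" using tau by (intro mult_left_mono) auto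
      then have "exp (\<tau> * z - \<tau>\<^sup>2 / 2) \<le> 1" by (simp add: power2_eq_square)
      then have "?m z = exp (\<tau> * z - \<tau>\<^sup>2 / 2)" by (rule min_absorb2)
      then show ?thesis using False d by simp
    qed
  qed
  have "(\<integral>\<^sup>+z. ennreal (?m z) \<partial>std_normal_distribution) = (\<integral>\<^sup>+z. ennreal (std_normal_density z) * ennreal (?m z) \<partial>lborel)"
    by (rule nn_integral_density) auto
  also have "\<dots> = (\<integral>\<^sup>+z. ennreal (std_normal_density z) * indicator {\<tau> / 2<..} z
      + ennreal (std_normal_density (z - \<tau>)) * indicator {..\<tau> / 2} z \<partial>lborel)"
  proof (rule nn_integral_cong)
    fix z
    have "ennreal (std_normal_density z) * ennreal (?m z) = ennreal (std_normal_density z * ?m z)"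
      by (rule ennreal_mult[symmetric]) auto
    also have "\<dots> = ennreal (std_normal_density z) * indicator {\<tau> / 2<..} z
      + ennreal (std_normal_density (z - \<tau>)) * indicator {..\<tau> / 2} z"
      unfolding sp by (auto simp: indicator_def)
    finally show "ennreal (std_normal_density z) * ennreal (?m z) = ennreal (std_normal_density z) * indicator {\<tau> / 2<..} z
      + ennreal (std_normal_density (z - \<tau>)) * indicator {..\<tau> / 2} z" .
  qed
  also have "\<dots> = (\<integral>\<^sup>+z. ennreal (std_normal_density z) * indicator {\<tau> / 2<..} z \<partial>lborel)
      + (\<integral>\<^sup>+z. ennreal (std_normal_density (z - \<tau>)) * indicator {..\<tau> / 2} z \<partial>lborel)"
    by (rule nn_integral_add) measurable
  also have "(\<integral>\<^sup>+z. ennreal (std_normal_density z) * indicator {\<tau> / 2<..} z \<partial>lborel) =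
      (\<integral>\<^sup>+z. ennreal (std_normal_density z) * indicator {\<tau> / 2<..} (- z) \<partial>lborel)"
    by (rule nn_integral_std_normal_reflect[symmetric]) measurable
  also have "\<dots> = (\<integral>\<^sup>+z. ennreal (std_normal_density z) * indicator {..- (\<tau> / 2)} z \<partial>lborel)"
  proof (rule nn_integral_cong_AE)
    \<comment> \<open>Reflection produces an open half-line, while the distribution function uses
      the closed one; they differ in one point.\<close>
    show "AE z in lborel. ennreal (std_normal_density z) * indicator {\<tau> / 2<..} (- z) =
        ennreal (std_normal_density z) * indicator {..- (\<tau> / 2)} z"
      using AE_lborel_singleton[of "- (\<tau> / 2)"] by eventually_elim (auto simp: indicator_def)
  qed
  also have "(\<integral>\<^sup>+z. ennreal (std_normal_density (z - \<tau>)) * indicator {..\<tau> / 2} z \<partial>lborel) =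
      ennreal \<bar>1\<bar> * (\<integral>\<^sup>+z. ennreal (std_normal_density ((\<tau> + 1 * z) - \<tau>)) * indicator {..\<tau> / 2} (\<tau> + 1 * z) \<partial>lborel)"
    by (rule nn_integral_real_affine) auto
  also have "\<dots> = (\<integral>\<^sup>+z. ennreal (std_normal_density z) * indicator {..- (\<tau> / 2)} z \<partial>lborel)"
    by (simp, intro nn_integral_cong) (auto simp: indicator_def)
  finally have "(\<integral>\<^sup>+z. ennreal (?m z) \<partial>std_normal_distribution) = ennreal (2 * std_normal_cdf (- (\<tau> / 2)))"
    unfolding nn_integral_std_normal_atMost using nn by (simp add: ennreal_plus[symmetric] del: ennreal_plus)
  then show ?thesis
    using nn by (subst integral_eq_nn_integral) auto
qed

section \<open>Products of factors close to one\<close>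

lemma exp_approx: "cmod (exp z - (1 + z)) \<le> exp (cmod z) * (cmod z)\<^sup>2"
  using Taylor_exp_field[of z 1] by (simp add: numeral_2_eq_2)

text \<open>Each factor is compared with exp(s e^(2a)). All of these lie in the closed unit disc, as
  Re s is at most 0, so the products differ by at most the sum of the differences, which is bounded
  by a multiple of \<open>eb n\<close> times a convergent sum. Coordinate i contributes one further
  term of order \<open>eb n\<close>, which allows it the weaker estimate.\<close>

lemma prod_tendsto_exp:
  fixes z :: "nat \<Rightarrow> nat \<Rightarrow> complex" and e :: "nat \<Rightarrow> nat \<Rightarrow> real" and s :: complex
  assumes a: "a \<ge> 1" and i: "i \<ge> 1" and D: "D \<ge> 0" and s: "Re s \<le> 0"
    and e: "\<And>n j. n \<ge> base \<Longrightarrow> j \<in> {1..n} \<Longrightarrow> 0 < e n j \<and> e n j \<le> eb n"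
    and eb: "eb \<longlonglongrightarrow> 0" "\<And>n. n \<ge> base \<Longrightarrow> eb n \<le> 1"
    and sum: "(\<lambda>n. \<Sum>j\<in>{1..n}. e n j ^ (2 * a)) \<longlonglongrightarrow> L"
    and z1: "\<And>n j. n \<ge> base \<Longrightarrow> j \<in> {1..n} \<Longrightarrow> cmod (z n j) \<le> 1"
    and z2: "\<And>n j. n \<ge> base \<Longrightarrow> j \<in> {1..n} \<Longrightarrow> j \<noteq> i \<Longrightarrow> cmod (z n j - (1 + s * e n j ^ (2 * a))) \<le> D * e n j ^ (2 * a + 1)"
    and z3: "\<And>n. n \<ge> base \<Longrightarrow> n \<ge> i \<Longrightarrow> cmod (z n i - 1) \<le> D * e n i"
  shows "(\<lambda>n. \<Prod>j\<in>{1..n}. z n j) \<longlonglongrightarrow> exp (s * L)"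
proof -
  define w where "w = (\<lambda>n j. exp (s * complex_of_real (e n j ^ (2 * a))))"
  define K where "K = exp (cmod s) * (cmod s)\<^sup>2"
  define S where "S = (\<lambda>n. \<Sum>j\<in>{1..n}. e n j ^ (2 * a))"
  have K: "K \<ge> 0" by (simp add: K_def)
  have w1: "cmod (w n j) \<le> 1" if "n \<ge> base" "j \<in> {1..n}" for n j
    using e[OF that] s by (auto simp: w_def mult_nonpos_nonneg)
  have ple: "e n j ^ (2 * a) \<le> e n j" "e n j ^ (2 * a) \<le> 1" "e n j \<le> 1" "(e n j ^ (2 * a))\<^sup>2 \<le> e n j ^ (2 * a + 1)"
    if "n \<ge> base" "j \<in> {1..n}" for n j
  proof -
    have b: "0 < e n j" "e n j \<le> 1" using e[OF that] eb(2)[OF that(1)] by auto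
    then show "e n j \<le> 1" by simp
    show "e n j ^ (2 * a) \<le> e n j" using power_decreasing[of 1 "2 * a" "e n j"] b a by simp
    show "e n j ^ (2 * a) \<le> 1" using b by (simp add: power_le_one)
    show "(e n j ^ (2 * a))\<^sup>2 \<le> e n j ^ (2 * a + 1)"
      unfolding power_mult[symmetric] using b a by (intro power_decreasing) auto
  qed
  have wa: "cmod (w n j - (1 + s * e n j ^ (2 * a))) \<le> K * e n j ^ (2 * a + 1)" if "n \<ge> base" "j \<in> {1..n}" for n j
  proof -
    let ?y = "s * complex_of_real (e n j ^ (2 * a))"
    have ny: "cmod ?y = cmod s * e n j ^ (2 * a)"
      using e[OF that] by (simp add: norm_mult norm_power)
    have "cmod (w n j - (1 + ?y)) \<le> exp (cmod ?y) * (cmod ?y)\<^sup>2" unfolding w_def by (rule exp_approx)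
    also have "\<dots> \<le> exp (cmod s) * ((cmod s)\<^sup>2 * e n j ^ (2 * a + 1))"
      unfolding ny power_mult_distrib using ple[OF that] e[OF that]
      by (intro mult_mono) (auto simp: mult_left_le)
    finally show ?thesis by (simp add: K_def mult.assoc)
  qed
  have bound: "cmod (z n j - w n j) \<le> (D + K) * (eb n * e n j ^ (2 * a)) + (if j = i then (D + cmod s + K) * eb n else 0)"
    if n: "n \<ge> base" and j: "j \<in> {1..n}" for n j
  proof -
    have E: "0 < e n j" "e n j \<le> eb n" "eb n \<ge> 0" using e[OF n j] by auto
    have pe: "e n j ^ (2 * a + 1) \<le> eb n * e n j ^ (2 * a)" using E by (simp add: mult_right_mono)
    show ?thesis
    proof (cases "j = i")
      case False
      have "cmod (z n j - w n j) \<le> cmod (z n j - (1 + s * e n j ^ (2 * a))) + cmod (w n j - (1 + s * e n j ^ (2 * a)))"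
        using norm_triangle_ineq4[of "z n j - (1 + s * e n j ^ (2 * a))" "w n j - (1 + s * e n j ^ (2 * a))"] by simp
      also have "\<dots> \<le> (D + K) * e n j ^ (2 * a + 1)"
        using z2[OF n j False] wa[OF n j] by (simp only: distrib_right)
      also have "\<dots> \<le> (D + K) * (eb n * e n j ^ (2 * a))"
        using pe D K by (intro mult_left_mono) auto
      finally show ?thesis using False by simp
    next
      case True
      have in_: "n \<ge> i" using True j by simp
      have "cmod (z n i - w n i) \<le> cmod (z n i - 1) + cmod (w n i - 1)"
        using norm_triangle_ineq4[of "z n i - 1" "w n i - 1"] by simp
      also have "cmod (w n i - 1) \<le> cmod (w n i - (1 + s * e n i ^ (2 * a))) + cmod (s * e n i ^ (2 * a))"
        using norm_triangle_ineq[of "w n i - (1 + s * e n i ^ (2 * a))" "s * e n i ^ (2 * a)"] by simp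
      also have "cmod (s * e n i ^ (2 * a)) = cmod s * e n i ^ (2 * a)"
        using E True by (simp add: norm_mult norm_power)
      also have "cmod s * e n i ^ (2 * a) \<le> cmod s * eb n"
        using ple(1)[OF n j] E True by (intro mult_left_mono) auto
      finally have "cmod (z n i - w n i) \<le> cmod (z n i - 1) + (cmod (w n i - (1 + s * e n i ^ (2 * a))) + cmod s * eb n)" by simp
      moreover have "cmod (z n i - 1) \<le> D * eb n"
        using z3[OF n in_] mult_left_mono[OF E(2) D] True by simp
      moreover have "cmod (w n i - (1 + s * e n i ^ (2 * a))) \<le> K * eb n"
      proof -
        have "e n j ^ (2 * a + 1) \<le> eb n * 1"
          by (rule order_trans[OF pe mult_left_mono[OF ple(2)[OF n j] E(3)]])
        then have "K * e n j ^ (2 * a + 1) \<le> K * eb n"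
          using K by (intro mult_left_mono) auto
        then show ?thesis using order_trans[OF wa[OF n j]] True by blast
      qed
      moreover have "0 \<le> (D + K) * (eb n * e n j ^ (2 * a))" using D K E by simp
      ultimately show ?thesis using True by (simp add: distrib_right)
    qed
  qed
  have "(\<lambda>n. (\<Prod>j\<in>{1..n}. z n j) - (\<Prod>j\<in>{1..n}. w n j)) \<longlonglongrightarrow> 0"
  proof (rule Lim_null_comparison)
    show "eventually (\<lambda>n. norm ((\<Prod>j\<in>{1..n}. z n j) - (\<Prod>j\<in>{1..n}. w n j)) \<le> (D + K) * (eb n * S n) + (D + cmod s + K) * eb n) sequentially"
      using eventually_ge_at_top[of "max base i"]
    proof eventually_elim
      case (elim n)
      then have n: "n \<ge> base" "n \<ge> i" by auto
      have "norm ((\<Prod>j\<in>{1..n}. z n j) - (\<Prod>j\<in>{1..n}. w n j)) \<le> (\<Sum>j\<in>{1..n}. cmod (z n j - w n j))"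
        by (rule norm_prod_diff) (use z1[OF n(1)] w1[OF n(1)] in auto)
      also have "\<dots> \<le> (\<Sum>j\<in>{1..n}. (D + K) * (eb n * e n j ^ (2 * a)) + (if j = i then (D + cmod s + K) * eb n else 0))"
        by (intro sum_mono bound[OF n(1)])
      also have "\<dots> = (D + K) * (eb n * S n) + (D + cmod s + K) * eb n"
        using i n(2) by (simp del: One_nat_def add: sum.distrib S_def sum_distrib_left)
      finally show ?case .
    qed
    have "(\<lambda>n. (D + K) * (eb n * S n) + (D + cmod s + K) * eb n) \<longlonglongrightarrow> (D + K) * (0 * L) + (D + cmod s + K) * 0"
      unfolding S_def by (intro tendsto_intros eb sum)
    then show "(\<lambda>n. (D + K) * (eb n * S n) + (D + cmod s + K) * eb n) \<longlonglongrightarrow> 0" by simp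
  qed
  moreover have "(\<lambda>n. \<Prod>j\<in>{1..n}. w n j) \<longlonglongrightarrow> exp (s * L)"
  proof -
    have "(\<Prod>j\<in>{1..n}. w n j) = exp (s * of_real (S n))" for n
      unfolding w_def S_def by (subst exp_sum[symmetric]) (simp_all del: One_nat_def add: sum_distrib_left of_real_sum)
    moreover have "(\<lambda>n. exp (s * of_real (S n))) \<longlonglongrightarrow> exp (s * of_real L)"
      unfolding S_def by (intro tendsto_intros sum)
    ultimately show ?thesis by simp
  qed
  ultimately have "(\<lambda>n. ((\<Prod>j\<in>{1..n}. z n j) - (\<Prod>j\<in>{1..n}. w n j)) + (\<Prod>j\<in>{1..n}. w n j)) \<longlonglongrightarrow> 0 + exp (s * L)"
    by (rule tendsto_add)
  then show ?thesis by simp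
qed

section \<open>The sum over all coordinates\<close>

context smooth_density begin

abbreviation PX :: "nat set \<Rightarrow> (nat \<Rightarrow> real) measure" where "PX I \<equiv> PiM I (\<lambda>_. F)"
abbreviation PZ :: "nat set \<Rightarrow> (nat \<Rightarrow> real) measure" where "PZ I \<equiv> PiM I (\<lambda>_. N)"

lemma PX_prob: "prob_space (PX I)" and PZ_prob: "prob_space (PZ I)"
  by (intro prob_space_PiM f_prob N_prob)+

sublocale XZ: pair_prob_space "PX I" "PZ I" for I
  unfolding pair_prob_space_def pair_sigma_finite_def
  using PX_prob PZ_prob prob_space_imp_sigma_finite by blast

lemma prod_integral_X:
  fixes h :: "nat \<Rightarrow> real \<Rightarrow> 'c :: {real_normed_field, banach, second_countable_topology}"
  assumes "finite I" "\<And>j. j \<in> I \<Longrightarrow> integrable F (h j)"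
  shows "(\<integral>X. (\<Prod>j\<in>I. h j (X j)) \<partial>PX I) = (\<Prod>j\<in>I. integral\<^sup>L F (h j))"
proof -
  interpret X: product_sigma_finite "\<lambda>_::nat. F" by standard
  show ?thesis by (rule X.product_integral_prod[OF assms])
qed

lemma prod_integral_Z:
  fixes h :: "nat \<Rightarrow> real \<Rightarrow> 'c :: {real_normed_field, banach, second_countable_topology}"
  assumes "finite I" "\<And>j. j \<in> I \<Longrightarrow> integrable N (h j)"
  shows "(\<integral>Z. (\<Prod>j\<in>I. h j (Z j)) \<partial>PZ I) = (\<Prod>j\<in>I. integral\<^sup>L N (h j))"
proof -
  interpret Z: product_sigma_finite "\<lambda>_::nat. N" by standard
  show ?thesis by (rule Z.product_integral_prod[OF assms])
qed

definition logsum :: "algorithm \<Rightarrow> (nat \<Rightarrow> real) \<Rightarrow> nat set \<Rightarrow> (nat \<Rightarrow> real) \<Rightarrow> (nat \<Rightarrow> real) \<Rightarrow> real" where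
  "logsum alg e I X Z = (\<Sum>j\<in>I. logratio alg g (e j) (X j) (Z j))"

lemma logsum_measurable [measurable]:
  "(\<lambda>p. logsum alg e I (fst p) (snd p)) \<in> borel_measurable (PX I \<Otimes>\<^sub>M PZ I)"
  unfolding logsum_def by measurable

text \<open>The i-th coordinate is the observed one, whose factor carries the weight of the squared
  jump.\<close>

definition cfac :: "algorithm \<Rightarrow> real \<Rightarrow> nat \<Rightarrow> nat \<Rightarrow> real \<Rightarrow> real \<Rightarrow> complex" where
  "cfac alg t i j e x = (if j = i then psiw alg t e x else psi alg t e x)"

lemma cfac_measurable [measurable]: "cfac alg t i j e \<in> borel_measurable borel"
  unfolding cfac_def by (cases "j = i") simp_all

lemma cmod_cfac_le_1: "cmod (cfac alg t i j e x) \<le> 1"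
  by (simp add: cfac_def cmod_psi_le_1 cmod_psiw_le_1)

text \<open>Given the state, the noise coordinates are independent; the exponential of the sum is a
  product, and the weight goes into factor i.\<close>

lemma conditional_char:
  assumes I: "finite I" "i \<in> I"
  shows "(\<integral>Z. of_real ((Z i)\<^sup>2) * iexp (t * logsum alg e I X Z) \<partial>PZ I) = (\<Prod>j\<in>I. cfac alg t i j (e j) (X j))"
proof -
  let ?h = "\<lambda>j z. (if j = i then of_real (z\<^sup>2) else 1) * iexp (t * logratio alg g (e j) (X j) z)"
  have "of_real ((Z i)\<^sup>2) * iexp (t * logsum alg e I X Z) = (\<Prod>j\<in>I. ?h j (Z j))" for Z
    using I by (simp add: prod.distrib logsum_def sum_distrib_left exp_sum of_real_sum)
  then have "(\<integral>Z. of_real ((Z i)\<^sup>2) * iexp (t * logsum alg e I X Z) \<partial>PZ I) = (\<integral>Z. (\<Prod>j\<in>I. ?h j (Z j)) \<partial>PZ I)"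
    by simp
  also have "\<dots> = (\<Prod>j\<in>I. integral\<^sup>L N (?h j))"
  proof (rule prod_integral_Z[OF I(1)])
    fix j
    show "integrable N (?h j)"
      using iexp_integrable[of t alg "e j" "X j"] by (cases "j = i") simp_all
  qed
  also have "\<dots> = (\<Prod>j\<in>I. cfac alg t i j (e j) (X j))"
    by (intro prod.cong refl) (simp add: cfac_def psi_def psiw_def)
  finally show ?thesis .
qed

text \<open>The second moment of the difference factorises, so no conditional limit theorem is needed.\<close>

lemma prod_cfac_L2:
  fixes alg :: algorithm and t :: real and i :: nat and e :: "nat \<Rightarrow> real" and c :: complex
  assumes I: "finite I"
  defines "p \<equiv> \<lambda>X. \<Prod>j\<in>I. cfac alg t i j (e j) (X j)"
  shows "(\<integral>X. (cmod (p X - c))\<^sup>2 \<partial>PX I) =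
    (\<Prod>j\<in>I. \<integral>x. (cmod (cfac alg t i j (e j) x))\<^sup>2 \<partial>F) - 2 * Re (cnj c * (\<Prod>j\<in>I. \<integral>x. cfac alg t i j (e j) x \<partial>F)) + (cmod c)\<^sup>2"
proof -
  have [measurable]: "p \<in> borel_measurable (PX I)" unfolding p_def by measurable
  have p1: "cmod (p X) \<le> 1" for X
    unfolding p_def prod_norm[symmetric] by (intro prod_le_1) (simp add: cmod_cfac_le_1)
  have ip: "integrable (PX I) p" by (rule XZ.M1.integrable_const_bound[of _ 1]) (simp_all add: p1)
  have ip2: "integrable (PX I) (\<lambda>X. (cmod (p X))\<^sup>2)"
    by (rule XZ.M1.integrable_const_bound[of _ 1]) (simp_all add: p1 power_le_one)
  have ic: "integrable F (cfac alg t i j (e j))" for j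
    by (rule FN.M1.integrable_const_bound[of _ 1]) (simp_all add: cmod_cfac_le_1)
  have ic2: "integrable F (\<lambda>x. (cmod (cfac alg t i j (e j) x))\<^sup>2)" for j
    by (rule FN.M1.integrable_const_bound[of _ 1]) (simp_all add: cmod_cfac_le_1 power_le_one)
  have P: "(\<integral>X. p X \<partial>PX I) = (\<Prod>j\<in>I. \<integral>x. cfac alg t i j (e j) x \<partial>F)"
    unfolding p_def by (rule prod_integral_X[OF I ic])
  have P2: "(\<integral>X. (cmod (p X))\<^sup>2 \<partial>PX I) = (\<Prod>j\<in>I. \<integral>x. (cmod (cfac alg t i j (e j) x))\<^sup>2 \<partial>F)"
  proof -
    have "(cmod (p X))\<^sup>2 = (\<Prod>j\<in>I. (cmod (cfac alg t i j (e j) (X j)))\<^sup>2)" for X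
      by (simp add: p_def prod_norm[symmetric] prod_power_distrib)
    then show ?thesis using prod_integral_X[OF I ic2] by simp
  qed
  \<comment> \<open>The squared modulus of a product is again a product over coordinates, and the
    cross term is linear in the product, so both expectations factorise over the independent
    states.\<close>
  have ex: "(cmod (p X - c))\<^sup>2 = (cmod (p X))\<^sup>2 - 2 * Re (cnj c * p X) + (cmod c)\<^sup>2" for X
    unfolding cmod_power2 by (simp add: power2_eq_square algebra_simps)
  have icp: "integrable (PX I) (\<lambda>X. cnj c * p X)" using ip by (rule integrable_mult_right)
  define q where "q = (\<lambda>X. Re (cnj c * p X))"
  have q: "integrable (PX I) q" "integral\<^sup>L (PX I) q = Re (cnj c * (\<integral>X. p X \<partial>PX I))"
    unfolding q_def using integrable_Re[OF icp] by (assumption, subst integral_Re[OF icp], simp)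
  have "(\<integral>X. (cmod (p X - c))\<^sup>2 \<partial>PX I) = (\<integral>X. (cmod (p X))\<^sup>2 - 2 * q X + (cmod c)\<^sup>2 \<partial>PX I)"
    unfolding ex q_def ..
  also have "\<dots> = (\<integral>X. (cmod (p X))\<^sup>2 \<partial>PX I) - 2 * integral\<^sup>L (PX I) q + (cmod c)\<^sup>2"
    using ip2 q(1) XZ.M1.prob_space by simp
  finally show ?thesis unfolding q(2) P P2 .
qed

text \<open>The exponents come from \<open>psi_mean\<close> and \<open>psi_norm_mean\<close>. The
  second is twice the real part of the first, so the second limit is the squared modulus of the
  first.\<close>

lemma cfac_products_limit:
  assumes i: "i \<ge> 1"
    and e: "\<And>n j. n \<ge> n0 \<Longrightarrow> j \<in> {1..n} \<Longrightarrow> 0 < e n j \<and> e n j \<le> eb n"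
    and eb: "eb \<longlonglongrightarrow> 0" "\<And>n. n \<ge> n0 \<Longrightarrow> eb n \<le> 1"
    and sum: "(\<lambda>n. \<Sum>j\<in>{1..n}. e n j ^ (2 * lead_order alg)) \<longlonglongrightarrow> L"
  shows "(\<lambda>n. \<Prod>j\<in>{1..n}. \<integral>x. cfac alg t i j (e n j) x \<partial>F) \<longlonglongrightarrow> exp (- ((\<i> * of_real t + of_real (t\<^sup>2)) / 2 * Kc alg) * L)" (is ?A)
    and "(\<lambda>n. \<Prod>j\<in>{1..n}. \<integral>x. (cmod (cfac alg t i j (e n j) x))\<^sup>2 \<partial>F) \<longlonglongrightarrow> exp (- (t\<^sup>2 * Kc alg) * L)" (is ?B)
proof -
  obtain D1 where D1: "D1 \<ge> 0" "\<And>e. 0 < e \<Longrightarrow> e \<le> 1 \<Longrightarrow>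
     cmod ((\<integral>x. psi alg t e x \<partial>F) - (1 - (\<i> * of_real t + of_real (t\<^sup>2)) / 2 * (Kc alg * e ^ (2 * lead_order alg)))) \<le> D1 * e ^ (2 * lead_order alg + 1)"
    using psi_mean by blast
  obtain D2 where D2: "D2 \<ge> 0" "\<And>e. 0 < e \<Longrightarrow> e \<le> 1 \<Longrightarrow>
     \<bar>(\<integral>x. (cmod (psi alg t e x))\<^sup>2 \<partial>F) - (1 - t\<^sup>2 * (Kc alg * e ^ (2 * lead_order alg)))\<bar> \<le> D2 * e ^ (2 * lead_order alg + 1)"
    using psi_norm_mean by blast
  obtain D3 where D3: "D3 \<ge> 0" "\<And>e. 0 < e \<Longrightarrow> e \<le> 1 \<Longrightarrow>
     cmod ((\<integral>x. psiw alg t e x \<partial>F) - 1) \<le> D3 * e \<and> \<bar>(\<integral>x. (cmod (psiw alg t e x))\<^sup>2 \<partial>F) - 1\<bar> \<le> D3 * e"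
    using psiw_mean by blast
  have e1: "0 < e n j" "e n j \<le> 1" if "n \<ge> n0" "j \<in> {1..n}" for n j
    using e[OF that] eb(2)[OF that(1)] by auto
  have K: "Kc alg \<ge> 0" using Kc_pos[of alg] by simp
  show ?A
  proof (rule prod_tendsto_exp[OF lead_order_pos i, where D = "max D1 D3" and base = n0 and eb = eb])
    show "cmod (\<integral>x. cfac alg t i j (e n j) x \<partial>F) \<le> 1" for n j
    proof -
      have "cmod (\<integral>x. cfac alg t i j (e n j) x \<partial>F) \<le> (\<integral>x. cmod (cfac alg t i j (e n j) x) \<partial>F)"
        by (rule integral_norm_bound)
      also have "\<dots> \<le> (\<integral>x. 1 \<partial>F)"
        using FN.M1.integrable_const_bound[of "cfac alg t i j (e n j)" 1] cmod_cfac_le_1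
        by (intro integral_mono integrable_norm) auto
      finally show ?thesis using FN.M1.prob_space by simp
    qed
    fix n j assume n: "n \<ge> n0" "j \<in> {1..n}" "j \<noteq> i"
    have "cmod ((\<integral>x. psi alg t (e n j) x \<partial>F) - (1 - (\<i> * of_real t + of_real (t\<^sup>2)) / 2 * (Kc alg * e n j ^ (2 * lead_order alg)))) \<le> D1 * e n j ^ (2 * lead_order alg + 1)"
      by (rule D1(2)) (use e1 n in auto)
    also have "\<dots> \<le> max D1 D3 * e n j ^ (2 * lead_order alg + 1)"
      using e1[OF n(1,2)] by (intro mult_right_mono) auto
    finally show "cmod ((\<integral>x. cfac alg t i j (e n j) x \<partial>F) - (1 + - ((\<i> * of_real t + of_real (t\<^sup>2)) / 2 * Kc alg) * complex_of_real (e n j ^ (2 * lead_order alg)))) \<le> max D1 D3 * e n j ^ (2 * lead_order alg + 1)"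
      using n(3) by (simp add: cfac_def mult.assoc)
  next
    fix n assume n: "n \<ge> n0" "n \<ge> i"
    have m: "i \<in> {1..n}" using n i by simp
    have "cmod ((\<integral>x. psiw alg t (e n i) x \<partial>F) - 1) \<le> D3 * e n i" using D3(2) e1[OF n(1) m] by blast
    also have "\<dots> \<le> max D1 D3 * e n i" using e1[OF n(1) m] by (intro mult_right_mono) auto
    finally show "cmod ((\<integral>x. cfac alg t i i (e n i) x \<partial>F) - 1) \<le> max D1 D3 * e n i"
      by (simp add: cfac_def)
  next
    show "Re (- ((\<i> * of_real t + of_real (t\<^sup>2)) / 2 * Kc alg)) \<le> 0" using K by (simp add: power2_eq_square)
  qed (use D1(1) e eb sum in auto)
  \<comment> \<open>The real product is read as a complex one, so that
    \<open>prod_tendsto_exp\<close> serves both limits.\<close>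
  have "(\<lambda>n. \<Prod>j\<in>{1..n}. complex_of_real (\<integral>x. (cmod (cfac alg t i j (e n j) x))\<^sup>2 \<partial>F)) \<longlonglongrightarrow> exp (complex_of_real (- (t\<^sup>2 * Kc alg)) * L)"
  proof (rule prod_tendsto_exp[OF lead_order_pos i, where D = "max D2 D3" and base = n0 and eb = eb])
    show "cmod (complex_of_real (\<integral>x. (cmod (cfac alg t i j (e n j) x))\<^sup>2 \<partial>F)) \<le> 1" for n j
    proof -
      have "(\<integral>x. (cmod (cfac alg t i j (e n j) x))\<^sup>2 \<partial>F) \<le> (\<integral>x. 1 \<partial>F)"
        using FN.M1.integrable_const_bound[of "\<lambda>x. (cmod (cfac alg t i j (e n j) x))\<^sup>2" 1] cmod_cfac_le_1
        by (intro integral_mono) (auto simp: power_le_one)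
      moreover have "(\<integral>x. (cmod (cfac alg t i j (e n j) x))\<^sup>2 \<partial>F) \<ge> 0" by (rule integral_nonneg_AE) auto
      ultimately show ?thesis using FN.M1.prob_space by simp
    qed
    fix n j assume n: "n \<ge> n0" "j \<in> {1..n}" "j \<noteq> i"
    have "\<bar>(\<integral>x. (cmod (psi alg t (e n j) x))\<^sup>2 \<partial>F) - (1 - t\<^sup>2 * (Kc alg * e n j ^ (2 * lead_order alg)))\<bar> \<le> D2 * e n j ^ (2 * lead_order alg + 1)"
      by (rule D2(2)) (use e1 n in auto)
    also have "\<dots> \<le> max D2 D3 * e n j ^ (2 * lead_order alg + 1)"
      using e1[OF n(1,2)] by (intro mult_right_mono) auto
    finally have "cmod (complex_of_real ((\<integral>x. (cmod (cfac alg t i j (e n j) x))\<^sup>2 \<partial>F) - (1 + - (t\<^sup>2 * Kc alg) * e n j ^ (2 * lead_order alg)))) \<le> max D2 D3 * e n j ^ (2 * lead_order alg + 1)"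
      unfolding norm_of_real using n(3) by (simp add: cfac_def mult.assoc)
    then show "cmod (complex_of_real (\<integral>x. (cmod (cfac alg t i j (e n j) x))\<^sup>2 \<partial>F) - (1 + complex_of_real (- (t\<^sup>2 * Kc alg)) * complex_of_real (e n j ^ (2 * lead_order alg)))) \<le> max D2 D3 * e n j ^ (2 * lead_order alg + 1)"
      by simp
  next
    fix n assume n: "n \<ge> n0" "n \<ge> i"
    have m: "i \<in> {1..n}" using n i by simp
    have "\<bar>(\<integral>x. (cmod (psiw alg t (e n i) x))\<^sup>2 \<partial>F) - 1\<bar> \<le> D3 * e n i" using D3(2) e1[OF n(1) m] by blast
    also have "\<dots> \<le> max D2 D3 * e n i" using e1[OF n(1) m] by (intro mult_right_mono) auto
    finally have "cmod (complex_of_real ((\<integral>x. (cmod (cfac alg t i i (e n i) x))\<^sup>2 \<partial>F) - 1)) \<le> max D2 D3 * e n i"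
      unfolding norm_of_real by (simp add: cfac_def)
    then show "cmod (complex_of_real (\<integral>x. (cmod (cfac alg t i i (e n i) x))\<^sup>2 \<partial>F) - 1) \<le> max D2 D3 * e n i"
      by simp
  next
    show "Re (complex_of_real (- (t\<^sup>2 * Kc alg))) \<le> 0" using K by simp
  qed (use D2(1) e eb sum in auto)
  then have "(\<lambda>n. complex_of_real (\<Prod>j\<in>{1..n}. \<integral>x. (cmod (cfac alg t i j (e n j) x))\<^sup>2 \<partial>F)) \<longlonglongrightarrow> complex_of_real (exp (- (t\<^sup>2 * Kc alg) * L))"
    by (simp only: of_real_prod exp_of_real of_real_mult[symmetric])
  then show ?B by (simp only: tendsto_of_real_iff)
qed

end

declare One_nat_def [simp del]

context smooth_density begin

text \<open>
  The weight enters only through its bound: this is how the target, whose density with respect to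
  the reference measure is bounded, inherits the limit from the product measure.
\<close>

lemma weighted_char_limit:
  fixes w :: "nat \<Rightarrow> (nat \<Rightarrow> real) \<Rightarrow> real" and L :: real
  assumes i: "i \<ge> 1" "i \<le> n0"
    and e: "\<And>n j. n \<ge> n0 \<Longrightarrow> j \<in> {1..n} \<Longrightarrow> 0 < e n j \<and> e n j \<le> eb n"
    and eb: "eb \<longlonglongrightarrow> 0" "\<And>n. n \<ge> n0 \<Longrightarrow> eb n \<le> 1"
    and sum: "(\<lambda>n. \<Sum>j\<in>{1..n}. e n j ^ (2 * lead_order alg)) \<longlonglongrightarrow> L"
    and w: "\<And>n. n \<ge> n0 \<Longrightarrow> w n \<in> borel_measurable (PX {1..n})"
      "\<And>n X. n \<ge> n0 \<Longrightarrow> X \<in> space (PX {1..n}) \<Longrightarrow> 0 \<le> w n X \<and> w n X \<le> B"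
      "\<And>n. n \<ge> n0 \<Longrightarrow> (\<integral>X. w n X \<partial>PX {1..n}) = 1"
  shows "(\<lambda>n. \<integral>X. w n X * (\<integral>Z. of_real ((Z i)\<^sup>2) * iexp (t * logsum alg (e n) {1..n} X Z) \<partial>PZ {1..n}) \<partial>PX {1..n})
     \<longlonglongrightarrow> exp (- ((\<i> * of_real t + of_real (t\<^sup>2)) / 2 * Kc alg) * L)"
proof -
  define c where "c = exp (- ((\<i> * of_real t + of_real (t\<^sup>2)) / 2 * Kc alg) * complex_of_real L)"
  define p where "p = (\<lambda>n X. \<Prod>j\<in>{1..n}. cfac alg t i j (e n j) (X j))"
  define d2 where "d2 = (\<lambda>n. \<integral>X. (cmod (p n X - c))\<^sup>2 \<partial>PX {1..n})"
  \<comment> \<open>This makes |c|^2 the limit of the second product, so the three terms of the mean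
    square distance cancel in the limit.\<close>
  have c2: "(cmod c)\<^sup>2 = exp (- (t\<^sup>2 * Kc alg) * L)"
    by (simp add: c_def norm_exp_eq_Re power2_eq_square exp_add[symmetric] algebra_simps del: One_nat_def)
  have "(\<lambda>n. (\<Prod>j\<in>{1..n}. \<integral>x. (cmod (cfac alg t i j (e n j) x))\<^sup>2 \<partial>F)
      - 2 * Re (cnj c * (\<Prod>j\<in>{1..n}. \<integral>x. cfac alg t i j (e n j) x \<partial>F)) + (cmod c)\<^sup>2)
     \<longlonglongrightarrow> (cmod c)\<^sup>2 - 2 * Re (cnj c * c) + (cmod c)\<^sup>2"
    unfolding c2 unfolding c_def
    by (intro tendsto_intros cfac_products_limit[OF i(1) e eb sum])
  moreover have "(cmod c)\<^sup>2 - 2 * Re (cnj c * c) + (cmod c)\<^sup>2 = 0"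
    unfolding cmod_power2 by (simp add: power2_eq_square)
  ultimately have d2: "d2 \<longlonglongrightarrow> 0"
    unfolding d2_def p_def by (simp only: prod_cfac_L2[OF finite_atLeastAtMost])
  let ?J = "\<lambda>n. \<integral>X. w n X * (\<integral>Z. of_real ((Z i)\<^sup>2) * iexp (t * logsum alg (e n) {1..n} X Z) \<partial>PZ {1..n}) \<partial>PX {1..n}"
  have B: "B \<ge> 0"
  proof -
    have "space (PX {1..n0}) \<noteq> {}" using XZ.M1.not_empty .
    then show ?thesis using w(2)[of n0] by (meson all_not_in_conv order_refl order_trans)
  qed
  have bound: "cmod (?J n - c) \<le> B * sqrt (d2 n)" if n: "n \<ge> n0" for n
  proof -
    have [measurable]: "w n \<in> borel_measurable (PX {1..n})" by (rule w(1)[OF n])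
    have [measurable]: "p n \<in> borel_measurable (PX {1..n})" unfolding p_def by measurable
    have ii: "i \<in> {1..n}" using i n by simp
    have p1: "cmod (p n X) \<le> 1" for X
      unfolding p_def prod_norm[symmetric] by (intro prod_le_1) (simp add: cmod_cfac_le_1)
    have pc: "cmod (p n X - c) \<le> 1 + cmod c" for X
      using norm_triangle_ineq4[of "p n X" c] p1[of X] by simp
    have pc2: "(cmod (p n X - c))\<^sup>2 \<le> (1 + cmod c)\<^sup>2" for X
      by (rule power_mono[OF pc]) simp
    have iw: "integrable (PX {1..n}) (w n)"
      by (rule XZ.M1.integrable_const_bound[where B = B]) (use w(1,2)[OF n] in auto)
    have ipc: "integrable (PX {1..n}) (\<lambda>X. cmod (p n X - c))"
      by (rule XZ.M1.integrable_const_bound[where B = "1 + cmod c"]) (use pc in auto)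
    have ipc2: "integrable (PX {1..n}) (\<lambda>X. (cmod (p n X - c))\<^sup>2)"
      by (rule XZ.M1.integrable_const_bound[where B = "(1 + cmod c)\<^sup>2"]) (use pc2 in auto)
    have iwp: "integrable (PX {1..n}) (\<lambda>X. of_real (w n X) * p n X)"
      by (rule XZ.M1.integrable_const_bound[where B = "B * 1"])
        (use w(2)[OF n] p1 B in \<open>auto simp: norm_mult intro!: AE_I2 mult_mono[of _ B _ 1, simplified]\<close>)
    \<comment> \<open>The weight integrates to one, so the constant c can be moved under the
      integral.\<close>
    have "?J n - c = (\<integral>X. of_real (w n X) * p n X \<partial>PX {1..n}) - (\<integral>X. of_real (w n X) * c \<partial>PX {1..n})"
      unfolding conditional_char[OF finite_atLeastAtMost ii] p_def using w(3)[OF n] by simp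
    also have "\<dots> = (\<integral>X. of_real (w n X) * p n X - of_real (w n X) * c \<partial>PX {1..n})"
      by (rule Bochner_Integration.integral_diff[symmetric, OF iwp integrable_mult_left[OF integrable_of_real[OF iw]]])
    finally have eq: "?J n - c = \<dots>" .
    have "cmod (?J n - c) \<le> (\<integral>X. cmod (of_real (w n X) * p n X - of_real (w n X) * c) \<partial>PX {1..n})"
      unfolding eq by (rule integral_norm_bound)
    also have "\<dots> \<le> (\<integral>X. B * cmod (p n X - c) \<partial>PX {1..n})"
    proof (rule integral_mono)
      show "integrable (PX {1..n}) (\<lambda>X. cmod (of_real (w n X) * p n X - of_real (w n X) * c))"
        by (intro integrable_norm Bochner_Integration.integrable_diff iwp integrable_mult_left integrable_of_real iw)
      show "integrable (PX {1..n}) (\<lambda>X. B * cmod (p n X - c))" by (intro integrable_mult_right ipc)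
      fix X assume "X \<in> space (PX {1..n})"
      then show "cmod (of_real (w n X) * p n X - of_real (w n X) * c) \<le> B * cmod (p n X - c)"
        unfolding right_diff_distrib[symmetric] norm_mult using w(2)[OF n] by (intro mult_right_mono) auto
    qed
    also have "\<dots> = B * (\<integral>X. cmod (p n X - c) \<partial>PX {1..n})" by simp
    also have "\<dots> \<le> B * sqrt (d2 n)"
    proof (intro mult_left_mono B real_le_rsqrt)
      show "(\<integral>X. cmod (p n X - c) \<partial>PX {1..n})\<^sup>2 \<le> d2 n"
        unfolding d2_def by (rule XZ.M1.square_integral_le[OF ipc ipc2])
    qed
    finally show ?thesis .
  qed
  have "(\<lambda>n. ?J n - c) \<longlonglongrightarrow> 0"
  proof (rule Lim_null_comparison)
    show "eventually (\<lambda>n. norm (?J n - c) \<le> B * sqrt (d2 n)) sequentially"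
      using eventually_ge_at_top[of n0] by eventually_elim (rule bound)
    have "(\<lambda>n. B * sqrt (d2 n)) \<longlonglongrightarrow> B * sqrt 0" by (intro tendsto_intros d2)
    then show "(\<lambda>n. B * sqrt (d2 n)) \<longlonglongrightarrow> 0" by simp
  qed
  then show ?thesis unfolding c_def by (simp only: LIM_zero_iff)
qed

text \<open>The weight w times the squared noise of coordinate i integrates to one and so defines a
  probability measure. Under it the characteristic functions of \<open>logsum\<close> converge by
  \<open>weighted_char_limit\<close>, and the acceptance rate is the integral of the bounded
  continuous function min 1 (exp r).\<close>

lemma weighted_acceptance_limit:
  fixes w :: "nat \<Rightarrow> (nat \<Rightarrow> real) \<Rightarrow> real" and L :: real
  assumes i: "i \<ge> 1" "i \<le> n0"
    and e: "\<And>n j. n \<ge> n0 \<Longrightarrow> j \<in> {1..n} \<Longrightarrow> 0 < e n j \<and> e n j \<le> eb n"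
    and eb: "eb \<longlonglongrightarrow> 0" "\<And>n. n \<ge> n0 \<Longrightarrow> eb n \<le> 1"
    and sum: "(\<lambda>n. \<Sum>j\<in>{1..n}. e n j ^ (2 * lead_order alg)) \<longlonglongrightarrow> L"
    and w: "\<And>n. n \<ge> n0 \<Longrightarrow> w n \<in> borel_measurable (PX {1..n})"
      "\<And>n X. n \<ge> n0 \<Longrightarrow> X \<in> space (PX {1..n}) \<Longrightarrow> 0 \<le> w n X \<and> w n X \<le> B"
      "\<And>n. n \<ge> n0 \<Longrightarrow> (\<integral>X. w n X \<partial>PX {1..n}) = 1"
  shows "(\<lambda>n. \<integral>p. w n (fst p) * (snd p i)\<^sup>2 * min 1 (exp (logsum alg (e n) {1..n} (fst p) (snd p)))
       \<partial>(PX {1..n} \<Otimes>\<^sub>M PZ {1..n})) \<longlonglongrightarrow> 2 * std_normal_cdf (- (sqrt (Kc alg * L) / 2))"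
proof -
  define Q where "Q = (\<lambda>n. PX {1..n} \<Otimes>\<^sub>M PZ {1..n})"
  define W where "W = (\<lambda>n p. w n (fst p) * (snd p i)\<^sup>2 :: real)"
  define T where "T = (\<lambda>n p. logsum alg (e n) {1..n} (fst p) (snd p))"
  \<comment> \<open>The index is shifted by n0 because the weights are known to be probability
    densities only from n0 on, whereas weak convergence asks for a probability measure at every
    index.\<close>
  define \<mu> where "\<mu> = (\<lambda>n. distr (density (Q (n + n0)) (\<lambda>p. ennreal (W (n + n0) p))) borel (T (n + n0)))"
  define \<tau> where "\<tau> = sqrt (Kc alg * L)"
  define \<nu> where "\<nu> = distr std_normal_distribution borel (\<lambda>z. \<tau> * z - \<tau>\<^sup>2 / 2)"
  have ii: "i \<in> {1..n}" if "n \<ge> n0" for n using i that by simp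
  have T_meas [measurable]: "T n \<in> borel_measurable (Q n)" for n
    unfolding T_def Q_def by measurable
  have W_meas: "W n \<in> borel_measurable (Q n)" if n: "n \<ge> n0" for n
  proof -
    have [measurable]: "w n \<in> borel_measurable (PX {1..n})" by (rule w(1)[OF n])
    have [measurable]: "(\<lambda>Z. Z i) \<in> borel_measurable (PZ {1..n})"
      using measurable_component_singleton[OF ii[OF n], of "\<lambda>_. N"] by (simp del: One_nat_def)
    show ?thesis unfolding W_def Q_def by measurable
  qed
  have W_nn: "W n p \<ge> 0" if "n \<ge> n0" "p \<in> space (Q n)" for n p
    using w(2)[OF that(1), of "fst p"] that(2) by (auto simp: W_def Q_def space_pair_measure)
  have Zi: "integrable (PZ {1..n}) (\<lambda>Z. (Z i)\<^sup>2)" "(\<integral>Z. (Z i)\<^sup>2 \<partial>PZ {1..n}) = 1" if n: "n \<ge> n0" for n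
  proof -
    have d: "distr (PZ {1..n}) N (\<lambda>Z. Z i) = N"
      by (rule distr_PiM_component[OF N_prob ii[OF n]])
    have m: "(\<lambda>Z. Z i) \<in> measurable (PZ {1..n}) N"
      by (rule measurable_component_singleton[OF ii[OF n]])
    have "integrable (distr (PZ {1..n}) N (\<lambda>Z. Z i)) (\<lambda>z. z\<^sup>2)"
      unfolding d by (rule N_integrable_power)
    then show "integrable (PZ {1..n}) (\<lambda>Z. (Z i)\<^sup>2)" by (rule integrable_distr[OF m])
    have "(\<integral>Z. (Z i)\<^sup>2 \<partial>PZ {1..n}) = (\<integral>z. z\<^sup>2 \<partial>distr (PZ {1..n}) N (\<lambda>Z. Z i))"
      by (rule integral_distr[symmetric, OF m]) simp
    then show "(\<integral>Z. (Z i)\<^sup>2 \<partial>PZ {1..n}) = 1" unfolding d by (simp add: N_moments)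
  qed
  have W_int: "integrable (Q n) (W n)" if n: "n \<ge> n0" for n
  proof -
    have B: "0 \<le> w n X" "w n X \<le> B" if "X \<in> space (PX {1..n})" for X using w(2)[OF n that] by auto
    have iw: "integrable (PX {1..n}) (w n)"
      by (rule XZ.M1.integrable_const_bound[where B = B]) (use w(1,2)[OF n] in auto)
    show ?thesis unfolding W_def Q_def
    proof (rule XZ.Fubini_integrable)
      show "(\<lambda>p. w n (fst p) * (snd p i)\<^sup>2) \<in> borel_measurable (PX {1..n} \<Otimes>\<^sub>M PZ {1..n})"
        using W_meas[OF n] by (simp add: W_def[abs_def] Q_def)
      have "(\<integral>Z. norm (w n (fst (X, Z)) * (snd (X, Z) i)\<^sup>2) \<partial>PZ {1..n}) = norm (w n X)" for X
        using Zi[OF n] by (simp add: abs_mult del: One_nat_def)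
      then show "integrable (PX {1..n}) (\<lambda>X. \<integral>Z. norm (w n (fst (X, Z)) * (snd (X, Z) i)\<^sup>2) \<partial>PZ {1..n})"
        using iw by (simp only: integrable_norm)
      show "AE X in PX {1..n}. integrable (PZ {1..n}) (\<lambda>Z. w n (fst (X, Z)) * (snd (X, Z) i)\<^sup>2)"
        using Zi[OF n] by (simp del: One_nat_def)
    qed
  qed
  have W_one: "(\<integral>p. W n p \<partial>Q n) = 1" if n: "n \<ge> n0" for n
  proof -
    have "(\<integral>p. W n p \<partial>Q n) = (\<integral>X. \<integral>Z. W n (X, Z) \<partial>PZ {1..n} \<partial>PX {1..n})"
      using XZ.integral_fst'[OF W_int[OF n, unfolded Q_def]] by (simp add: Q_def)
    also have "\<dots> = 1" unfolding W_def using Zi[OF n] w(3)[OF n] by (simp del: One_nat_def)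
    finally show ?thesis .
  qed
  have int_mu: "(\<integral>r. h r \<partial>\<mu> n) = (\<integral>p. W (n + n0) p *\<^sub>R h (T (n + n0) p) \<partial>Q (n + n0))"
    if [measurable]: "h \<in> borel_measurable borel" for h :: "real \<Rightarrow> 'c :: {banach, second_countable_topology}" and n
  proof -
    note [measurable] = W_meas[of "n + n0", simplified]
    have "(\<integral>r. h r \<partial>\<mu> n) = (\<integral>p. h (T (n + n0) p) \<partial>density (Q (n + n0)) (\<lambda>p. ennreal (W (n + n0) p)))"
      unfolding \<mu>_def by (rule integral_distr) measurable
    also have "\<dots> = (\<integral>p. W (n + n0) p *\<^sub>R h (T (n + n0) p) \<partial>Q (n + n0))"
      by (rule integral_density) (use W_nn[of "n + n0"] in \<open>auto intro!: AE_I2\<close>)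
    finally show ?thesis .
  qed
  have mu: "real_distribution (\<mu> n)" for n
  proof -
    note [measurable] = W_meas[of "n + n0", simplified]
    have "emeasure (density (Q (n + n0)) (\<lambda>p. ennreal (W (n + n0) p))) (space (Q (n + n0))) = (\<integral>\<^sup>+p. ennreal (W (n + n0) p) \<partial>Q (n + n0))"
      by (subst emeasure_density) (auto intro!: nn_integral_cong)
    also have "\<dots> = 1"
      using nn_integral_eq_integral[OF W_int[of "n + n0"]] W_nn[of "n + n0"] W_one[of "n + n0"]
      by (simp add: AE_I2)
    finally have "prob_space (density (Q (n + n0)) (\<lambda>p. ennreal (W (n + n0) p)))"
      by (intro prob_spaceI) simp
    from prob_space.prob_space_distr[OF this, of "T (n + n0)" borel]
    show ?thesis unfolding \<mu>_def real_distribution_def real_distribution_axioms_def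
      by simp
  qed
  have nu: "real_distribution \<nu>"
    unfolding \<nu>_def real_distribution_def real_distribution_axioms_def
    using FN.M2.prob_space_distr[of "\<lambda>z. \<tau> * z - \<tau>\<^sup>2 / 2" borel] by simp
  have L: "L \<ge> 0"
    by (rule LIMSEQ_le_const[OF sum], rule exI[of _ n0]) (auto intro!: sum_nonneg zero_le_power less_imp_le[OF e[THEN conjunct1]])
  then have tau: "\<tau> \<ge> 0" "\<tau>\<^sup>2 = Kc alg * L" using Kc_pos[of alg] by (auto simp: \<tau>_def)
  have char_nu: "char \<nu> t = exp (- ((\<i> * of_real t + of_real (t\<^sup>2)) / 2 * Kc alg) * L)" for t
  proof -
    have "char \<nu> t = (\<integral>z. iexp (t * (\<tau> * z - \<tau>\<^sup>2 / 2)) \<partial>std_normal_distribution)"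
      unfolding char_def \<nu>_def by (rule integral_distr) measurable
    also have "\<dots> = (\<integral>z. iexp (- t * \<tau>\<^sup>2 / 2) * iexp ((t * \<tau>) * z) \<partial>std_normal_distribution)"
      by (intro Bochner_Integration.integral_cong refl) (simp add: exp_add[symmetric] algebra_simps)
    also have "\<dots> = iexp (- t * \<tau>\<^sup>2 / 2) * char std_normal_distribution (t * \<tau>)"
      unfolding char_def by simp
    also have "\<dots> = exp (\<i> * of_real (- t * \<tau>\<^sup>2 / 2) + of_real (- ((t * \<tau>)\<^sup>2) / 2))"
      unfolding char_std_normal_distribution by (simp only: exp_add exp_of_real)
    also have "\<i> * of_real (- t * \<tau>\<^sup>2 / 2) + of_real (- ((t * \<tau>)\<^sup>2) / 2) = - ((\<i> * of_real t + of_real (t\<^sup>2)) / 2 * Kc alg) * complex_of_real L"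
      unfolding power_mult_distrib tau(2) by (simp add: field_simps)
    finally show ?thesis .
  qed
  have char_mu: "char (\<mu> n) t = (\<integral>X. w (n + n0) X * (\<integral>Z. of_real ((Z i)\<^sup>2) * iexp (t * logsum alg (e (n + n0)) {1..n + n0} X Z) \<partial>PZ {1..n + n0}) \<partial>PX {1..n + n0})" for n t
  proof -
    let ?n = "n + n0"
    have n: "?n \<ge> n0" by simp
    note [measurable] = W_meas[OF n]
    have i1: "integrable (Q ?n) (\<lambda>p. W ?n p *\<^sub>R iexp (t * T ?n p))"
      by (rule Bochner_Integration.integrable_bound[OF W_int[OF n]]) auto
    have "char (\<mu> n) t = (\<integral>p. W ?n p *\<^sub>R iexp (t * T ?n p) \<partial>Q ?n)"
      unfolding char_def by (rule int_mu) measurable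
    also have "\<dots> = (\<integral>X. \<integral>Z. W ?n (X, Z) *\<^sub>R iexp (t * T ?n (X, Z)) \<partial>PZ {1..?n} \<partial>PX {1..?n})"
      using XZ.integral_fst'[OF i1[unfolded Q_def]] by (simp add: Q_def)
    also have "\<dots> = (\<integral>X. w ?n X * (\<integral>Z. of_real ((Z i)\<^sup>2) * iexp (t * logsum alg (e ?n) {1..?n} X Z) \<partial>PZ {1..?n}) \<partial>PX {1..?n})"
      by (simp add: W_def T_def scaleR_conv_of_real mult.assoc del: One_nat_def)
    finally show ?thesis .
  qed
  have wc: "weak_conv_m \<mu> \<nu>"
  proof (rule levy_continuity[OF mu nu])
    fix t
    show "(\<lambda>n. char (\<mu> n) t) \<longlonglongrightarrow> char \<nu> t"
      unfolding char_mu char_nu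
      by (rule LIMSEQ_ignore_initial_segment[OF weighted_char_limit[OF i e eb sum w]])
  qed
  have "(\<lambda>n. \<integral>r. min 1 (exp r) \<partial>\<mu> n) \<longlonglongrightarrow> (\<integral>r. min 1 (exp r) \<partial>\<nu>)"
    using mu nu wc
    by (rule weak_conv_imp_integral_bdd_continuous_conv[where B = 1]) (auto intro!: continuous_intros)
  also have "(\<integral>r. min 1 (exp r) \<partial>\<nu>) = (\<integral>z. min 1 (exp (\<tau> * z - \<tau>\<^sup>2 / 2)) \<partial>std_normal_distribution)"
    unfolding \<nu>_def by (rule integral_distr) measurable
  also have "\<dots> = 2 * std_normal_cdf (- (\<tau> / 2))"
    by (rule gaussian_acceptance[OF tau(1)])
  finally have "(\<lambda>n. \<integral>p. W (n + n0) p * min 1 (exp (T (n + n0) p)) \<partial>Q (n + n0)) \<longlonglongrightarrow> 2 * std_normal_cdf (- (\<tau> / 2))"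
    by (simp add: int_mu)
  from LIMSEQ_offset[OF this] show ?thesis
    by (simp only: W_def T_def Q_def \<tau>_def)
qed

end

section \<open>Reduction to independent coordinates\<close>

lemma uniform_acceptance:
  assumes "0 \<le> a" "a \<le> 1"
  shows "(\<integral>\<^sup>+u. (if u < a then c else 0) \<partial>uniform_measure lborel {0..1::real}) = c * ennreal a"
proof -
  have "(\<integral>\<^sup>+u. (if u < a then c else 0) \<partial>uniform_measure lborel {0..1::real}) =
      (\<integral>\<^sup>+u. c * indicator {..<a} u \<partial>uniform_measure lborel {0..1::real})"
    by (intro nn_integral_cong) (auto simp: indicator_def)
  also have "\<dots> = c * emeasure (uniform_measure lborel {0..1}) {..<a}"
    by (rule nn_integral_cmult_indicator) simp
  also have "emeasure (uniform_measure lborel {0..1}) {..<a} = emeasure lborel ({0..1} \<inter> {..<a}) / emeasure lborel {0..1::real}"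
    by (rule emeasure_uniform_measure) auto
  also have "{0..1} \<inter> {..<a} = {0..<a}" using assms by auto
  finally show ?thesis using assms divide_ennreal[of a 1] by simp
qed

text \<open>
  In the coordinates \<open>X j = x j / lam \<kappa> j\<close> the reference measure is a power of a single
  distribution, and the step size of the \<open>j\<close>-th coordinate becomes \<open>\<sigma> / lam \<kappa> j\<close>.
\<close>

definition stretch :: "real \<Rightarrow> nat \<Rightarrow> (nat \<Rightarrow> real) \<Rightarrow> nat \<Rightarrow> real" where
  "stretch \<kappa> n X = (\<lambda>j\<in>{1..n}. lam \<kappa> j * X j)"

lemma lam_pos: "j \<ge> 1 \<Longrightarrow> lam \<kappa> j > 0"
  by (simp add: lam_def)

lemma stretch_in_Rn: "stretch \<kappa> n X \<in> Rn n"
  by (auto simp: stretch_def)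

context smooth_density begin

lemma stretch_measurable [measurable]: "stretch \<kappa> n \<in> measurable (PX {1..n}) (lborel_n n)"
  unfolding stretch_def by measurable

lemma ref_dens_measurable: "ref_dens f \<kappa> n \<in> borel_measurable (lborel_n n)"
  unfolding ref_dens_def by measurable

text \<open>Both measures are compared on boxes with the product of the scaled marginals
  \<open>M j\<close>. A linear substitution identifies the density of each marginal with a factor of
  \<open>ref_dens\<close>.\<close>

lemma distr_stretch: "distr (PX {1..n}) (lborel_n n) (stretch \<kappa> n) = ref_measure f \<kappa> n"
proof -
  define M where "M = (\<lambda>j. distr F lborel (\<lambda>t. lam \<kappa> j * t))"
  interpret P: product_prob_space "\<lambda>_::nat. F"
    by (intro product_prob_spaceI f_prob)
  interpret L: product_sigma_finite "\<lambda>_::nat. lborel :: real measure" ..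
  have prob_M: "prob_space (M j)" for j
    unfolding M_def by (rule FN.M1.prob_space_distr) measurable
  interpret MM: product_prob_space M
    by (intro product_prob_spaceI prob_M)
  have setsM: "sets (PiM {1..n} M) = sets (lborel_n n)"
    by (intro sets_PiM_cong) (auto simp: M_def)
  have M_eq: "M j = density lborel (\<lambda>t. ennreal (inverse (lam \<kappa> j) * f (t / lam \<kappa> j)))" if j: "j \<in> {1..n}" for j
  proof (rule measure_eqI)
    have l: "lam \<kappa> j > 0" using j lam_pos by simp
    fix A assume "A \<in> sets (M j)"
    then have [measurable]: "A \<in> sets borel" by (simp add: M_def)
    have "emeasure (M j) A = (\<integral>\<^sup>+t. indicator A t \<partial>M j)" by (simp add: M_def)
    also have "\<dots> = (\<integral>\<^sup>+t. indicator A (lam \<kappa> j * t) \<partial>F)"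
      unfolding M_def by (rule nn_integral_distr) measurable
    also have "\<dots> = (\<integral>\<^sup>+t. ennreal (f t) * indicator A (lam \<kappa> j * t) \<partial>lborel)"
      by (rule nn_integral_density) auto
    also have "\<dots> = ennreal \<bar>inverse (lam \<kappa> j)\<bar> * (\<integral>\<^sup>+t. ennreal (f (0 + inverse (lam \<kappa> j) * t)) * indicator A (lam \<kappa> j * (0 + inverse (lam \<kappa> j) * t)) \<partial>lborel)"
      by (rule nn_integral_real_affine) (use l in auto)
    also have "\<dots> = (\<integral>\<^sup>+t. ennreal (inverse (lam \<kappa> j)) * (ennreal (f (t / lam \<kappa> j)) * indicator A t) \<partial>lborel)"
      using l by (subst nn_integral_cmult[symmetric]) (auto simp: field_simps)
    also have "\<dots> = (\<integral>\<^sup>+t. ennreal (inverse (lam \<kappa> j) * f (t / lam \<kappa> j)) * indicator A t \<partial>lborel)"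
      using l by (intro nn_integral_cong) (simp add: ennreal_mult' mult.assoc)
    also have "\<dots> = emeasure (density lborel (\<lambda>t. ennreal (inverse (lam \<kappa> j) * f (t / lam \<kappa> j)))) A"
      by (rule emeasure_density[symmetric]) auto
    finally show "emeasure (M j) A = emeasure (density lborel (\<lambda>t. ennreal (inverse (lam \<kappa> j) * f (t / lam \<kappa> j)))) A" .
  qed (simp add: M_def)
  have "distr (PX {1..n}) (lborel_n n) (stretch \<kappa> n) = PiM {1..n} M"
  proof (rule MM.PiM_eqI)
    fix A assume A: "\<And>i. i \<in> {1..n} \<Longrightarrow> A i \<in> sets (M i)"
    have A' [measurable]: "i \<in> {1..n} \<Longrightarrow> A i \<in> sets borel" for i
      using A[of i] by (simp add: M_def)
    have eq: "stretch \<kappa> n -` Pi\<^sub>E {1..n} A \<inter> space (PX {1..n}) = Pi\<^sub>E {1..n} (\<lambda>i. (\<lambda>t. lam \<kappa> i * t) -` A i)"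
      by (auto simp: stretch_def space_PiM PiE_iff Pi_iff)
    have vA: "(\<lambda>t. lam \<kappa> i * t) -` A i \<in> sets borel" if "i \<in> {1..n}" for i
      using measurable_sets_borel[of "\<lambda>t. lam \<kappa> i * t" "borel :: real measure" "A i"] A'[OF that] by simp
    have "emeasure (distr (PX {1..n}) (lborel_n n) (stretch \<kappa> n)) (Pi\<^sub>E {1..n} A) =
          emeasure (PX {1..n}) (Pi\<^sub>E {1..n} (\<lambda>i. (\<lambda>t. lam \<kappa> i * t) -` A i))"
      by (subst emeasure_distr[OF stretch_measurable]) (auto simp: eq simp del: One_nat_def intro!: sets_PiM_I_finite A')
    also have "\<dots> = (\<Prod>i\<in>{1..n}. emeasure F ((\<lambda>t. lam \<kappa> i * t) -` A i))"
      by (rule P.emeasure_PiM) (auto intro: vA)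
    also have "\<dots> = (\<Prod>i\<in>{1..n}. emeasure (M i) (A i))"
      unfolding M_def by (intro prod.cong refl, subst emeasure_distr) (auto simp: A')
    finally show "emeasure (distr (PX {1..n}) (lborel_n n) (stretch \<kappa> n)) (Pi\<^sub>E {1..n} A) = (\<Prod>i\<in>{1..n}. emeasure (M i) (A i))" .
  qed (simp_all del: One_nat_def add: setsM)
  also have "\<dots> = ref_measure f \<kappa> n"
  proof (rule MM.PiM_eqI[symmetric])
    fix A assume A: "\<And>i. i \<in> {1..n} \<Longrightarrow> A i \<in> sets (M i)"
    have A' [measurable]: "i \<in> {1..n} \<Longrightarrow> A i \<in> sets borel" for i
      using A[of i] by (simp add: M_def)
    note [measurable] = ref_dens_measurable
    have ind: "indicator (Pi\<^sub>E {1..n} A) y = (\<Prod>i\<in>{1..n}. indicator (A i) (y i) :: ennreal)"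
      if y: "y \<in> Rn n" for y
    proof (cases "y \<in> Pi\<^sub>E {1..n} A")
      case True
      then show ?thesis by (auto simp: PiE_iff)
    next
      case False
      then obtain i where "i \<in> {1..n}" "y i \<notin> A i" using y by (auto simp: PiE_iff)
      then have "(\<Prod>i\<in>{1..n}. indicator (A i) (y i) :: ennreal) = 0"
        by (intro prod_zero) (auto intro!: bexI[of _ i])
      with False show ?thesis by simp
    qed
    have nn: "inverse (lam \<kappa> i) * f t \<ge> 0" for i t
      using f_pos[of t] by (auto simp: lam_def intro!: mult_nonneg_nonneg less_imp_le)
    have "emeasure (ref_measure f \<kappa> n) (Pi\<^sub>E {1..n} A) =
      (\<integral>\<^sup>+ y. ennreal (ref_dens f \<kappa> n y) * indicator (Pi\<^sub>E {1..n} A) y \<partial>lborel_n n)"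
      unfolding ref_measure_def
      by (rule emeasure_density) (auto simp del: One_nat_def intro!: sets_PiM_I_finite A')
    also have "\<dots> = (\<integral>\<^sup>+ y. (\<Prod>i\<in>{1..n}. ennreal (inverse (lam \<kappa> i) * f (y i / lam \<kappa> i)) * indicator (A i) (y i)) \<partial>lborel_n n)"
      by (intro nn_integral_cong)
         (simp del: One_nat_def add: ind[unfolded space_lborel_n[symmetric]] ref_dens_def prod_ennreal[OF nn] prod.distrib)
    also have "\<dots> = (\<Prod>i\<in>{1..n}. \<integral>\<^sup>+ t. ennreal (inverse (lam \<kappa> i) * f (t / lam \<kappa> i)) * indicator (A i) t \<partial>lborel)"
      by (rule L.product_nn_integral_prod) auto
    also have "\<dots> = (\<Prod>i\<in>{1..n}. emeasure (M i) (A i))"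
      by (intro prod.cong refl, subst M_eq, simp, subst emeasure_density) (auto simp: A')
    finally show "emeasure (ref_measure f \<kappa> n) (Pi\<^sub>E {1..n} A) = (\<Prod>i\<in>{1..n}. emeasure (M i) (A i))" .
  qed (simp_all del: One_nat_def add: setsM ref_measure_def)
  finally show ?thesis .
qed

definition propn :: "algorithm \<Rightarrow> (nat \<Rightarrow> real) \<Rightarrow> (nat \<Rightarrow> real) \<Rightarrow> (nat \<Rightarrow> real) \<Rightarrow> nat \<Rightarrow> real" where
  "propn alg e X Z j = prop1 alg g (e j) (X j) (Z j)"

lemma proposal_mean_stretch:
  assumes "j \<in> {1..n}"
  shows "proposal_mean alg g \<kappa> \<sigma> (stretch \<kappa> n X) j = lam \<kappa> j * mean1 alg g (\<sigma> / lam \<kappa> j) (X j)"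
  using assms lam_pos[of j \<kappa>]
  by (cases alg) (auto simp: proposal_mean_def mean1_def stretch_def field_simps power2_eq_square)

lemma proposal_stretch:
  "proposal alg g \<kappa> \<sigma> n (stretch \<kappa> n X) Z = stretch \<kappa> n (propn alg (\<lambda>j. \<sigma> / lam \<kappa> j) X Z)"
proof (rule ext)
  fix j
  show "proposal alg g \<kappa> \<sigma> n (stretch \<kappa> n X) Z j = stretch \<kappa> n (propn alg (\<lambda>j. \<sigma> / lam \<kappa> j) X Z) j"
  proof (cases "j \<in> {1..n}")
    case True
    have "lam \<kappa> j > 0" using True lam_pos by simp
    then show ?thesis
      using True by (simp add: proposal_def proposal_mean_stretch stretch_def[of _ _ "propn _ _ _ _"] propn_def prop1_def distrib_left del: One_nat_def)
  qed (auto simp: proposal_def stretch_def)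
qed

text \<open>Links a coordinate of the algorithm, with step \<sigma>, to the scale-free
  \<open>logratio\<close> with step \<sigma> / l. The Gaussian normalisations agree on both sides,
  so only the exponents have to match.\<close>

lemma coordinate_ratio:
  fixes alg :: algorithm and \<sigma> l x z :: real
  assumes s: "\<sigma> > 0" and l: "l > 0"
  defines "y \<equiv> prop1 alg g (\<sigma> / l) x z"
  shows "f y * normal_density (l * mean1 alg g (\<sigma> / l) y) \<sigma> (l * x) =
    f x * normal_density (l * mean1 alg g (\<sigma> / l) x) \<sigma> (l * y) * exp (logratio alg g (\<sigma> / l) x z)"
proof -
  have e: "\<sigma> / l > 0" using s l by simp
  have nd: "normal_density (l * m) \<sigma> (l * v) = 1 / sqrt (2 * pi * \<sigma>\<^sup>2) * exp (- ((v - m) / (\<sigma> / l))\<^sup>2 / 2)" for m v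
    using s l by (simp add: normal_density_def power_divide power_mult_distrib mult_ac flip: right_diff_distrib)
  have z: "(y - mean1 alg g (\<sigma> / l) x) / (\<sigma> / l) = z" using s l by (simp add: y_def prop1_def)
  have ex: "exp a * (k * exp b) = exp c * (k * exp d) * exp r" if "a + b = c + d + r" for a b c d k r :: real
  proof -
    have "exp a * (k * exp b) = k * exp (a + b)" by (simp add: exp_add)
    also have "\<dots> = exp c * (k * exp d) * exp r" unfolding that by (simp add: exp_add)
    finally show ?thesis .
  qed
  show ?thesis
    unfolding nd z f_eq logratio_def y_def[symmetric] by (rule ex) simp
qed

text \<open>The density ratio factorises over coordinates into instances of
  \<open>coordinate_ratio\<close>. All densities are strictly positive, so the default acceptance 0
  never occurs.\<close>

lemma mh_accept_stretch:
  fixes alg :: algorithm and \<sigma> \<kappa> :: real and n :: nat and X Z :: "nat \<Rightarrow> real"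
  assumes s: "\<sigma> > 0"
  defines "e \<equiv> \<lambda>j. \<sigma> / lam \<kappa> j"
  defines "x \<equiv> stretch \<kappa> n X" and "y \<equiv> stretch \<kappa> n (propn alg e X Z)"
  shows "mh_accept (target_dens f \<kappa> \<phi> n) (proposal_dens alg g \<kappa> \<sigma> n) x y =
    min 1 (exp (\<phi> n x - \<phi> n y + logsum alg e {1..n} X Z))"
proof -
  have rd: "ref_dens f \<kappa> n (stretch \<kappa> n V) = (\<Prod>j=1..n. inverse (lam \<kappa> j) * f (V j))" for V
    unfolding ref_dens_def
    by (intro prod.cong refl) (use lam_pos[of _ \<kappa>] in \<open>auto simp: stretch_def less_imp_neq[THEN not_sym]\<close>)
  have pd: "proposal_dens alg g \<kappa> \<sigma> n (stretch \<kappa> n V) (stretch \<kappa> n U) =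
      (\<Prod>j=1..n. normal_density (lam \<kappa> j * mean1 alg g (e j) (V j)) \<sigma> (lam \<kappa> j * U j))" for V U
    unfolding proposal_dens_def e_def
    by (intro prod.cong refl) (simp add: proposal_mean_stretch stretch_def[of _ _ U])
  let ?Y = "propn alg e X Z"
  have ratio: "ref_dens f \<kappa> n y * proposal_dens alg g \<kappa> \<sigma> n y x =
     ref_dens f \<kappa> n x * proposal_dens alg g \<kappa> \<sigma> n x y * exp (logsum alg e {1..n} X Z)"
  proof -
    have "ref_dens f \<kappa> n y * proposal_dens alg g \<kappa> \<sigma> n y x =
      (\<Prod>j=1..n. inverse (lam \<kappa> j) * (f (?Y j) * normal_density (lam \<kappa> j * mean1 alg g (e j) (?Y j)) \<sigma> (lam \<kappa> j * X j)))"
      unfolding x_def y_def rd pd by (simp only: prod.distrib mult.assoc)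
    also have "\<dots> = (\<Prod>j=1..n. inverse (lam \<kappa> j) * (f (X j) * normal_density (lam \<kappa> j * mean1 alg g (e j) (X j)) \<sigma> (lam \<kappa> j * ?Y j) * exp (logratio alg g (e j) (X j) (Z j))))"
      unfolding e_def propn_def
      by (intro prod.cong refl) (subst coordinate_ratio[OF s], use lam_pos in auto)
    also have "\<dots> = ref_dens f \<kappa> n x * proposal_dens alg g \<kappa> \<sigma> n x y * exp (logsum alg e {1..n} X Z)"
      unfolding x_def y_def rd pd logsum_def by (simp only: prod.distrib mult.assoc exp_sum finite_atLeastAtMost)
    finally show ?thesis .
  qed
  have pos: "ref_dens f \<kappa> n x > 0" "proposal_dens alg g \<kappa> \<sigma> n x y > 0"
    unfolding x_def y_def rd pd using f_pos s lam_pos by (auto intro!: prod_pos mult_pos_pos normal_density_pos simp del: One_nat_def)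
  have tpos: "target_dens f \<kappa> \<phi> n x * proposal_dens alg g \<kappa> \<sigma> n x y > 0"
    unfolding target_dens_def using pos by (intro mult_pos_pos) auto
  have "target_dens f \<kappa> \<phi> n y * proposal_dens alg g \<kappa> \<sigma> n y x = exp (- \<phi> n y) * (ref_dens f \<kappa> n y * proposal_dens alg g \<kappa> \<sigma> n y x)"
    by (simp add: target_dens_def)
  also have "\<dots> = target_dens f \<kappa> \<phi> n x * proposal_dens alg g \<kappa> \<sigma> n x y * exp (\<phi> n x - \<phi> n y + logsum alg e {1..n} X Z)"
    unfolding ratio target_dens_def by (simp add: exp_add exp_diff exp_minus field_simps)
  finally have "target_dens f \<kappa> \<phi> n y * proposal_dens alg g \<kappa> \<sigma> n y x / (target_dens f \<kappa> \<phi> n x * proposal_dens alg g \<kappa> \<sigma> n x y) =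
      exp (\<phi> n x - \<phi> n y + logsum alg e {1..n} X Z)"
    by (simp only: nonzero_mult_div_cancel_left[OF less_imp_neq[OF tpos, symmetric]])
  then show ?thesis using tpos by (simp add: mh_accept_def)
qed

lemma propn_measurable [measurable]:
  "(\<lambda>p. stretch \<kappa> n (propn alg e (fst p) (snd p))) \<in> measurable (PX {1..n} \<Otimes>\<^sub>M PZ {1..n}) (lborel_n n)"
  unfolding stretch_def propn_def by measurable

text \<open>The uniform variable is integrated out and the state moved to the scale of the density.
  The computation runs in nonnegative integrals, where Fubini's theorem asks for measurability only,
  and returns to the Bochner integral at the end.\<close>

lemma sq_jump_eq:
  fixes \<sigma> :: "nat \<Rightarrow> real" and \<kappa> :: real and n :: nat
  assumes s: "\<sigma> n > 0" and i: "i \<in> {1..n}" and phi: "\<phi> n \<in> borel_measurable (lborel_n n)"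
  defines "e \<equiv> \<lambda>j. \<sigma> n / lam \<kappa> j"
  shows "sq_jump alg f g \<kappa> \<phi> \<sigma> i n = (\<sigma> n)\<^sup>2 *
    (\<integral>p. exp (- \<phi> n (stretch \<kappa> n (fst p))) * ((prop1 alg g (e i) (fst p i) (snd p i) - fst p i) / e i)\<^sup>2
       * min 1 (exp (\<phi> n (stretch \<kappa> n (fst p)) - \<phi> n (stretch \<kappa> n (propn alg e (fst p) (snd p))) + logsum alg e {1..n} (fst p) (snd p)))
       \<partial>(PX {1..n} \<Otimes>\<^sub>M PZ {1..n}))"
proof -
  note [measurable] = phi
  let ?U = "uniform_measure lborel {0..1::real}"
  let ?q = "proposal alg g \<kappa> (\<sigma> n) n"
  let ?a = "mh_accept (target_dens f \<kappa> \<phi> n) (proposal_dens alg g \<kappa> (\<sigma> n) n)"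
  interpret U: prob_space ?U by (rule prob_space_uniform_measure) auto
  have Zsp: "std_gaussian n = PZ {1..n}" by (simp add: std_gaussian_def)
  interpret ZU: pair_prob_space "PZ {1..n}" ?U ..
  have l: "lam \<kappa> i > 0" using i lam_pos by simp
  have comp [measurable]: "(\<lambda>x. x i) \<in> borel_measurable (lborel_n n)" "(\<lambda>x. x i) \<in> borel_measurable (PX {1..n})" "(\<lambda>x. x i) \<in> borel_measurable (PZ {1..n})"
    using measurable_component_singleton[OF i, of "\<lambda>_. lborel"] measurable_component_singleton[OF i, of "\<lambda>_. F"]
      measurable_component_singleton[OF i, of "\<lambda>_. N"] by simp_all
  have pm [measurable]: "(\<lambda>p. proposal_mean alg g \<kappa> (\<sigma> n) (h p) j) \<in> borel_measurable M"
    if [measurable]: "(\<lambda>p. h p j) \<in> borel_measurable M" for h j and M :: "'c measure"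
    unfolding proposal_mean_def by (cases alg) simp_all
  have tm [measurable]: "target_dens f \<kappa> \<phi> n \<in> borel_measurable (lborel_n n)"
    using ref_dens_measurable unfolding target_dens_def by measurable
  have pdm [measurable]: "(\<lambda>p. proposal_dens alg g \<kappa> (\<sigma> n) n (fst p) (snd p)) \<in> borel_measurable (lborel_n n \<Otimes>\<^sub>M lborel_n n)"
    unfolding proposal_dens_def normal_density_def by measurable
  have pdm2 [measurable]: "(\<lambda>p. proposal_dens alg g \<kappa> (\<sigma> n) n (snd p) (fst p)) \<in> borel_measurable (lborel_n n \<Otimes>\<^sub>M lborel_n n)"
    unfolding proposal_dens_def normal_density_def by measurable
  have am: "(\<lambda>p. ?a (fst p) (snd p)) \<in> borel_measurable (lborel_n n \<Otimes>\<^sub>M lborel_n n)"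
    unfolding mh_accept_def by measurable
  have qm [measurable]: "(\<lambda>p. ?q (fst p) (snd p)) \<in> measurable (lborel_n n \<Otimes>\<^sub>M PZ {1..n}) (lborel_n n)"
    unfolding proposal_def by measurable
  have am2: "(\<lambda>p. ?a (fst p) (?q (fst p) (snd p))) \<in> borel_measurable (lborel_n n \<Otimes>\<^sub>M PZ {1..n})"
    using measurable_compose[OF measurable_Pair[OF measurable_fst qm] am] by simp
  have am3 [measurable]: "(\<lambda>p. ?a (fst p) (?q (fst p) (fst (snd p)))) \<in> borel_measurable (lborel_n n \<Otimes>\<^sub>M (PZ {1..n} \<Otimes>\<^sub>M ?U))"
    using measurable_compose[OF measurable_Pair[OF measurable_fst measurable_compose[OF measurable_snd measurable_fst]] am2] by simp
  have qi [measurable]: "(\<lambda>p. ?q (fst p) (fst (snd p)) i) \<in> borel_measurable (lborel_n n \<Otimes>\<^sub>M (PZ {1..n} \<Otimes>\<^sub>M ?U))"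
    using i unfolding proposal_def by simp
  have qi2 [measurable]: "(\<lambda>p. ?q (fst p) (snd p) i) \<in> borel_measurable (lborel_n n \<Otimes>\<^sub>M PZ {1..n})"
    using i unfolding proposal_def by simp
  define H where "H = (\<lambda>x z u. (if u < ?a x (?q x z) then (?q x z i - x i)\<^sup>2 else 0 :: real))"
  have step: "(mh_step alg f g \<kappa> \<phi> (\<sigma> n) n x z u i - x i)\<^sup>2 = H x z u" for x z u
    by (simp add: mh_step_def H_def Let_def)
  have Hm [measurable]: "(\<lambda>p. H (fst p) (fst (snd p)) (snd (snd p))) \<in> borel_measurable (lborel_n n \<Otimes>\<^sub>M (PZ {1..n} \<Otimes>\<^sub>M ?U))"
    unfolding H_def by measurable
  have tsets: "sets (target f \<kappa> \<phi> n) = sets (lborel_n n)" by (simp add: target_def ref_measure_def)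
  have Hm': "(\<lambda>p. H (fst p) (fst (snd p)) (snd (snd p))) \<in> borel_measurable (target f \<kappa> \<phi> n \<Otimes>\<^sub>M (PZ {1..n} \<Otimes>\<^sub>M ?U))"
    using Hm by (subst measurable_cong_sets[OF sets_pair_measure_cong[OF tsets refl] refl])
  let ?w = "\<lambda>X. exp (- \<phi> n (stretch \<kappa> n X))"
  let ?A = "\<lambda>X Z. min 1 (exp (\<phi> n (stretch \<kappa> n X) - \<phi> n (stretch \<kappa> n (propn alg e X Z)) + logsum alg e {1..n} X Z))"
  let ?V = "\<lambda>X Z. ((prop1 alg g (e i) (X i) (Z i) - X i) / e i)\<^sup>2"
  have tn: "target_dens f \<kappa> \<phi> n x \<ge> 0" "proposal_dens alg g \<kappa> (\<sigma> n) n x y \<ge> 0" for x y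
    unfolding target_dens_def ref_dens_def proposal_dens_def
    by (auto intro!: prod_nonneg mult_nonneg_nonneg less_imp_le[OF f_pos] simp: lam_def)
  have a01: "0 \<le> ?a x y" "?a x y \<le> 1" for x y
    unfolding mh_accept_def using tn by (auto intro!: divide_nonneg_nonneg mult_nonneg_nonneg)
  define G where "G = (\<lambda>x z. ennreal ((?q x z i - x i)\<^sup>2 * ?a x (?q x z)))"
  have Gm [measurable]: "(\<lambda>p. G (fst p) (snd p)) \<in> borel_measurable (lborel_n n \<Otimes>\<^sub>M PZ {1..n})"
    unfolding G_def using am2 by measurable
  have "(\<integral>\<^sup>+p. ennreal (H (fst p) (fst (snd p)) (snd (snd p))) \<partial>(target f \<kappa> \<phi> n \<Otimes>\<^sub>M (PZ {1..n} \<Otimes>\<^sub>M ?U))) =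
     (\<integral>\<^sup>+x. \<integral>\<^sup>+q. ennreal (H x (fst q) (snd q)) \<partial>(PZ {1..n} \<Otimes>\<^sub>M ?U) \<partial>target f \<kappa> \<phi> n)"
    by (subst ZU.P.nn_integral_fst[symmetric]) (use Hm' in auto)
  also have "\<dots> = (\<integral>\<^sup>+x. \<integral>\<^sup>+z. G x z \<partial>PZ {1..n} \<partial>target f \<kappa> \<phi> n)"
  proof (rule nn_integral_cong)
    fix x assume "x \<in> space (target f \<kappa> \<phi> n)"
    then have x: "x \<in> space (lborel_n n)" using sets_eq_imp_space_eq[OF tsets] by simp
    have Hx: "(\<lambda>q. H x (fst q) (snd q)) \<in> borel_measurable (PZ {1..n} \<Otimes>\<^sub>M ?U)"
      using measurable_compose[OF measurable_Pair1'[OF x] Hm] by simp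
    have "(\<integral>\<^sup>+q. ennreal (H x (fst q) (snd q)) \<partial>(PZ {1..n} \<Otimes>\<^sub>M ?U)) = (\<integral>\<^sup>+z. \<integral>\<^sup>+u. ennreal (H x z u) \<partial>?U \<partial>PZ {1..n})"
      by (subst U.nn_integral_fst[symmetric]) (use Hx in auto)
    also have "\<dots> = (\<integral>\<^sup>+z. G x z \<partial>PZ {1..n})"
    proof (rule nn_integral_cong)
      fix z
      have "(\<integral>\<^sup>+u. ennreal (H x z u) \<partial>?U) = (\<integral>\<^sup>+u. (if u < ?a x (?q x z) then ennreal ((?q x z i - x i)\<^sup>2) else 0) \<partial>?U)"
        by (intro nn_integral_cong) (simp add: H_def)
      also have "\<dots> = G x z"
        unfolding uniform_acceptance[OF a01] G_def by (rule ennreal_mult[symmetric]) (use a01 in auto)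
      finally show "(\<integral>\<^sup>+u. ennreal (H x z u) \<partial>?U) = G x z" .
    qed
    finally show "(\<integral>\<^sup>+q. ennreal (H x (fst q) (snd q)) \<partial>(PZ {1..n} \<Otimes>\<^sub>M ?U)) = (\<integral>\<^sup>+z. G x z \<partial>PZ {1..n})" .
  qed
  also have "\<dots> = (\<integral>\<^sup>+x. ennreal (exp (- \<phi> n x)) * (\<integral>\<^sup>+z. G x z \<partial>PZ {1..n}) \<partial>distr (PX {1..n}) (lborel_n n) (stretch \<kappa> n))"
    unfolding target_def distr_stretch[symmetric]
    by (rule nn_integral_density) measurable
  also have "\<dots> = (\<integral>\<^sup>+X. ennreal (?w X) * (\<integral>\<^sup>+z. G (stretch \<kappa> n X) z \<partial>PZ {1..n}) \<partial>PX {1..n})"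
    by (rule nn_integral_distr) measurable
  also have "\<dots> = (\<integral>\<^sup>+X. \<integral>\<^sup>+Z. ennreal ((\<sigma> n)\<^sup>2 * (?w X * ?V X Z * ?A X Z)) \<partial>PZ {1..n} \<partial>PX {1..n})"
  proof (rule nn_integral_cong)
    fix X assume X: "X \<in> space (PX {1..n})"
    have sx: "stretch \<kappa> n X \<in> space (lborel_n n)" using measurable_space[OF stretch_measurable X] .
    have GX: "G (stretch \<kappa> n X) \<in> borel_measurable (PZ {1..n})"
      using measurable_compose[OF measurable_Pair1'[OF sx] Gm] by simp
    have "ennreal (?w X) * (\<integral>\<^sup>+z. G (stretch \<kappa> n X) z \<partial>PZ {1..n}) = (\<integral>\<^sup>+z. ennreal (?w X) * G (stretch \<kappa> n X) z \<partial>PZ {1..n})"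
      by (rule nn_integral_cmult[symmetric, OF GX])
    also have "\<dots> = (\<integral>\<^sup>+Z. ennreal ((\<sigma> n)\<^sup>2 * (?w X * ?V X Z * ?A X Z)) \<partial>PZ {1..n})"
    proof (rule nn_integral_cong)
      fix Z
      have q: "?q (stretch \<kappa> n X) Z = stretch \<kappa> n (propn alg e X Z)"
        unfolding e_def by (rule proposal_stretch)
      \<comment> \<open>\<open>lam \<kappa> i\<close> times an increment is \<sigma> times the
        increment measured in units of the step \<open>e i\<close>, so the factor \<sigma>^2 comes
        out independently of i.\<close>
      have sq: "(stretch \<kappa> n (propn alg e X Z) i - stretch \<kappa> n X i)\<^sup>2 = (\<sigma> n)\<^sup>2 * ?V X Z"
        using i l s by (simp add: stretch_def propn_def e_def power_divide power_mult_distrib flip: right_diff_distrib)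
      have "G (stretch \<kappa> n X) Z = ennreal ((\<sigma> n)\<^sup>2 * ?V X Z * ?A X Z)"
        unfolding G_def q sq unfolding e_def mh_accept_stretch[OF s] ..
      then show "ennreal (?w X) * G (stretch \<kappa> n X) Z = ennreal ((\<sigma> n)\<^sup>2 * (?w X * ?V X Z * ?A X Z))"
        by (simp add: ennreal_mult'[symmetric] mult_ac)
    qed
    finally show "ennreal (?w X) * (\<integral>\<^sup>+z. G (stretch \<kappa> n X) z \<partial>PZ {1..n}) = \<dots>" .
  qed
  also have "\<dots> = (\<integral>\<^sup>+p. ennreal ((\<sigma> n)\<^sup>2 * (?w (fst p) * ?V (fst p) (snd p) * ?A (fst p) (snd p))) \<partial>(PX {1..n} \<Otimes>\<^sub>M PZ {1..n}))"
    by (subst XZ.M2.nn_integral_fst[symmetric]) (simp_all del: One_nat_def)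
  finally have main: "(\<integral>\<^sup>+p. ennreal (H (fst p) (fst (snd p)) (snd (snd p))) \<partial>(target f \<kappa> \<phi> n \<Otimes>\<^sub>M (PZ {1..n} \<Otimes>\<^sub>M ?U))) = \<dots>" .
  have "sq_jump alg f g \<kappa> \<phi> \<sigma> i n = (\<integral>p. H (fst p) (fst (snd p)) (snd (snd p)) \<partial>(target f \<kappa> \<phi> n \<Otimes>\<^sub>M (PZ {1..n} \<Otimes>\<^sub>M ?U)))"
    unfolding sq_jump_def Zsp by (intro Bochner_Integration.integral_cong refl) (auto simp: step)
  also have "\<dots> = enn2real (\<integral>\<^sup>+p. ennreal (H (fst p) (fst (snd p)) (snd (snd p))) \<partial>(target f \<kappa> \<phi> n \<Otimes>\<^sub>M (PZ {1..n} \<Otimes>\<^sub>M ?U)))"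
    by (rule integral_eq_nn_integral[OF Hm']) (auto simp: H_def)
  also have "\<dots> = (\<integral>p. (\<sigma> n)\<^sup>2 * (?w (fst p) * ?V (fst p) (snd p) * ?A (fst p) (snd p)) \<partial>(PX {1..n} \<Otimes>\<^sub>M PZ {1..n}))"
    unfolding main by (rule integral_eq_nn_integral[symmetric]) (auto simp del: One_nat_def)
  also have "\<dots> = (\<sigma> n)\<^sup>2 * (\<integral>p. ?w (fst p) * ?V (fst p) (snd p) * ?A (fst p) (snd p) \<partial>(PX {1..n} \<Otimes>\<^sub>M PZ {1..n}))"
    by (rule integral_mult_right_zero)
  finally show ?thesis .
qed

end

section \<open>Sums of powers, and a Lipschitz bound for the acceptance function\<close>

lemma powr_increment_bounds:
  fixes a p :: real
  assumes a: "a > 0" and p: "p \<ge> 0"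
  shows "(p + 1) * a powr p \<le> (a + 1) powr (p + 1) - a powr (p + 1)"
    and "(a + 1) powr (p + 1) - a powr (p + 1) \<le> (p + 1) * (a + 1) powr p"
proof -
  have "\<exists>z>a. z < a + 1 \<and> (a + 1) powr (p + 1) - a powr (p + 1) = (a + 1 - a) * ((p + 1) * z powr p)"
  proof (rule MVT2)
    fix x assume "a \<le> x" "x \<le> a + 1"
    then have "x > 0" using a by simp
    then show "((\<lambda>x. x powr (p + 1)) has_real_derivative (p + 1) * x powr p) (at x)"
      by (auto intro!: derivative_eq_intros)
  qed simp
  then obtain z where z: "z > a" "z < a + 1" "(a + 1) powr (p + 1) - a powr (p + 1) = (p + 1) * z powr p" by auto
  show "(p + 1) * a powr p \<le> (a + 1) powr (p + 1) - a powr (p + 1)"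
    unfolding z(3) using z a p by (intro mult_left_mono powr_mono2) auto
  show "(a + 1) powr (p + 1) - a powr (p + 1) \<le> (p + 1) * (a + 1) powr p"
    unfolding z(3) using z a p by (intro mult_left_mono powr_mono2) auto
qed

text \<open>A discrete comparison with the integral of x^p: the increments of x^(p+1), bounded by
  the mean value theorem, telescope. The upper bound is taken one step ahead, at n + 1, which is
  harmless asymptotically.\<close>

lemma sum_powr_bounds:
  fixes p :: real
  assumes p: "p \<ge> 0"
  shows "real n powr (p + 1) \<le> (p + 1) * (\<Sum>j\<in>{1..n}. real j powr p)"
    and "(p + 1) * (\<Sum>j\<in>{1..n}. real j powr p) \<le> (real n + 1) powr (p + 1)"
proof (induction n)
  case (Suc n)
  have S: "(\<Sum>j\<in>{1..Suc n}. real j powr p) = (\<Sum>j\<in>{1..n}. real j powr p) + (real n + 1) powr p"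
    by (simp add: add.commute)
  { case 1
    \<comment> \<open>At n = 0 the mean value bound does not apply; there
      \<open>0 powr (p + 1)\<close> is 0 and the inequality reads 1 \<le> p + 1.\<close>
    have "(real n + 1) powr (p + 1) - real n powr (p + 1) \<le> (p + 1) * (real n + 1) powr p"
      using powr_increment_bounds(2)[of "real n" p] p by (cases "n = 0") auto
    then show ?case unfolding S distrib_left using Suc(1) by (simp add: add.commute)
  next
    case 2
    have "(p + 1) * (real n + 1) powr p \<le> (real n + 1 + 1) powr (p + 1) - (real n + 1) powr (p + 1)"
      by (rule powr_increment_bounds(1)) (use p in auto)
    then show ?case unfolding S distrib_left using Suc(2) by (simp add: add.commute)
  }
qed auto

lemma sum_powr_asymp:
  fixes p :: real
  assumes p: "p \<ge> 0"
  shows "(\<lambda>n. real n powr (- (p + 1)) * (\<Sum>j\<in>{1..n}. real j powr p)) \<longlonglongrightarrow> 1 / (p + 1)"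
proof (rule tendsto_sandwich)
  show "eventually (\<lambda>n. 1 / (p + 1) \<le> real n powr (- (p + 1)) * (\<Sum>j\<in>{1..n}. real j powr p)) sequentially"
    using eventually_gt_at_top[of 0]
  proof eventually_elim
    case (elim n)
    have "real n powr (- (p + 1)) * real n powr (p + 1) \<le> real n powr (- (p + 1)) * ((p + 1) * (\<Sum>j\<in>{1..n}. real j powr p))"
      by (intro mult_left_mono sum_powr_bounds p) simp
    moreover have "real n powr (- (p + 1)) * real n powr (p + 1) = 1"
      unfolding powr_add[symmetric] using elim by simp
    ultimately show ?case using p by (simp add: field_simps)
  qed
  show "eventually (\<lambda>n. real n powr (- (p + 1)) * (\<Sum>j\<in>{1..n}. real j powr p) \<le> real n powr (- (p + 1)) * (real n + 1) powr (p + 1) / (p + 1)) sequentially"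
  proof (intro always_eventually allI)
    fix n
    have "real n powr (- (p + 1)) * ((p + 1) * (\<Sum>j\<in>{1..n}. real j powr p)) \<le> real n powr (- (p + 1)) * (real n + 1) powr (p + 1)"
      by (intro mult_left_mono sum_powr_bounds p) simp
    then show "real n powr (- (p + 1)) * (\<Sum>j\<in>{1..n}. real j powr p) \<le> real n powr (- (p + 1)) * (real n + 1) powr (p + 1) / (p + 1)"
      using p by (simp add: field_simps)
  qed
  have "(\<lambda>n. real n powr (- (p + 1)) * (real n + 1) powr (p + 1)) \<longlonglongrightarrow> 1"
    using p by real_asymp
  from tendsto_divide[OF this tendsto_const[of "p + 1"]] p
  show "(\<lambda>n. real n powr (- (p + 1)) * (real n + 1) powr (p + 1) / (p + 1)) \<longlonglongrightarrow> 1 / (p + 1)" by simp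
qed simp

text \<open>Used with q = 2s - 2\<kappa>, which is below -1 exactly when s < \<kappa> - 1/2.\<close>

lemma sum_powr_bounded:
  fixes q :: real
  assumes q: "q < -1"
  shows "\<exists>C\<ge>0. \<forall>n. (\<Sum>j\<in>{1..n}. real j powr q) \<le> C"
proof -
  have s: "summable (\<lambda>j. real j powr q)" using q by (simp add: summable_real_powr_iff)
  show ?thesis
  proof (intro exI[of _ "suminf (\<lambda>j. real j powr q)"] conjI allI)
    show "suminf (\<lambda>j. real j powr q) \<ge> 0" by (rule suminf_nonneg[OF s]) simp
    show "(\<Sum>j\<in>{1..n}. real j powr q) \<le> suminf (\<lambda>j. real j powr q)" for n
      by (rule sum_le_suminf[OF s]) auto
  qed
qed

text \<open>min 1 (exp r) = exp (min 0 r), and exp is 1-Lipschitz on the nonpositive half-line.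
  Truncating the bound at 1 allows perturbations d that are small in probability only.\<close>

lemma min_exp_lipschitz: "\<bar>min 1 (exp (d + t)) - min 1 (exp t)\<bar> \<le> min 1 \<bar>d :: real\<bar>"
proof -
  have lip: "exp b - exp a \<le> b - a" if "a \<le> b" "b \<le> 0" for a b :: real
  proof -
    have "1 + (a - b) \<le> exp (a - b)" by (rule exp_ge_add_one_self)
    then have "1 - exp (a - b) \<le> b - a" by linarith
    then have "exp b * (1 - exp (a - b)) \<le> 1 * (b - a)"
      using that by (intro mult_mono) simp_all
    then show ?thesis by (simp add: right_diff_distrib exp_add[symmetric])
  qed
  have m: "min 1 (exp r) = exp (min 0 r)" for r :: real
    by (auto simp: min_def)
  have lip': "\<bar>exp b - exp a\<bar> \<le> \<bar>b - a\<bar>" if "a \<le> 0" "b \<le> 0" for a b :: real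
    using lip[of a b] lip[of b a] that by (cases "a \<le> b") auto
  have "\<bar>exp (min 0 (d + t)) - exp (min 0 t)\<bar> \<le> \<bar>min 0 (d + t) - min 0 t\<bar>"
    by (rule lip') auto
  also have "\<dots> \<le> \<bar>d\<bar>" by (auto simp: min_def)
  finally have 1: "\<bar>min 1 (exp (d + t)) - min 1 (exp t)\<bar> \<le> \<bar>d\<bar>" unfolding m .
  have "0 \<le> min 1 (exp (d + t))" "min 1 (exp (d + t)) \<le> 1" "0 \<le> min 1 (exp t)" "min 1 (exp t) \<le> 1"
    by auto
  then have "\<bar>min 1 (exp (d + t)) - min 1 (exp t)\<bar> \<le> 1" by linarith
  with 1 show ?thesis by simp
qed

context smooth_density begin

lemma coordinate_distr:
  assumes i: "i \<in> I"
  shows "distr (PX I \<Otimes>\<^sub>M PZ I) (F \<Otimes>\<^sub>M N) (\<lambda>p. (fst p i, snd p i)) = F \<Otimes>\<^sub>M N"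
proof -
  have dX: "distr (PX I) F (\<lambda>X. X i) = F" by (rule distr_PiM_component[OF f_prob i])
  have dZ: "distr (PZ I) N (\<lambda>Z. Z i) = N" by (rule distr_PiM_component[OF N_prob i])
  have "distr (PX I) F (\<lambda>X. X i) \<Otimes>\<^sub>M distr (PZ I) N (\<lambda>Z. Z i) =
      distr (PX I \<Otimes>\<^sub>M PZ I) (F \<Otimes>\<^sub>M N) (\<lambda>(X, Z). (X i, Z i))"
    by (rule pair_measure_distr[OF measurable_component_singleton[OF i] measurable_component_singleton[OF i]])
      (unfold dZ, rule prob_space_imp_sigma_finite[OF N_prob])
  then show ?thesis unfolding dX dZ by (simp add: case_prod_beta')
qed

lemma coordinate_measurable:
  assumes i: "i \<in> I"
  shows "(\<lambda>p. (fst p i, snd p i)) \<in> measurable (PX I \<Otimes>\<^sub>M PZ I) (F \<Otimes>\<^sub>M N)"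
  by (intro measurable_Pair measurable_compose[OF measurable_fst measurable_component_singleton[OF i]]
     measurable_compose[OF measurable_snd measurable_component_singleton[OF i]])

lemma coordinate_integral:
  assumes i: "i \<in> I" and h: "integrable (F \<Otimes>\<^sub>M N) (\<lambda>w. h (fst w) (snd w))"
  shows "integrable (PX I \<Otimes>\<^sub>M PZ I) (\<lambda>p. h (fst p i) (snd p i))"
    and "(\<integral>p. h (fst p i) (snd p i) \<partial>(PX I \<Otimes>\<^sub>M PZ I)) = EE h"
proof -
  have h': "integrable (distr (PX I \<Otimes>\<^sub>M PZ I) (F \<Otimes>\<^sub>M N) (\<lambda>p. (fst p i, snd p i))) (\<lambda>w. h (fst w) (snd w))"
    unfolding coordinate_distr[OF i] by (rule h)
  show "integrable (PX I \<Otimes>\<^sub>M PZ I) (\<lambda>p. h (fst p i) (snd p i))"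
    using integrable_distr[OF coordinate_measurable[OF i] h'] by simp
  have "EE h = (\<integral>w. h (fst w) (snd w) \<partial>distr (PX I \<Otimes>\<^sub>M PZ I) (F \<Otimes>\<^sub>M N) (\<lambda>p. (fst p i, snd p i)))"
    unfolding coordinate_distr[OF i] ..
  also have "\<dots> = (\<integral>p. h (fst p i) (snd p i) \<partial>(PX I \<Otimes>\<^sub>M PZ I))"
    using integral_distr[OF coordinate_measurable[OF i] borel_measurable_integrable[OF h]] by simp
  finally show "(\<integral>p. h (fst p i) (snd p i) \<partial>(PX I \<Otimes>\<^sub>M PZ I)) = EE h" ..
qed

text \<open>The increment in units of the step: z for RWM and z - e g'(x) / 2 for SLA.\<close>

definition jump :: "algorithm \<Rightarrow> real \<Rightarrow> real \<Rightarrow> real \<Rightarrow> real" where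
  "jump alg e x z = (prop1 alg g e x z - x) / e"

lemma jump_measurable [measurable (raw)]:
  assumes [measurable]: "h \<in> borel_measurable M" "k \<in> borel_measurable M"
  shows "(\<lambda>w. jump alg e (h w) (k w)) \<in> borel_measurable M"
  unfolding jump_def by measurable

lemma growth_jump_diff: "growth 1 (\<lambda>e x z. jump alg e x z - z)"
proof (cases alg)
  case RWM
  have "growth 1 (\<lambda>e x z. e * 0)" by (rule growthI[of _ 0 1 0]) auto
  then show ?thesis by (rule growth_cong) (simp add: RWM jump_def prop1_def mean1_def)
next
  case SLA
  have "growth 1 (\<lambda>e x z. - (1/2) * (e ^ 1 * dg 1 x))"
    by (intro growth_cmult) (use growth_emult[OF growth_dg[of 1], of 1] in simp)
  then show ?thesis
    by (rule growth_cong) (simp add: SLA jump_def prop1_def mean1_def dg_1 field_simps power2_eq_square)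
qed

lemma growth_jump: "growth 0 (jump alg)"
proof -
  have "growth 0 (\<lambda>e x z. (jump alg e x z - z) + z)"
    by (intro growth_add growth_z growth_weaken[OF growth_jump_diff]) auto
  then show ?thesis by simp
qed

lemma growth_jump_square_diff: "growth 1 (\<lambda>e x z. (jump alg e x z)\<^sup>2 - z\<^sup>2)"
proof -
  have "growth 1 (\<lambda>e x z. (jump alg e x z - z) * (jump alg e x z + z))"
    using growth_mult[OF growth_jump_diff growth_add[OF growth_jump growth_z]] by simp
  then show ?thesis by (rule growth_cong) (simp add: power2_eq_square algebra_simps)
qed

lemma growth_prop1: "growth 0 (prop1 alg g)"
proof -
  have "growth 0 (\<lambda>e x z. (prop1 alg g e x z - x) + x)"
    by (intro growth_add growth_x growth_weaken[OF growth_step]) auto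
  then show ?thesis by simp
qed

text \<open>Coordinate j has scale \<open>lam \<kappa> j\<close>, so its weight in the squared norm
  is \<open>j powr (2 * s - 2 * \<kappa>)\<close>; bounded sums of these weights give a bound
  uniform in n. It is applied to the state, to the proposal and to their difference.\<close>

lemma expectation_snorm_square:
  assumes h: "\<And>j. j \<in> {1..n} \<Longrightarrow> integrable (F \<Otimes>\<^sub>M N) (\<lambda>w. (h j (fst w) (snd w))\<^sup>2)"
    and b: "\<And>j. j \<in> {1..n} \<Longrightarrow> EE (\<lambda>x z. (h j x z)\<^sup>2) \<le> D"
    and C: "(\<Sum>j\<in>{1..n}. real j powr (2 * s - 2 * \<kappa>)) \<le> C" and D: "D \<ge> 0"
  defines "H \<equiv> \<lambda>p. (snorm n s (\<lambda>j\<in>{1..n}. lam \<kappa> j * h j (fst p j) (snd p j)))\<^sup>2"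
  shows "integrable (PX {1..n} \<Otimes>\<^sub>M PZ {1..n}) H" "(\<integral>p. H p \<partial>(PX {1..n} \<Otimes>\<^sub>M PZ {1..n})) \<le> C * D"
proof -
  have H: "H = (\<lambda>p. \<Sum>j\<in>{1..n}. real j powr (2 * s - 2 * \<kappa>) * (h j (fst p j) (snd p j))\<^sup>2)"
  proof
    fix p
    have "real j powr (2 * s) * (lam \<kappa> j * v)\<^sup>2 = real j powr (2 * s - 2 * \<kappa>) * v\<^sup>2" if "j \<in> {1..n}" for j v
    proof -
      have "(lam \<kappa> j)\<^sup>2 = real j powr (- 2 * \<kappa>)"
        by (simp add: lam_def powr_realpow[symmetric] powr_powr mult.commute flip: powr_numeral)
      then show ?thesis by (simp add: power_mult_distrib powr_diff powr_minus field_simps)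
    qed
    then have "(\<Sum>j\<in>{1..n}. real j powr (2 * s) * ((\<lambda>j\<in>{1..n}. lam \<kappa> j * h j (fst p j) (snd p j)) j)\<^sup>2) =
      (\<Sum>j\<in>{1..n}. real j powr (2 * s - 2 * \<kappa>) * (h j (fst p j) (snd p j))\<^sup>2)"
      by (intro sum.cong refl) simp
    then show "H p = (\<Sum>j\<in>{1..n}. real j powr (2 * s - 2 * \<kappa>) * (h j (fst p j) (snd p j))\<^sup>2)"
      unfolding H_def snorm_def by (subst real_sqrt_pow2) (auto intro!: sum_nonneg)
  qed
  have i: "integrable (PX {1..n} \<Otimes>\<^sub>M PZ {1..n}) (\<lambda>p. real j powr (2 * s - 2 * \<kappa>) * (h j (fst p j) (snd p j))\<^sup>2)" if "j \<in> {1..n}" for j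
    using coordinate_integral(1)[OF that, of "\<lambda>x z. (h j x z)\<^sup>2"] h[OF that] by (intro integrable_mult_right)
  show "integrable (PX {1..n} \<Otimes>\<^sub>M PZ {1..n}) H" unfolding H by (rule Bochner_Integration.integrable_sum[OF i])
  have "(\<integral>p. H p \<partial>(PX {1..n} \<Otimes>\<^sub>M PZ {1..n})) = (\<Sum>j\<in>{1..n}. \<integral>p. real j powr (2 * s - 2 * \<kappa>) * (h j (fst p j) (snd p j))\<^sup>2 \<partial>(PX {1..n} \<Otimes>\<^sub>M PZ {1..n}))"
    unfolding H by (rule Bochner_Integration.integral_sum[OF i])
  also have "\<dots> = (\<Sum>j\<in>{1..n}. real j powr (2 * s - 2 * \<kappa>) * EE (\<lambda>x z. (h j x z)\<^sup>2))"
  proof (intro sum.cong refl)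
    fix j assume j: "j \<in> {1..n}"
    have "(\<integral>p. (h j (fst p j) (snd p j))\<^sup>2 \<partial>(PX {1..n} \<Otimes>\<^sub>M PZ {1..n})) = EE (\<lambda>x z. (h j x z)\<^sup>2)"
      by (rule coordinate_integral(2)[OF j, of "\<lambda>x z. (h j x z)\<^sup>2"]) (rule h[OF j])
    then show "(\<integral>p. real j powr (2 * s - 2 * \<kappa>) * (h j (fst p j) (snd p j))\<^sup>2 \<partial>(PX {1..n} \<Otimes>\<^sub>M PZ {1..n})) = real j powr (2 * s - 2 * \<kappa>) * EE (\<lambda>x z. (h j x z)\<^sup>2)"
      by simp
  qed
  also have "\<dots> \<le> (\<Sum>j\<in>{1..n}. real j powr (2 * s - 2 * \<kappa>) * D)"
    by (intro sum_mono mult_left_mono b) auto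
  also have "\<dots> = (\<Sum>j\<in>{1..n}. real j powr (2 * s - 2 * \<kappa>)) * D" by (simp add: sum_distrib_right)
  also have "\<dots> \<le> C * D" by (intro mult_right_mono C D)
  finally show "(\<integral>p. H p \<partial>(PX {1..n} \<Otimes>\<^sub>M PZ {1..n})) \<le> C * D" .
qed

lemma hellinger_product:
  assumes I: "finite I"
  shows "(\<integral>\<^sup>+p. ennreal (exp (logsum alg e I (fst p) (snd p) / 2)) \<partial>(PX I \<Otimes>\<^sub>M PZ I)) =
    (\<Prod>j\<in>I. \<integral>\<^sup>+w. ennreal (exp (logratio alg g (e j) (fst w) (snd w) / 2)) \<partial>(F \<Otimes>\<^sub>M N))"
proof -
  interpret X: product_sigma_finite "\<lambda>_::nat. F" by standard
  interpret Z: product_sigma_finite "\<lambda>_::nat. N" by standard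
  let ?h = "\<lambda>j x z. ennreal (exp (logratio alg g (e j) x z / 2))"
  have "(\<integral>\<^sup>+p. ennreal (exp (logsum alg e I (fst p) (snd p) / 2)) \<partial>(PX I \<Otimes>\<^sub>M PZ I)) =
      (\<integral>\<^sup>+X. \<integral>\<^sup>+Z. ennreal (exp (logsum alg e I X Z / 2)) \<partial>PZ I \<partial>PX I)"
    by (subst XZ.M2.nn_integral_fst[symmetric]) simp_all
  also have "\<dots> = (\<integral>\<^sup>+X. \<integral>\<^sup>+Z. (\<Prod>j\<in>I. ?h j (X j) (Z j)) \<partial>PZ I \<partial>PX I)"
    by (intro nn_integral_cong) (simp add: logsum_def sum_divide_distrib exp_sum I prod_ennreal)
  also have "\<dots> = (\<integral>\<^sup>+X. (\<Prod>j\<in>I. \<integral>\<^sup>+z. ?h j (X j) z \<partial>N) \<partial>PX I)"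
    by (intro nn_integral_cong Z.product_nn_integral_prod[OF I]) measurable
  also have "\<dots> = (\<Prod>j\<in>I. \<integral>\<^sup>+x. \<integral>\<^sup>+z. ?h j x z \<partial>N \<partial>F)"
    by (rule X.product_nn_integral_prod[OF I]) measurable
  also have "\<dots> = (\<Prod>j\<in>I. \<integral>\<^sup>+w. ?h j (fst w) (snd w) \<partial>(F \<Otimes>\<^sub>M N))"
    by (intro prod.cong refl) (subst FN.M2.nn_integral_fst[symmetric], simp_all)
  finally show ?thesis .
qed

end

section \<open>The expected squared jump\<close>

text \<open>The inequality \<rho> > 2\<kappa> holds in all three regimes. It makes the largest
  coordinate step \<open>eb n\<close> tend to zero, so that eventually every coordinate is in the
  range of the expansions.\<close>

locale mh_chain = smooth_density f g for f g :: "real \<Rightarrow> real" +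
  fixes alg :: algorithm and \<phi> :: "nat \<Rightarrow> (nat \<Rightarrow> real) \<Rightarrow> real" and \<sigma> :: "nat \<Rightarrow> real"
    and \<kappa> l \<rho> :: real and i :: nat
  assumes kappa: "\<kappa> \<ge> 0"
    and phi_meas: "\<And>n. n \<ge> 1 \<Longrightarrow> \<phi> n \<in> borel_measurable (PiM {1..n} (\<lambda>_. borel))"
    and target_prob: "\<And>n. n \<ge> 1 \<Longrightarrow> prob_space (target f \<kappa> \<phi> n)"
    and l: "l > 0" and rho: "\<rho> > 2 * \<kappa>"
    and sigma: "\<And>n. n \<ge> 1 \<Longrightarrow> \<sigma> n > 0 \<and> (\<sigma> n)\<^sup>2 = l\<^sup>2 * real n powr (-\<rho>)"
    and A: "\<exists>M. \<forall>\<^sub>F n in sequentially. \<forall>x\<in>Rn n. \<phi> n x \<ge> M"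
    and i1: "i \<ge> 1"
begin

definition ec :: "nat \<Rightarrow> nat \<Rightarrow> real" where "ec n j = \<sigma> n / lam \<kappa> j"
text \<open>The largest of the coordinate steps \<open>ec n j\<close>, attained at j = n since
  \<kappa> is nonnegative.\<close>

definition eb :: "nat \<Rightarrow> real" where "eb n = \<sigma> n * real n powr \<kappa>"
text \<open>Density of the target with respect to the reference measure, in the stretched
  coordinates.\<close>

definition w :: "nat \<Rightarrow> (nat \<Rightarrow> real) \<Rightarrow> real" where "w n X = exp (- \<phi> n (stretch \<kappa> n X))"
definition \<Delta> :: "nat \<Rightarrow> (nat \<Rightarrow> real) \<times> (nat \<Rightarrow> real) \<Rightarrow> real" where
  "\<Delta> n p = \<phi> n (stretch \<kappa> n (fst p)) - \<phi> n (stretch \<kappa> n (propn alg (ec n) (fst p) (snd p)))"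
abbreviation Q :: "nat \<Rightarrow> ((nat \<Rightarrow> real) \<times> (nat \<Rightarrow> real)) measure" where
  "Q n \<equiv> PX {1..n} \<Otimes>\<^sub>M PZ {1..n}"
text \<open>The expected squared jump in units of \<sigma>^2. The three claims amount to: J tends to
  a(l), tends to 1, or vanishes faster than any power of n.\<close>

definition J :: "nat \<Rightarrow> real" where
  "J n = (\<integral>p. w n (fst p) * (jump alg (ec n i) (fst p i) (snd p i))\<^sup>2
       * min 1 (exp (\<Delta> n p + logsum alg (ec n) {1..n} (fst p) (snd p))) \<partial>Q n)"

lemma phi_measurable: "n \<ge> 1 \<Longrightarrow> \<phi> n \<in> borel_measurable (lborel_n n)"
  using phi_meas[of n] by (subst measurable_cong_sets[OF sets_PiM_cong refl]) auto

lemma sq_jump_J: "n \<ge> i \<Longrightarrow> sq_jump alg f g \<kappa> \<phi> \<sigma> i n = l\<^sup>2 * real n powr (-\<rho>) * J n"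
  using sq_jump_eq[of \<sigma> n i \<phi> alg \<kappa>] sigma[of n] i1 phi_measurable[of n]
  by (simp add: J_def w_def \<Delta>_def jump_def ec_def[abs_def])

lemma ec_eq: "j \<ge> 1 \<Longrightarrow> ec n j = \<sigma> n * real j powr \<kappa>"
  by (simp add: ec_def lam_def powr_minus field_simps)

lemma ec_bounds: "n \<ge> 1 \<Longrightarrow> j \<in> {1..n} \<Longrightarrow> 0 < ec n j \<and> ec n j \<le> eb n"
  using sigma[of n] kappa by (auto simp: ec_eq eb_def intro!: mult_left_mono powr_mono2)

lemma sigma_eq: "n \<ge> 1 \<Longrightarrow> \<sigma> n = l * real n powr (- \<rho> / 2)"
proof -
  assume n: "n \<ge> 1"
  have "(l * real n powr (- \<rho> / 2))\<^sup>2 = (\<sigma> n)\<^sup>2"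
    using sigma[OF n] n by (simp add: power_mult_distrib power2_eq_square powr_add[symmetric])
  then have "(\<sigma> n)\<^sup>2 = (l * real n powr (- \<rho> / 2))\<^sup>2" by (rule sym)
  then show ?thesis by (rule power2_eq_imp_eq) (use sigma[OF n] l in \<open>simp_all add: less_imp_le\<close>)
qed

lemma eb_tendsto: "eb \<longlonglongrightarrow> 0"
proof -
  have "(\<lambda>n. l * real n powr (\<kappa> - \<rho> / 2)) \<longlonglongrightarrow> l * 0"
    using rho by (intro tendsto_mult tendsto_const tendsto_neg_powr filterlim_real_sequentially) auto
  then have "(\<lambda>n. l * real n powr (\<kappa> - \<rho> / 2)) \<longlonglongrightarrow> 0" by simp
  moreover have "eventually (\<lambda>n. l * real n powr (\<kappa> - \<rho> / 2) = eb n) sequentially"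
    using eventually_ge_at_top[of 1] by eventually_elim (simp add: eb_def sigma_eq powr_add[symmetric] mult.assoc)
  ultimately show ?thesis by (rule Lim_transform_eventually)
qed

text \<open>The factor \<open>real n powr (- (2 * a * \<kappa> + 1))\<close> normalises the power
  sum. At a = \<open>lead_order alg\<close>, the exponent 1 - a (\<rho> - 2\<kappa>) left over is
  zero, negative or positive in the critical, supercritical and subcritical regime.\<close>

lemma sum_ec: "n \<ge> 1 \<Longrightarrow> (\<Sum>j\<in>{1..n}. ec n j ^ (2 * a)) =
    l ^ (2 * a) * real n powr (1 - real a * (\<rho> - 2 * \<kappa>)) * (real n powr (- (2 * a * \<kappa> + 1)) * (\<Sum>j\<in>{1..n}. real j powr (2 * a * \<kappa>)))"
proof -
  assume n: "n \<ge> 1"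
  have "ec n j ^ (2 * a) = l ^ (2 * a) * real n powr (- (a * \<rho>)) * real j powr (2 * a * \<kappa>)" if "j \<in> {1..n}" for j
  proof -
    have "ec n j ^ (2 * a) = l ^ (2 * a) * (real n powr (- \<rho> / 2)) ^ (2 * a) * (real j powr \<kappa>) ^ (2 * a)"
      using that n by (simp add: ec_eq sigma_eq power_mult_distrib)
    also have "(real n powr (- \<rho> / 2)) ^ (2 * a) = real n powr (- (a * \<rho>))"
      using n by (simp add: powr_realpow[symmetric] powr_powr field_simps)
    also have "(real j powr \<kappa>) ^ (2 * a) = real j powr (2 * a * \<kappa>)"
      using that by (simp add: powr_realpow[symmetric] powr_powr field_simps)
    finally show ?thesis .
  qed
  then have "(\<Sum>j\<in>{1..n}. ec n j ^ (2 * a)) = l ^ (2 * a) * real n powr (- (a * \<rho>)) * (\<Sum>j\<in>{1..n}. real j powr (2 * a * \<kappa>))"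
    by (simp add: sum_distrib_left)
  also have "real n powr (- (a * \<rho>)) = real n powr (1 - real a * (\<rho> - 2 * \<kappa>)) * real n powr (- (2 * a * \<kappa> + 1))"
    unfolding powr_add[symmetric] by (simp add: algebra_simps)
  finally show ?thesis by (simp add: mult_ac)
qed

lemma lower_bound: obtains M :: real and n0 :: nat where "n0 \<ge> i" "n0 \<ge> 1" "\<And>n x. n \<ge> n0 \<Longrightarrow> x \<in> Rn n \<Longrightarrow> \<phi> n x \<ge> M"
    "\<And>n. n \<ge> n0 \<Longrightarrow> eb n \<le> 1"
proof -
  obtain M where M: "\<forall>\<^sub>F n in sequentially. \<forall>x\<in>Rn n. \<phi> n x \<ge> M" using A by blast
  have "\<forall>\<^sub>F n in sequentially. eb n < 1" by (rule order_tendstoD(2)[OF eb_tendsto]) simp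
  with M have "\<forall>\<^sub>F n in sequentially. (\<forall>x\<in>Rn n. \<phi> n x \<ge> M) \<and> eb n < 1 \<and> n \<ge> i"
    using eventually_ge_at_top[of i] by eventually_elim auto
  then obtain n0 where "\<And>n. n \<ge> n0 \<Longrightarrow> (\<forall>x\<in>Rn n. \<phi> n x \<ge> M) \<and> eb n < 1 \<and> n \<ge> i"
    unfolding eventually_sequentially by blast
  then have *: "\<And>n. n \<ge> n0 \<Longrightarrow> \<forall>x\<in>Rn n. \<phi> n x \<ge> M" "\<And>n. n \<ge> n0 \<Longrightarrow> eb n \<le> 1"
    by (blast, metis less_imp_le)
  show thesis
    by (rule that[of "max n0 i" M]) (use i1 * in auto)
qed

lemma w_measurable: "n \<ge> 1 \<Longrightarrow> w n \<in> borel_measurable (PX {1..n})"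
proof -
  assume "n \<ge> 1"
  note [measurable] = phi_measurable[OF this]
  show ?thesis unfolding w_def by measurable
qed

lemma w_integral: "n \<ge> 1 \<Longrightarrow> (\<integral>X. w n X \<partial>PX {1..n}) = 1"
proof -
  assume n: "n \<ge> 1"
  note [measurable] = phi_measurable[OF n]
  interpret T: prob_space "target f \<kappa> \<phi> n" by (rule target_prob[OF n])
  have "emeasure (target f \<kappa> \<phi> n) (space (target f \<kappa> \<phi> n)) = (\<integral>\<^sup>+x. 1 \<partial>target f \<kappa> \<phi> n)" by simp
  also have "\<dots> = (\<integral>\<^sup>+x. ennreal (exp (- \<phi> n x)) * 1 \<partial>distr (PX {1..n}) (lborel_n n) (stretch \<kappa> n))"
    unfolding target_def distr_stretch[symmetric] by (rule nn_integral_density) measurable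
  also have "\<dots> = (\<integral>\<^sup>+X. ennreal (exp (- \<phi> n (stretch \<kappa> n X))) * 1 \<partial>PX {1..n})"
    by (rule nn_integral_distr) measurable
  finally have "(\<integral>\<^sup>+X. ennreal (w n X) \<partial>PX {1..n}) = 1" using T.emeasure_space_1 by (simp add: w_def)
  then show ?thesis using w_measurable[OF n] by (subst integral_eq_nn_integral) (auto simp: w_def)
qed

lemma Delta_measurable: "n \<ge> 1 \<Longrightarrow> \<Delta> n \<in> borel_measurable (Q n)"
proof -
  assume "n \<ge> 1"
  note [measurable] = phi_measurable[OF this]
  show ?thesis unfolding \<Delta>_def by measurable
qed

text \<open>By Chebyshev's inequality state and proposal lie in a ball of radius K for the s-norm,
  up to probability \<open>D / K\<^sup>2\<close>; there \<delta> is bounded, and the increment has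
  second moment of order \<open>eb n\<close> squared. K is fixed before n tends to infinity, because
  nothing controls how the bound of \<delta> grows with K. The expectation is under the product
  measure; \<open>J_limit\<close> transfers it by the bounded weight.\<close>

lemma Delta_vanishes:
  fixes \<delta> :: "real \<times> real \<Rightarrow> real" and s s' :: real
  assumes lb: "locally_bounded_on ({0..} \<times> {0..}) \<delta>"
    and s: "s < \<kappa> - 1/2" "s' < \<kappa> - 1/2"
    and B: "\<forall>\<^sub>F n in sequentially. \<forall>x\<in>Rn n. \<forall>y\<in>Rn n.
       \<bar>\<phi> n y - \<phi> n x\<bar> \<le> \<delta> (snorm n s x, snorm n s y) * snorm n s' (\<lambda>i\<in>{1..n}. y i - x i)"
  shows "(\<lambda>n. \<integral>p. min 1 \<bar>\<Delta> n p\<bar> \<partial>Q n) \<longlonglongrightarrow> 0"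
proof -
  obtain M :: real and n0 :: nat where n0: "n0 \<ge> i" "n0 \<ge> 1" "\<And>n x. n \<ge> n0 \<Longrightarrow> x \<in> Rn n \<Longrightarrow> \<phi> n x \<ge> M"
    "\<And>n. n \<ge> n0 \<Longrightarrow> eb n \<le> 1" by (rule lower_bound) blast
  obtain C where C: "C \<ge> 0" "\<And>n. (\<Sum>j\<in>{1..n}. real j powr (2 * s - 2 * \<kappa>)) \<le> C"
    using sum_powr_bounded[of "2 * s - 2 * \<kappa>"] s by auto
  obtain C' where C': "C' \<ge> 0" "\<And>n. (\<Sum>j\<in>{1..n}. real j powr (2 * s' - 2 * \<kappa>)) \<le> C'"
    using sum_powr_bounded[of "2 * s' - 2 * \<kappa>"] s by auto
  have gx: "growth 0 (\<lambda>e x z. x\<^sup>2)" using growth_power[OF growth_x, of 2] by simp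
  have gy: "growth 0 (\<lambda>e x z. (prop1 alg g e x z)\<^sup>2)" using growth_power[OF growth_prop1, of 2] by simp
  have gd: "growth 2 (\<lambda>e x z. (prop1 alg g e x z - x)\<^sup>2)" using growth_power[OF growth_step, of 2] by simp
  define D1 where "D1 = EE (\<lambda>x z. x\<^sup>2)"
  have D1: "D1 \<ge> 0" unfolding D1_def by (rule integral_nonneg_AE) auto
  obtain D2 where D2: "D2 \<ge> 0" "\<And>e. 0 < e \<Longrightarrow> e \<le> 1 \<Longrightarrow> EE (\<lambda>x z. (prop1 alg g e x z)\<^sup>2) \<le> D2"
    using growth_integral[OF gy] by auto
  obtain D3 where D3: "D3 \<ge> 0" "\<And>e. 0 < e \<Longrightarrow> e \<le> 1 \<Longrightarrow> EE (\<lambda>x z. (prop1 alg g e x z - x)\<^sup>2) \<le> D3 * e ^ 2"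
    using growth_integral[OF gd] by auto
  define D where "D = C * D1 + C * D2"
  have D: "D \<ge> 0" using C D1 D2 by (simp add: D_def)
  have key: "\<exists>U\<ge>0. \<forall>\<^sub>F n in sequentially. (\<integral>p. min 1 \<bar>\<Delta> n p\<bar> \<partial>Q n) \<le> D / K\<^sup>2 + U * eb n" if K: "K > 0" for K
  proof -
    have "bounded (\<delta> ` ({0..K} \<times> {0..K}))"
    proof (rule lb[unfolded locally_bounded_on_def, rule_format])
      show "{0..K} \<times> {0..K} \<subseteq> {0..} \<times> {0..}" by auto
      show "bounded ({0..K} \<times> {0..K})" by (rule bounded_Times) simp_all
    qed
    then obtain U0 where "\<forall>v \<in> \<delta> ` ({0..K} \<times> {0..K}). norm v \<le> U0"
      unfolding bounded_iff by blast
    then have U0: "\<bar>\<delta> (a, b)\<bar> \<le> U0" if "a \<in> {0..K}" "b \<in> {0..K}" for a b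
      using that by force
    have "U0 \<ge> 0" using U0[of 0 0] K by auto
    \<comment> \<open>The bracket in \<open>U0 * (eb n + c p / eb n)\<close> below has expectation
      at most (1 + C' D3) \<open>eb n\<close>, as the mean of \<open>c\<close> is at most
      \<open>C' * D3 * (eb n)\<^sup>2\<close>.\<close>
    define U where "U = U0 * (1 + C' * D3)"
    show ?thesis
    proof (intro exI[of _ U] conjI)
      show "U \<ge> 0" using \<open>U0 \<ge> 0\<close> C' D3 by (simp add: U_def)
      show "\<forall>\<^sub>F n in sequentially. (\<integral>p. min 1 \<bar>\<Delta> n p\<bar> \<partial>Q n) \<le> D / K\<^sup>2 + U * eb n"
        using B eventually_ge_at_top[of n0]
      proof eventually_elim
        case (elim n)
        then have n: "n \<ge> n0" "n \<ge> 1" using n0 by auto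
        have e: "0 < ec n j" "ec n j \<le> 1" "ec n j \<le> eb n" if "j \<in> {1..n}" for j
          using ec_bounds[OF n(2) that] n0(4)[OF n(1)] by auto
        have ebp: "eb n > 0" using sigma[OF n(2)] n(2) by (simp add: eb_def)
        define a :: "(nat \<Rightarrow> real) \<times> (nat \<Rightarrow> real) \<Rightarrow> real" where "a = (\<lambda>p. (snorm n s (\<lambda>j\<in>{1..n}. lam \<kappa> j * fst p j))\<^sup>2)"
        define b :: "(nat \<Rightarrow> real) \<times> (nat \<Rightarrow> real) \<Rightarrow> real" where "b = (\<lambda>p. (snorm n s (\<lambda>j\<in>{1..n}. lam \<kappa> j * prop1 alg g (ec n j) (fst p j) (snd p j)))\<^sup>2)"
        define c :: "(nat \<Rightarrow> real) \<times> (nat \<Rightarrow> real) \<Rightarrow> real" where "c = (\<lambda>p. (snorm n s' (\<lambda>j\<in>{1..n}. lam \<kappa> j * (prop1 alg g (ec n j) (fst p j) (snd p j) - fst p j)))\<^sup>2)"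
        note ea = expectation_snorm_square[where h = "\<lambda>j x z. x" and n = n and C = C and D = D1 and s = s and \<kappa> = \<kappa>]
        note eb' = expectation_snorm_square[where h = "\<lambda>j x z. prop1 alg g (ec n j) x z" and n = n and C = C and D = D2 and s = s and \<kappa> = \<kappa>]
        note ec' = expectation_snorm_square[where h = "\<lambda>j x z. prop1 alg g (ec n j) x z - x" and n = n and C = C' and D = "D3 * (eb n)\<^sup>2" and s = s' and \<kappa> = \<kappa>]
        have ia: "integrable (F \<Otimes>\<^sub>M N) (\<lambda>w. (fst w)\<^sup>2)"
          by (rule growth_integrable0[OF gx]) simp
        have a: "integrable (Q n) a" "(\<integral>p. a p \<partial>Q n) \<le> C * D1"
          unfolding a_def by (rule ea(1)[OF ia _ C(2) D1], simp add: D1_def, rule ea(2)[OF ia _ C(2) D1], simp add: D1_def)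
        have ib: "integrable (F \<Otimes>\<^sub>M N) (\<lambda>w. (prop1 alg g (ec n j) (fst w) (snd w))\<^sup>2)" if "j \<in> {1..n}" for j
          by (rule growth_integrable[OF gy e(1,2)[OF that]]) measurable
        have mb: "EE (\<lambda>x z. (prop1 alg g (ec n j) x z)\<^sup>2) \<le> D2" if j: "j \<in> {1..n}" for j
          by (rule D2(2)[OF e(1,2)[OF j]])
        have b: "integrable (Q n) b" "(\<integral>p. b p \<partial>Q n) \<le> C * D2"
          unfolding b_def by (rule eb'(1)[OF ib mb C(2) D2(1)], assumption+, rule eb'(2)[OF ib mb C(2) D2(1)], assumption+)
        have ic: "integrable (F \<Otimes>\<^sub>M N) (\<lambda>w. (prop1 alg g (ec n j) (fst w) (snd w) - fst w)\<^sup>2)" if "j \<in> {1..n}" for j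
          by (rule growth_integrable[OF gd e(1,2)[OF that]]) measurable
        have mc: "EE (\<lambda>x z. (prop1 alg g (ec n j) x z - x)\<^sup>2) \<le> D3 * (eb n)\<^sup>2" if j: "j \<in> {1..n}" for j
        proof -
          have "(ec n j)\<^sup>2 \<le> (eb n)\<^sup>2" using e[OF j] by (intro power_mono) auto
          then show ?thesis using D3(2)[OF e(1,2)[OF j]] mult_left_mono[OF _ D3(1)] by (meson order_trans)
        qed
        have D3': "0 \<le> D3 * (eb n)\<^sup>2" using D3(1) by simp
        have c: "integrable (Q n) c" "(\<integral>p. c p \<partial>Q n) \<le> C' * (D3 * (eb n)\<^sup>2)"
          unfolding c_def by (rule ec'(1)[OF ic mc C'(2) D3'], assumption+, rule ec'(2)[OF ic mc C'(2) D3'], assumption+)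
        have ptw: "min 1 \<bar>\<Delta> n p\<bar> \<le> a p / K\<^sup>2 + b p / K\<^sup>2 + U0 * (eb n + c p / eb n)" for p
        proof -
          let ?x = "stretch \<kappa> n (fst p)" and ?y = "stretch \<kappa> n (propn alg (ec n) (fst p) (snd p))"
          have sx: "snorm n s ?x \<ge> 0" "a p = (snorm n s ?x)\<^sup>2"
            by (simp_all add: a_def stretch_def snorm_def sum_nonneg)
          have sy: "snorm n s ?y \<ge> 0" "b p = (snorm n s ?y)\<^sup>2"
            by (simp_all add: b_def stretch_def snorm_def sum_nonneg propn_def)
          have d: "(\<lambda>j\<in>{1..n}. ?y j - ?x j) = (\<lambda>j\<in>{1..n}. lam \<kappa> j * (prop1 alg g (ec n j) (fst p j) (snd p j) - fst p j))"
            by (rule ext) (simp add: stretch_def propn_def restrict_def right_diff_distrib)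
          define r where "r = snorm n s' (\<lambda>j\<in>{1..n}. ?y j - ?x j)"
          have r: "r \<ge> 0" "c p = r\<^sup>2"
            by (simp add: r_def snorm_def sum_nonneg, simp add: r_def c_def d)
          have nn: "a p / K\<^sup>2 \<ge> 0" "b p / K\<^sup>2 \<ge> 0" "U0 * (eb n + c p / eb n) \<ge> 0"
            using sx sy r ebp \<open>U0 \<ge> 0\<close> by auto
          \<comment> \<open>Chebyshev's inequality in pointwise form: outside the ball one of the
            first two terms is at least 1 and dominates the truncated difference.\<close>
          consider "snorm n s ?x > K" | "snorm n s ?y > K" | "snorm n s ?x \<le> K" "snorm n s ?y \<le> K" by linarith
          then show ?thesis
          proof cases
            case 1
            then have "a p \<ge> K\<^sup>2" unfolding sx(2) using K by (intro power_mono) auto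
            then have "a p / K\<^sup>2 \<ge> 1" using K by simp
            then show ?thesis using nn by linarith
          next
            case 2
            then have "b p \<ge> K\<^sup>2" unfolding sy(2) using K by (intro power_mono) auto
            then have "b p / K\<^sup>2 \<ge> 1" using K by simp
            then show ?thesis using nn by linarith
          next
            case 3
            have "\<bar>\<Delta> n p\<bar> = \<bar>\<phi> n ?y - \<phi> n ?x\<bar>" unfolding \<Delta>_def by (rule abs_minus_commute)
            also have "\<dots> \<le> \<delta> (snorm n s ?x, snorm n s ?y) * r"
              unfolding r_def by (rule elim(1)[rule_format, OF stretch_in_Rn stretch_in_Rn])
            also have "\<dots> \<le> U0 * r"
            proof (rule mult_right_mono[OF _ r(1)])
              show "\<delta> (snorm n s ?x, snorm n s ?y) \<le> U0"
                by (rule order_trans[OF abs_ge_self U0]) (use 3 sx(1) sy(1) in simp_all)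
            qed
            also have "\<dots> \<le> U0 * (eb n + c p / eb n)"
            proof (intro mult_left_mono \<open>U0 \<ge> 0\<close>)
              \<comment> \<open>Trades the norm r for its square, whose expectation is available. As
                r is typically of size at most \<open>eb n\<close>, no order is lost.\<close>
              show "r \<le> eb n + c p / eb n"
              proof (cases "r \<le> eb n")
                case True then show ?thesis using r ebp by (simp add: add_increasing2)
              next
                case False
                then have "r * eb n \<le> r\<^sup>2" using r by (simp add: power2_eq_square mult_left_mono)
                then have "r \<le> r\<^sup>2 / eb n" using ebp by (simp add: field_simps)
                then show ?thesis using r ebp by simp
              qed
            qed
            finally show ?thesis using nn by linarith
          qed
        qed
        have im: "integrable (Q n) (\<lambda>p. min 1 \<bar>\<Delta> n p\<bar>)"
          by (rule XZ.P.integrable_const_bound[where B = 1]) (use Delta_measurable[OF n(2)] in auto)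
        have ir: "integrable (Q n) (\<lambda>p. a p / K\<^sup>2 + b p / K\<^sup>2 + U0 * (eb n + c p / eb n))"
          using a b c by (intro Bochner_Integration.integrable_add integrable_mult_right integrable_divide) auto
        have "(\<integral>p. min 1 \<bar>\<Delta> n p\<bar> \<partial>Q n) \<le> (\<integral>p. a p / K\<^sup>2 + b p / K\<^sup>2 + U0 * (eb n + c p / eb n) \<partial>Q n)"
          using im ir ptw by (intro integral_mono) auto
        also have "\<dots> = (\<integral>p. a p \<partial>Q n) / K\<^sup>2 + (\<integral>p. b p \<partial>Q n) / K\<^sup>2 + U0 * (eb n + (\<integral>p. c p \<partial>Q n) / eb n)"
          using a(1) b(1) c(1) XZ.P.prob_space by simp
        also have "\<dots> \<le> C * D1 / K\<^sup>2 + C * D2 / K\<^sup>2 + U0 * (eb n + C' * (D3 * (eb n)\<^sup>2) / eb n)"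
          using a(2) b(2) c(2) \<open>U0 \<ge> 0\<close> ebp
          by (intro add_mono mult_left_mono divide_right_mono order_refl) auto
        also have "\<dots> = D / K\<^sup>2 + U * eb n"
          using ebp by (simp add: D_def U_def add_divide_distrib power2_eq_square algebra_simps)
        finally show ?case .
      qed
    qed
  qed
  show ?thesis
  proof (rule tendstoI)
    fix r :: real assume r: "r > 0"
    \<comment> \<open>D + 1 in place of D keeps K positive when D = 0 and makes
      \<open>D / K\<^sup>2\<close> strictly less than r / 2.\<close>
    define K where "K = sqrt (2 * (D + 1) / r)"
    have K: "K > 0" "K\<^sup>2 = 2 * (D + 1) / r" using D r by (auto simp: K_def)
    have DK: "D / K\<^sup>2 < r / 2" unfolding K(2) using D r by (simp add: field_simps)
    obtain U where U: "U \<ge> 0" "\<forall>\<^sub>F n in sequentially. (\<integral>p. min 1 \<bar>\<Delta> n p\<bar> \<partial>Q n) \<le> D / K\<^sup>2 + U * eb n"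
      using key[OF K(1)] by blast
    have "(\<lambda>n. U * eb n) \<longlonglongrightarrow> U * 0" by (intro tendsto_intros eb_tendsto)
    then have "\<forall>\<^sub>F n in sequentially. U * eb n < r / 2" using r by (intro order_tendstoD(2)) auto
    with U(2) show "\<forall>\<^sub>F n in sequentially. dist (\<integral>p. min 1 \<bar>\<Delta> n p\<bar> \<partial>Q n) 0 < r"
    proof eventually_elim
      case (elim n)
      have "0 \<le> (\<integral>p. min 1 \<bar>\<Delta> n p\<bar> \<partial>Q n)" by (rule integral_nonneg_AE) auto
      moreover have "(\<integral>p. min 1 \<bar>\<Delta> n p\<bar> \<partial>Q n) < r" using elim DK by linarith
      ultimately show ?case by (simp add: dist_real_def)
    qed
  qed
qed

end

text \<open>Young's inequality with a free weight d, followed by b^2 \<le> b. It stands in for the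
  Cauchy-Schwarz inequality, for a square-integrable factor times a factor in [0, 1] of small
  mean.\<close>

lemma weighted_product_bound:
  fixes a b d :: real
  assumes "d > 0" "0 \<le> b" "b \<le> 1"
  shows "a * b \<le> d * a\<^sup>2 + b / (4 * d)"
proof -
  have "0 \<le> (2 * d * a - b)\<^sup>2 / (4 * d)" using assms by simp
  also have "\<dots> = d * a\<^sup>2 - a * b + b\<^sup>2 / (4 * d)"
    using assms by (simp add: power2_eq_square field_simps)
  finally have "a * b \<le> d * a\<^sup>2 + b\<^sup>2 / (4 * d)" by simp
  moreover have "b\<^sup>2 / (4 * d) \<le> b / (4 * d)"
    using assms by (intro divide_right_mono) (auto simp: power2_eq_square mult_left_le)
  ultimately show ?thesis by linarith
qed

context mh_chain begin

lemma w_bounds: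
  assumes "\<And>x. x \<in> Rn n \<Longrightarrow> \<phi> n x \<ge> M"
  shows "0 \<le> w n X" "w n X \<le> exp (- M)"
  using assms[OF stretch_in_Rn] by (auto simp: w_def)

text \<open>J is compared with the integral of \<open>weighted_acceptance_limit\<close>, in which
  the jump is replaced by the noise and the difference of \<phi> is dropped. The first change costs
  order \<open>eb n\<close>; the second is governed by the truncated difference times the unbounded
  squared noise.\<close>

lemma J_limit:
  assumes D: "(\<lambda>n. \<integral>p. min 1 \<bar>\<Delta> n p\<bar> \<partial>Q n) \<longlonglongrightarrow> 0"
    and sum: "(\<lambda>n. \<Sum>j\<in>{1..n}. ec n j ^ (2 * lead_order alg)) \<longlonglongrightarrow> L"
  shows "J \<longlonglongrightarrow> 2 * std_normal_cdf (- (sqrt (Kc alg * L) / 2))"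
proof -
  obtain M :: real and n0 :: nat where n0: "n0 \<ge> i" "n0 \<ge> 1" "\<And>n x. n \<ge> n0 \<Longrightarrow> x \<in> Rn n \<Longrightarrow> \<phi> n x \<ge> M"
    "\<And>n. n \<ge> n0 \<Longrightarrow> eb n \<le> 1" by (rule lower_bound) blast
  define B where "B = exp (- M)"
  have B: "B > 0" by (simp add: B_def)
  have wb: "0 \<le> w n X" "w n X \<le> B" if "n \<ge> n0" for n X
    using w_bounds[of n M X] n0(3)[OF that] by (auto simp: B_def)
  define T where "T = (\<lambda>n p. logsum alg (ec n) {1..n} (fst p) (snd p))"
  define J' where "J' = (\<lambda>n. \<integral>p. w n (fst p) * (snd p i)\<^sup>2 * min 1 (exp (T n p)) \<partial>Q n)"
  have J': "J' \<longlonglongrightarrow> 2 * std_normal_cdf (- (sqrt (Kc alg * L) / 2))"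
    unfolding J'_def T_def
  proof (rule weighted_acceptance_limit[OF i1 n0(1) _ eb_tendsto n0(4) sum])
    show "0 < ec n j \<and> ec n j \<le> eb n" if "n \<ge> n0" "j \<in> {1..n}" for n j
      using ec_bounds that n0(2) by simp
    show "w n \<in> borel_measurable (PX {1..n})" "(\<integral>X. w n X \<partial>PX {1..n}) = 1" if "n \<ge> n0" for n
      using w_measurable w_integral that n0(2) by simp_all
    show "0 \<le> w n X \<and> w n X \<le> B" if "n \<ge> n0" for n X using wb[OF that] by simp
  qed
  obtain D1 where D1: "D1 \<ge> 0" "\<And>e. 0 < e \<Longrightarrow> e \<le> 1 \<Longrightarrow> EE (\<lambda>x z. \<bar>(jump alg e x z)\<^sup>2 - z\<^sup>2\<bar>) \<le> D1 * e"
    using growth_integral[OF growth_jump_square_diff] by auto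
  define E4 where "E4 = EE (\<lambda>x z. (z\<^sup>2)\<^sup>2)"
  have g4: "growth 0 (\<lambda>e x z. (z\<^sup>2)\<^sup>2)"
    using growth_power[OF growth_power[OF growth_z, of 2], of 2] by simp
  define m where "m = (\<lambda>n. \<integral>p. min 1 \<bar>\<Delta> n p\<bar> \<partial>Q n)"
  have m0: "m n \<ge> 0" for n unfolding m_def by (rule integral_nonneg_AE) auto
  \<comment> \<open>Weight for \<open>weighted_product_bound\<close>: both d and m / d must vanish,
    hence the root of m; the second summand keeps d positive when m = 0.\<close>
  define d where "d = (\<lambda>n. sqrt (m n) + 1 / (real n + 1))"
  have bound: "\<bar>J n - J' n\<bar> \<le> B * (D1 * eb n + (d n * E4 + m n / (4 * d n)))" if n: "n \<ge> n0" for n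
  proof -
    have n1: "n \<ge> 1" and ii: "i \<in> {1..n}" using n n0 i1 by auto
    have e: "0 < ec n i" "ec n i \<le> 1" "ec n i \<le> eb n"
      using ec_bounds[OF n1 ii] n0(4)[OF n] by auto
    have dp: "d n > 0" unfolding d_def using m0[of n] by (simp add: add_nonneg_pos)
    define V where "V = (\<lambda>p. (jump alg (ec n i) (fst p i) (snd p i))\<^sup>2)"
    define Z2 where "Z2 = (\<lambda>p :: (nat \<Rightarrow> real) \<times> (nat \<Rightarrow> real). (snd p i)\<^sup>2)"
    define h1 where "h1 = (\<lambda>p. \<bar>V p - Z2 p\<bar>)"
    define h2 where "h2 = (\<lambda>p. (Z2 p)\<^sup>2)"
    define b where "b = (\<lambda>p. min 1 \<bar>\<Delta> n p\<bar>)"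
    define A where "A = (\<lambda>p. min 1 (exp (\<Delta> n p + T n p)))"
    define A' where "A' = (\<lambda>p. min 1 (exp (T n p)))"
    define W where "W = (\<lambda>p :: (nat \<Rightarrow> real) \<times> (nat \<Rightarrow> real). w n (fst p))"
    have cX: "(\<lambda>p. fst p i) \<in> borel_measurable (Q n)" and cZ: "(\<lambda>p. snd p i) \<in> borel_measurable (Q n)"
      using measurable_compose[OF coordinate_measurable[OF ii] measurable_fst]
        measurable_compose[OF coordinate_measurable[OF ii] measurable_snd] by simp_all
    note [measurable] = cX cZ Delta_measurable[OF n1] w_measurable[OF n1]
    have [measurable]: "T n \<in> borel_measurable (Q n)" unfolding T_def by measurable
    have mV [measurable]: "V \<in> borel_measurable (Q n)" and mZ [measurable]: "Z2 \<in> borel_measurable (Q n)"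
      and mb [measurable]: "b \<in> borel_measurable (Q n)" and mA [measurable]: "A \<in> borel_measurable (Q n)" and mA' [measurable]: "A' \<in> borel_measurable (Q n)"
      and mW [measurable]: "W \<in> borel_measurable (Q n)"
      unfolding V_def Z2_def b_def A_def A'_def W_def by measurable
    have gi: "integrable (F \<Otimes>\<^sub>M N) (\<lambda>w. \<bar>(jump alg (ec n i) (fst w) (snd w))\<^sup>2 - (snd w)\<^sup>2\<bar>)"
      by (intro integrable_abs growth_integrable[OF growth_jump_square_diff e(1,2)]) measurable
    have gV: "integrable (F \<Otimes>\<^sub>M N) (\<lambda>w. (jump alg (ec n i) (fst w) (snd w))\<^sup>2)"
      using growth_integrable[OF growth_power[OF growth_jump, of 2] e(1,2)] by simp
    have gZ: "integrable (F \<Otimes>\<^sub>M N) (\<lambda>w. (snd w)\<^sup>2)"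
      using growth_integrable0[of "\<lambda>x z. z\<^sup>2"] growth_power[OF growth_z, of 2] by simp
    have g4i: "integrable (F \<Otimes>\<^sub>M N) (\<lambda>w. ((snd w)\<^sup>2)\<^sup>2)"
      by (rule growth_integrable0[OF g4]) measurable
    have iV: "integrable (Q n) V" unfolding V_def by (rule coordinate_integral(1)[OF ii gV])
    have iZ: "integrable (Q n) Z2" unfolding Z2_def by (rule coordinate_integral(1)[OF ii gZ])
    have ih1: "integrable (Q n) h1" "(\<integral>p. h1 p \<partial>Q n) \<le> D1 * eb n"
    proof -
      show "integrable (Q n) h1" unfolding h1_def V_def Z2_def by (rule coordinate_integral(1)[OF ii gi])
      have "(\<integral>p. h1 p \<partial>Q n) = EE (\<lambda>x z. \<bar>(jump alg (ec n i) x z)\<^sup>2 - z\<^sup>2\<bar>)"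
        unfolding h1_def V_def Z2_def by (rule coordinate_integral(2)[OF ii gi])
      also have "\<dots> \<le> D1 * ec n i" by (rule D1(2)[OF e(1,2)])
      also have "\<dots> \<le> D1 * eb n" by (rule mult_left_mono[OF e(3) D1(1)])
      finally show "(\<integral>p. h1 p \<partial>Q n) \<le> D1 * eb n" .
    qed
    have ih2: "integrable (Q n) h2" "(\<integral>p. h2 p \<partial>Q n) = E4"
      unfolding h2_def Z2_def E4_def by (rule coordinate_integral(1)[OF ii g4i], rule coordinate_integral(2)[OF ii g4i])
    have ib: "integrable (Q n) b" by (rule XZ.P.integrable_const_bound[where B = 1]) (auto simp: b_def Delta_measurable[OF n1])
    have A01: "0 \<le> A p" "A p \<le> 1" "0 \<le> A' p" "A' p \<le> 1" "0 \<le> b p" "b p \<le> 1" for p by (auto simp: A_def A'_def b_def)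
    have W: "0 \<le> W p" "W p \<le> B" for p using wb[OF n] by (auto simp: W_def)
    have iJ: "integrable (Q n) (\<lambda>p. W p * V p * A p)"
    proof (rule Bochner_Integration.integrable_bound)
      show "integrable (Q n) (\<lambda>p. B * V p)" using iV by simp
      have "W p * V p * A p \<le> B * V p * 1" for p
        using W A01 B by (intro mult_mono mult_nonneg_nonneg) (auto simp: V_def)
      moreover have "0 \<le> W p * V p * A p" for p
        using W A01 by (intro mult_nonneg_nonneg) (auto simp: V_def)
      ultimately show "AE p in Q n. norm (W p * V p * A p) \<le> norm (B * V p)"
        by (intro AE_I2) (metis abs_of_nonneg abs_ge_self mult_1_right order_trans real_norm_def)
    qed measurable
    have iJ': "integrable (Q n) (\<lambda>p. W p * Z2 p * A' p)"
    proof (rule Bochner_Integration.integrable_bound)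
      show "integrable (Q n) (\<lambda>p. B * Z2 p)" using iZ by simp
      have "W p * Z2 p * A' p \<le> B * Z2 p * 1" for p
        using W A01 B by (intro mult_mono mult_nonneg_nonneg) (auto simp: Z2_def)
      moreover have "0 \<le> W p * Z2 p * A' p" for p
        using W A01 by (intro mult_nonneg_nonneg) (auto simp: Z2_def)
      ultimately show "AE p in Q n. norm (W p * Z2 p * A' p) \<le> norm (B * Z2 p)"
        by (intro AE_I2) (metis abs_of_nonneg abs_ge_self mult_1_right order_trans real_norm_def)
    qed measurable
    \<comment> \<open>First V is exchanged for Z2 under the acceptance A, then A for A' under
      Z2.\<close>
    have ptw: "\<bar>W p * V p * A p - W p * Z2 p * A' p\<bar> \<le> B * (h1 p + (d n * h2 p + b p / (4 * d n)))" for p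
    proof -
      have "\<bar>V p * A p - Z2 p * A' p\<bar> = \<bar>(V p - Z2 p) * A p + Z2 p * (A p - A' p)\<bar>" by (simp add: algebra_simps)
      also have "\<dots> \<le> \<bar>V p - Z2 p\<bar> * A p + Z2 p * \<bar>A p - A' p\<bar>"
        using A01(1)[of p] by (intro order_trans[OF abs_triangle_ineq]) (simp add: abs_mult Z2_def)
      also have "\<dots> \<le> h1 p * 1 + Z2 p * b p"
        unfolding h1_def using A01[of p] min_exp_lipschitz[of "\<Delta> n p" "T n p"]
        by (intro add_mono mult_left_mono) (auto simp: A_def A'_def b_def Z2_def)
      also have "\<dots> \<le> h1 p + (d n * h2 p + b p / (4 * d n))"
        unfolding h2_def using weighted_product_bound[OF dp A01(5,6)] by simp
      finally have *: "\<bar>V p * A p - Z2 p * A' p\<bar> \<le> h1 p + (d n * h2 p + b p / (4 * d n))" .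
      have "\<bar>W p * V p * A p - W p * Z2 p * A' p\<bar> = W p * \<bar>V p * A p - Z2 p * A' p\<bar>"
        using W(1)[of p] by (simp add: abs_mult mult.assoc flip: right_diff_distrib)
      also have "\<dots> \<le> B * (h1 p + (d n * h2 p + b p / (4 * d n)))"
        using W[of p] * B by (intro mult_mono) auto
      finally show ?thesis .
    qed
    have ir: "integrable (Q n) (\<lambda>p. B * (h1 p + (d n * h2 p + b p / (4 * d n))))"
      using ih1(1) ih2(1) ib by (intro integrable_mult_right Bochner_Integration.integrable_add integrable_divide) auto
    have JJ: "J n - J' n = (\<integral>p. W p * V p * A p - W p * Z2 p * A' p \<partial>Q n)"
      unfolding Bochner_Integration.integral_diff[OF iJ iJ'] by (simp add: J_def J'_def W_def V_def A_def Z2_def A'_def T_def)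
    have "\<bar>J n - J' n\<bar> \<le> (\<integral>p. \<bar>W p * V p * A p - W p * Z2 p * A' p\<bar> \<partial>Q n)"
      unfolding JJ by (rule integral_abs_bound)
    also have "\<dots> \<le> (\<integral>p. B * (h1 p + (d n * h2 p + b p / (4 * d n))) \<partial>Q n)"
      using iJ iJ' ir ptw by (intro integral_mono integrable_abs Bochner_Integration.integrable_diff) auto
    also have "\<dots> = B * ((\<integral>p. h1 p \<partial>Q n) + (d n * (\<integral>p. h2 p \<partial>Q n) + (\<integral>p. b p \<partial>Q n) / (4 * d n)))"
      using ih1(1) ih2(1) ib by simp
    also have "\<dots> \<le> B * (D1 * eb n + (d n * E4 + m n / (4 * d n)))"
      unfolding ih2(2) m_def b_def[symmetric] using ih1(2) B dp by (intro mult_left_mono add_mono) auto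
    finally show ?thesis .
  qed
  have m_lim: "m \<longlonglongrightarrow> 0" using D by (simp add: m_def[abs_def])
  have d_lim: "d \<longlonglongrightarrow> 0"
  proof -
    have "(\<lambda>n. 1 / (real n + 1)) \<longlonglongrightarrow> 0" by real_asymp
    from tendsto_add[OF tendsto_real_sqrt[OF m_lim] this] show ?thesis by (simp add: d_def[abs_def])
  qed
  have md_lim: "(\<lambda>n. m n / (4 * d n)) \<longlonglongrightarrow> 0"
  proof (rule Lim_null_comparison)
    have "m n / (4 * d n) \<le> sqrt (m n)" for n
    proof -
      have dp: "d n > 0" unfolding d_def using m0[of n] by (simp add: add_nonneg_pos)
      have "sqrt (m n) * sqrt (m n) \<le> sqrt (m n) * (4 * d n)"
        using m0[of n] dp by (intro mult_left_mono) (auto simp: d_def)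
      then have "m n \<le> sqrt (m n) * (4 * d n)" using m0[of n] by simp
      then show ?thesis using dp by (simp add: pos_divide_le_eq)
    qed
    moreover have "m n / (4 * d n) \<ge> 0" for n using m0[of n] by (simp add: d_def)
    ultimately show "\<forall>\<^sub>F n in sequentially. norm (m n / (4 * d n)) \<le> sqrt (m n)"
      by (intro always_eventually allI) (simp only: real_norm_def abs_of_nonneg)
    show "(\<lambda>n. sqrt (m n)) \<longlonglongrightarrow> 0" using tendsto_real_sqrt[OF m_lim] by simp
  qed
  have "(\<lambda>n. J n - J' n) \<longlonglongrightarrow> 0"
  proof (rule Lim_null_comparison)
    show "\<forall>\<^sub>F n in sequentially. norm (J n - J' n) \<le> B * (D1 * eb n + (d n * E4 + m n / (4 * d n)))"
      using eventually_ge_at_top[of n0] by eventually_elim (use bound in simp)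
    have "(\<lambda>n. B * (D1 * eb n + (d n * E4 + m n / (4 * d n)))) \<longlonglongrightarrow> B * (D1 * 0 + (0 * E4 + 0))"
      by (intro tendsto_intros eb_tendsto d_lim md_lim)
    then show "(\<lambda>n. B * (D1 * eb n + (d n * E4 + m n / (4 * d n)))) \<longlonglongrightarrow> 0" by simp
  qed
  from tendsto_add[OF this J'] show ?thesis by simp
qed

lemma J_nonneg: "J n \<ge> 0"
  unfolding J_def by (rule integral_nonneg_AE) (auto simp: w_def)

text \<open>min 1 (exp T) is at most exp(T/2), whose expectation is a product of Hellinger
  affinities. The squared jump is unbounded but has a bounded second moment; separating it from the
  acceptance halves the rate.\<close>

lemma J_bound:
  obtains c K n0 where "c > 0" "K \<ge> 0" "\<And>n. n \<ge> n0 \<Longrightarrow> J n \<le> K * exp (- c * (\<Sum>j\<in>{1..n}. ec n j ^ (2 * lead_order alg)))"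
proof -
  obtain M :: real and n0 :: nat where n0: "n0 \<ge> i" "n0 \<ge> 1" "\<And>n x. n \<ge> n0 \<Longrightarrow> x \<in> Rn n \<Longrightarrow> \<phi> n x \<ge> M"
    "\<And>n. n \<ge> n0 \<Longrightarrow> eb n \<le> 1" by (rule lower_bound) blast
  define B where "B = exp (- M)"
  have B: "B > 0" by (simp add: B_def)
  obtain c e0 where c: "c > 0" "e0 > 0" and hell: "\<And>e. 0 < e \<Longrightarrow> e \<le> e0 \<Longrightarrow>
     (\<integral>\<^sup>+w. ennreal (exp (logratio alg g e (fst w) (snd w) / 2)) \<partial>(F \<Otimes>\<^sub>M N)) \<le> ennreal (exp (- c * e ^ (2 * lead_order alg)))"
    using logratio_hellinger by blast
  have g4: "growth 0 (\<lambda>e x z. ((jump alg e x z)\<^sup>2)\<^sup>2)"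
    using growth_power[OF growth_power[OF growth_jump, of 2], of 2] by simp
  obtain D where D: "D \<ge> 0" "\<And>e. 0 < e \<Longrightarrow> e \<le> 1 \<Longrightarrow> EE (\<lambda>x z. ((jump alg e x z)\<^sup>2)\<^sup>2) \<le> D"
    using growth_integral[OF g4] by auto
  have "\<forall>\<^sub>F n in sequentially. eb n < e0" by (rule order_tendstoD(2)[OF eb_tendsto c(2)])
  then obtain n1 where n1: "\<And>n. n \<ge> n1 \<Longrightarrow> eb n < e0" unfolding eventually_sequentially by blast
  have "J n \<le> (B * (D + 1)) * exp (- (c / 2) * (\<Sum>j\<in>{1..n}. ec n j ^ (2 * lead_order alg)))" if n: "n \<ge> max n0 n1" for n
  proof -
    have nn: "n \<ge> n0" "n \<ge> n1" "n \<ge> 1" and ii: "i \<in> {1..n}" using n n0 i1 by auto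
    have e: "0 < ec n j" "ec n j \<le> 1" "ec n j \<le> e0" if "j \<in> {1..n}" for j
      using ec_bounds[OF nn(3) that] n0(4)[OF nn(1)] n1[OF nn(2)] by auto
    define S where "S = (\<Sum>j\<in>{1..n}. ec n j ^ (2 * lead_order alg))"
    define T where "T = (\<lambda>p. logsum alg (ec n) {1..n} (fst p) (snd p))"
    define V where "V = (\<lambda>p. (jump alg (ec n i) (fst p i) (snd p i))\<^sup>2)"
    define a where "a = (\<lambda>p. min 1 (exp (T p)))"
    \<comment> \<open>The square root of the bound for the expectation of \<open>a\<close>: with
      this weight both terms of Young's inequality are of order d.\<close>
    define d where "d = exp (- (c / 2) * S)"
    have dp: "d > 0" by (simp add: d_def)
    have cX: "(\<lambda>p. fst p i) \<in> borel_measurable (Q n)" and cZ: "(\<lambda>p. snd p i) \<in> borel_measurable (Q n)"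
      using measurable_compose[OF coordinate_measurable[OF ii] measurable_fst]
        measurable_compose[OF coordinate_measurable[OF ii] measurable_snd] by simp_all
    note [measurable] = cX cZ Delta_measurable[OF nn(3)] w_measurable[OF nn(3)]
    have Tm [measurable]: "T \<in> borel_measurable (Q n)" unfolding T_def by measurable
    have [measurable]: "V \<in> borel_measurable (Q n)" "a \<in> borel_measurable (Q n)" unfolding V_def a_def by measurable
    have g4i: "integrable (F \<Otimes>\<^sub>M N) (\<lambda>w. ((jump alg (ec n i) (fst w) (snd w))\<^sup>2)\<^sup>2)"
      by (rule growth_integrable[OF g4 e(1,2)[OF ii]]) measurable
    have iV2: "integrable (Q n) (\<lambda>p. (V p)\<^sup>2)" "(\<integral>p. (V p)\<^sup>2 \<partial>Q n) \<le> D"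
    proof -
      show "integrable (Q n) (\<lambda>p. (V p)\<^sup>2)" unfolding V_def by (rule coordinate_integral(1)[OF ii g4i])
      have "(\<integral>p. (V p)\<^sup>2 \<partial>Q n) = EE (\<lambda>x z. ((jump alg (ec n i) x z)\<^sup>2)\<^sup>2)"
        unfolding V_def by (rule coordinate_integral(2)[OF ii g4i])
      then show "(\<integral>p. (V p)\<^sup>2 \<partial>Q n) \<le> D" using D(2)[OF e(1,2)[OF ii]] by simp
    qed
    have a01: "0 \<le> a p" "a p \<le> 1" for p by (auto simp: a_def)
    have ia: "integrable (Q n) a" by (rule XZ.P.integrable_const_bound[where B = 1]) (use a01 in auto)
    have a_int: "(\<integral>p. a p \<partial>Q n) \<le> exp (- c * S)"
    proof -
      have "ennreal (\<integral>p. a p \<partial>Q n) = (\<integral>\<^sup>+p. ennreal (a p) \<partial>Q n)"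
        by (rule nn_integral_eq_integral[symmetric, OF ia]) (use a01 in auto)
      also have "\<dots> \<le> (\<integral>\<^sup>+p. ennreal (exp (T p / 2)) \<partial>Q n)"
      proof (intro nn_integral_mono ennreal_leI)
        fix p
        show "a p \<le> exp (T p / 2)" by (cases "T p \<ge> 0") (auto simp: a_def)
      qed
      also have "\<dots> = (\<Prod>j\<in>{1..n}. \<integral>\<^sup>+w. ennreal (exp (logratio alg g (ec n j) (fst w) (snd w) / 2)) \<partial>(F \<Otimes>\<^sub>M N))"
        unfolding T_def by (rule hellinger_product) simp
      also have "\<dots> \<le> (\<Prod>j\<in>{1..n}. ennreal (exp (- c * ec n j ^ (2 * lead_order alg))))"
        by (intro prod_mono_ennreal hell e)
      also have "\<dots> = ennreal (\<Prod>j\<in>{1..n}. exp (- c * ec n j ^ (2 * lead_order alg)))"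
        by (rule prod_ennreal) simp
      also have "(\<Prod>j\<in>{1..n}. exp (- c * ec n j ^ (2 * lead_order alg))) = exp (- c * S)"
        unfolding S_def by (simp add: exp_sum[symmetric] sum_distrib_left sum_negf)
      finally show ?thesis by (simp add: ennreal_le_iff)
    qed
    have ptw: "w n (fst p) * V p * min 1 (exp (\<Delta> n p + T p)) \<le> B * (d * (V p)\<^sup>2 + a p / (4 * d))" for p
    proof -
      let ?x = "stretch \<kappa> n (fst p)" and ?y = "stretch \<kappa> n (propn alg (ec n) (fst p) (snd p))"
      \<comment> \<open>The weight cancels against the difference of \<phi>, as w times
        \<open>exp (\<Delta> n p)\<close> is exp(-\<phi>) at the proposal. So (A) is applied at the
        proposal if T is negative, and at the state otherwise.\<close>
      have "w n (fst p) * min 1 (exp (\<Delta> n p + T p)) \<le> B * a p"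
      proof (cases "T p \<ge> 0")
        case True
        have "w n (fst p) * min 1 (exp (\<Delta> n p + T p)) \<le> B * 1"
          using w_bounds[of n M "fst p"] n0(3)[OF nn(1)] B by (intro mult_mono) (auto simp: B_def)
        then show ?thesis using True by (simp add: a_def)
      next
        case False
        have "w n (fst p) * min 1 (exp (\<Delta> n p + T p)) \<le> w n (fst p) * exp (\<Delta> n p + T p)"
          using w_bounds(1)[of n M "fst p"] n0(3)[OF nn(1)] by (intro mult_left_mono) auto
        also have "\<dots> = exp (- \<phi> n ?y) * exp (T p)"
          by (simp add: w_def \<Delta>_def exp_add[symmetric])
        also have "\<dots> \<le> B * exp (T p)"
          using n0(3)[OF nn(1) stretch_in_Rn] by (intro mult_right_mono) (auto simp: B_def)
        also have "\<dots> = B * a p" using False by (simp add: a_def)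
        finally show ?thesis .
      qed
      then have "w n (fst p) * V p * min 1 (exp (\<Delta> n p + T p)) \<le> B * (V p * a p)"
        using mult_left_mono[of "w n (fst p) * min 1 (exp (\<Delta> n p + T p))" "B * a p" "V p"]
        by (simp add: V_def mult_ac)
      also have "\<dots> \<le> B * (d * (V p)\<^sup>2 + a p / (4 * d))"
        using weighted_product_bound[OF dp a01] B by (intro mult_left_mono) auto
      finally show ?thesis .
    qed
    have ir: "integrable (Q n) (\<lambda>p. B * (d * (V p)\<^sup>2 + a p / (4 * d)))"
      using iV2(1) ia by (intro integrable_mult_right Bochner_Integration.integrable_add integrable_divide) auto
    have iJ: "integrable (Q n) (\<lambda>p. w n (fst p) * V p * min 1 (exp (\<Delta> n p + T p)))"
    proof (rule Bochner_Integration.integrable_bound[OF ir])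
      have "0 \<le> w n (fst p) * V p * min 1 (exp (\<Delta> n p + T p))" for p by (auto simp: w_def V_def)
      then show "AE p in Q n. norm (w n (fst p) * V p * min 1 (exp (\<Delta> n p + T p))) \<le> norm (B * (d * (V p)\<^sup>2 + a p / (4 * d)))"
        using ptw by (intro AE_I2) (metis abs_of_nonneg order_trans real_norm_def)
    qed measurable
    have "J n = (\<integral>p. w n (fst p) * V p * min 1 (exp (\<Delta> n p + T p)) \<partial>Q n)"
      by (simp add: J_def V_def T_def)
    also have "\<dots> \<le> (\<integral>p. B * (d * (V p)\<^sup>2 + a p / (4 * d)) \<partial>Q n)"
      using iJ ir ptw by (intro integral_mono) auto
    also have "\<dots> = B * (d * (\<integral>p. (V p)\<^sup>2 \<partial>Q n) + (\<integral>p. a p \<partial>Q n) / (4 * d))"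
      using iV2(1) ia by simp
    also have "\<dots> \<le> B * (d * D + exp (- c * S) / (4 * d))"
      using iV2(2) a_int B dp by (intro mult_left_mono add_mono divide_right_mono) auto
    also have "exp (- c * S) = d * d" by (simp add: d_def exp_add[symmetric])
    also have "B * (d * D + d * d / (4 * d)) \<le> B * (D + 1) * d"
      using B dp by (simp add: field_simps)
    finally show ?thesis unfolding d_def S_def .
  qed
  then show thesis using that[of "c / 2" "B * (D + 1)" "max n0 n1"] c B D by auto
qed

end

section \<open>The three regimes of the step size\<close>

lemma std_normal_cdf_0: "2 * std_normal_cdf 0 = 1"
proof -
  interpret N: prob_space std_normal_distribution by (rule prob_space_normal_density) simp
  show ?thesis using gaussian_acceptance[of 0] N.prob_space by simp
qed

lemma I_exp_eq: "I_exp alg = 1 / real (lead_order alg)"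
  by (cases alg) (simp_all add: I_exp_def lead_order_def)

lemma I_exp_pos: "I_exp alg > 0"
  by (cases alg) (simp_all add: I_exp_def)

lemma stretched_exp_decay:
  fixes c \<theta> p :: real
  assumes "c > 0" "\<theta> > 0"
  shows "(\<lambda>n::nat. real n powr p * exp (- c * real n powr \<theta>)) \<longlonglongrightarrow> 0"
  using assms by real_asymp

context mh_chain begin

text \<open>Criticality is a (\<rho> - 2\<kappa>) = 1, so the power of n in \<open>sum_ec\<close>
  disappears and only the normalised power sum remains.\<close>

lemma sum_ec_critical:
  assumes "\<rho> = 2 * \<kappa> + I_exp alg"
  shows "(\<lambda>n. \<Sum>j\<in>{1..n}. ec n j ^ (2 * lead_order alg)) \<longlonglongrightarrow> l ^ (2 * lead_order alg) / (2 * lead_order alg * \<kappa> + 1)"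
proof -
  let ?a = "lead_order alg"
  have z: "1 - real ?a * (\<rho> - 2 * \<kappa>) = 0"
    using assms lead_order_pos[of alg] by (simp add: I_exp_eq)
  have "(\<lambda>n. l ^ (2 * ?a) * (real n powr (- (2 * ?a * \<kappa> + 1)) * (\<Sum>j\<in>{1..n}. real j powr (2 * ?a * \<kappa>)))) \<longlonglongrightarrow> l ^ (2 * ?a) * (1 / (2 * ?a * \<kappa> + 1))"
    using kappa by (intro tendsto_mult tendsto_const sum_powr_asymp) auto
  moreover have "\<forall>\<^sub>F n in sequentially. l ^ (2 * ?a) * (real n powr (- (2 * ?a * \<kappa> + 1)) * (\<Sum>j\<in>{1..n}. real j powr (2 * ?a * \<kappa>))) = (\<Sum>j\<in>{1..n}. ec n j ^ (2 * ?a))"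
    using eventually_ge_at_top[of 1] by eventually_elim (simp add: sum_ec z)
  ultimately have "(\<lambda>n. \<Sum>j\<in>{1..n}. ec n j ^ (2 * ?a)) \<longlonglongrightarrow> l ^ (2 * ?a) * (1 / (2 * ?a * \<kappa> + 1))"
    by (rule Lim_transform_eventually)
  then show ?thesis by simp
qed

lemma sum_ec_supercritical:
  assumes "\<rho> > 2 * \<kappa> + I_exp alg"
  shows "(\<lambda>n. \<Sum>j\<in>{1..n}. ec n j ^ (2 * lead_order alg)) \<longlonglongrightarrow> 0"
proof -
  let ?a = "lead_order alg"
  have "real ?a * (\<rho> - 2 * \<kappa>) > real ?a * I_exp alg"
    using assms lead_order_pos[of alg] by (intro mult_strict_left_mono) auto
  then have z: "1 - real ?a * (\<rho> - 2 * \<kappa>) < 0"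
    using lead_order_pos[of alg] by (simp add: I_exp_eq)
  have "(\<lambda>n. real n powr (1 - real ?a * (\<rho> - 2 * \<kappa>))) \<longlonglongrightarrow> 0"
    by (rule tendsto_neg_powr[OF z filterlim_real_sequentially])
  then have "(\<lambda>n. l ^ (2 * ?a) * real n powr (1 - real ?a * (\<rho> - 2 * \<kappa>)) * (real n powr (- (2 * ?a * \<kappa> + 1)) * (\<Sum>j\<in>{1..n}. real j powr (2 * ?a * \<kappa>)))) \<longlonglongrightarrow> l ^ (2 * ?a) * 0 * (1 / (2 * ?a * \<kappa> + 1))"
    using kappa by (intro tendsto_mult tendsto_const sum_powr_asymp) auto
  moreover have "\<forall>\<^sub>F n in sequentially. l ^ (2 * ?a) * real n powr (1 - real ?a * (\<rho> - 2 * \<kappa>)) * (real n powr (- (2 * ?a * \<kappa> + 1)) * (\<Sum>j\<in>{1..n}. real j powr (2 * ?a * \<kappa>))) = (\<Sum>j\<in>{1..n}. ec n j ^ (2 * ?a))"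
    using eventually_ge_at_top[of 1] by eventually_elim (simp add: sum_ec)
  ultimately have "(\<lambda>n. \<Sum>j\<in>{1..n}. ec n j ^ (2 * ?a)) \<longlonglongrightarrow> l ^ (2 * ?a) * 0 * (1 / (2 * ?a * \<kappa> + 1))"
    by (rule Lim_transform_eventually)
  then show ?thesis by simp
qed

lemma sum_ec_subcritical:
  assumes "\<rho> < 2 * \<kappa> + I_exp alg"
  obtains c \<theta> where "c > 0" "\<theta> > 0" "\<And>n. n \<ge> 1 \<Longrightarrow> c * real n powr \<theta> \<le> (\<Sum>j\<in>{1..n}. ec n j ^ (2 * lead_order alg))"
proof -
  let ?a = "lead_order alg"
  define c where "c = l ^ (2 * ?a) * (1 / (2 * ?a * \<kappa> + 1))"
  define \<theta> where "\<theta> = 1 - real ?a * (\<rho> - 2 * \<kappa>)"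
  have "real ?a * (\<rho> - 2 * \<kappa>) < real ?a * I_exp alg"
    using assms lead_order_pos[of alg] by (intro mult_strict_left_mono) auto
  then have \<theta>: "\<theta> > 0"
    using lead_order_pos[of alg] by (simp add: I_exp_eq \<theta>_def)
  have q: "real (2 * ?a) * \<kappa> \<ge> 0" using kappa by simp
  have "real (2 * ?a) * \<kappa> + 1 > 0" using kappa by (simp add: add_nonneg_pos)
  then have c: "c > 0" unfolding c_def using l by (intro mult_pos_pos zero_less_power divide_pos_pos) simp_all
  show thesis
  proof (rule that[OF c \<theta>])
    fix n :: nat assume n: "n \<ge> 1"
    let ?S = "\<Sum>j\<in>{1..n}. real j powr (2 * ?a * \<kappa>)"
    have "1 = real n powr (- (2 * ?a * \<kappa> + 1)) * real n powr (2 * ?a * \<kappa> + 1)"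
      using n unfolding powr_add[symmetric] by simp
    also have "\<dots> \<le> real n powr (- (2 * ?a * \<kappa> + 1)) * ((2 * ?a * \<kappa> + 1) * ?S)"
      by (intro mult_left_mono sum_powr_bounds(1) q powr_ge_zero)
    finally have "1 / (2 * ?a * \<kappa> + 1) \<le> real n powr (- (2 * ?a * \<kappa> + 1)) * ?S"
      using q by (simp add: field_simps)
    then have "l ^ (2 * ?a) * real n powr \<theta> * (1 / (2 * ?a * \<kappa> + 1)) \<le> l ^ (2 * ?a) * real n powr \<theta> * (real n powr (- (2 * ?a * \<kappa> + 1)) * ?S)"
      using l by (intro mult_left_mono) auto
    then show "c * real n powr \<theta> \<le> (\<Sum>j\<in>{1..n}. ec n j ^ (2 * ?a))"
      unfolding sum_ec[OF n] \<theta>_def[symmetric] by (simp add: c_def mult_ac)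
  qed
qed

text \<open>For a = 1 and a = 3 the square root yields l and l^3, and 2 a \<kappa> + 1 the
  denominators 1 + 2\<kappa> and 1 + 6\<kappa>.\<close>

lemma acc_limit_eq:
  "2 * std_normal_cdf (- (sqrt (Kc alg * (l ^ (2 * lead_order alg) / (2 * lead_order alg * \<kappa> + 1))) / 2)) = acc_limit alg f g \<kappa> l"
proof -
  have s: "sqrt (Kc alg * (l ^ (2 * a) / q)) / 2 = l ^ a / 2 * sqrt (Kc alg / q)" for a and q :: real
  proof -
    have "sqrt (l ^ (2 * a)) = l ^ a"
      by (rule real_sqrt_unique) (use l in \<open>simp_all add: power_mult[symmetric] mult.commute\<close>)
    then show ?thesis by (simp add: real_sqrt_mult real_sqrt_divide mult_ac)
  qed
  show ?thesis
    unfolding s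
    by (cases alg) (simp_all add: acc_limit_def lead_order_def Kc_RWM Kc_SLA add.commute)
qed

lemma sq_jump_asymp:
  assumes "J \<longlonglongrightarrow> a"
  shows "(\<lambda>n. sq_jump alg f g \<kappa> \<phi> \<sigma> i n - l\<^sup>2 * a * real n powr (-\<rho>)) \<in> o(\<lambda>n. real n powr (-\<rho>))"
proof (rule smalloI_tendsto)
  have "(\<lambda>n. l\<^sup>2 * (J n - a)) \<longlonglongrightarrow> l\<^sup>2 * (a - a)" by (intro tendsto_intros assms)
  then have "(\<lambda>n. l\<^sup>2 * (J n - a)) \<longlonglongrightarrow> 0" by simp
  moreover have "\<forall>\<^sub>F n in sequentially. l\<^sup>2 * (J n - a) = (sq_jump alg f g \<kappa> \<phi> \<sigma> i n - l\<^sup>2 * a * real n powr (-\<rho>)) / real n powr (-\<rho>)"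
    using eventually_ge_at_top[of i]
  proof eventually_elim
    case (elim n)
    then have "real n powr (-\<rho>) > 0" using i1 by simp
    then show ?case using elim by (simp add: sq_jump_J field_simps)
  qed
  ultimately show "(\<lambda>n. (sq_jump alg f g \<kappa> \<phi> \<sigma> i n - l\<^sup>2 * a * real n powr (-\<rho>)) / real n powr (-\<rho>)) \<longlonglongrightarrow> 0"
    by (rule Lim_transform_eventually)
  show "\<forall>\<^sub>F n in sequentially. real n powr (-\<rho>) \<noteq> 0"
    using eventually_gt_at_top[of 0] by eventually_elim simp
qed

text \<open>The sum in \<open>J_bound\<close> grows at least like a positive power of n, so J is
  bounded by a stretched exponential, which beats every power and absorbs the prefactor.\<close>

lemma sq_jump_subcritical:
  assumes "\<rho> < 2 * \<kappa> + I_exp alg"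
  shows "sq_jump alg f g \<kappa> \<phi> \<sigma> i \<in> O(\<lambda>n. real n powr (-p))"
proof -
  obtain c K n0 where c: "c > 0" "K \<ge> 0" "\<And>n. n \<ge> n0 \<Longrightarrow> J n \<le> K * exp (- c * (\<Sum>j\<in>{1..n}. ec n j ^ (2 * lead_order alg)))"
    by (rule J_bound) blast
  obtain c' \<theta> where c': "c' > 0" "\<theta> > 0" "\<And>n. n \<ge> 1 \<Longrightarrow> c' * real n powr \<theta> \<le> (\<Sum>j\<in>{1..n}. ec n j ^ (2 * lead_order alg))"
    by (rule sum_ec_subcritical[OF assms]) blast
  have "\<forall>\<^sub>F n in sequentially. real n powr (p - \<rho>) * exp (- (c * c') * real n powr \<theta>) < 1"
    using c(1) c'(1,2) by (intro order_tendstoD(2)[OF stretched_exp_decay]) auto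
  then have "\<forall>\<^sub>F n in sequentially. norm (sq_jump alg f g \<kappa> \<phi> \<sigma> i n) \<le> (l\<^sup>2 * K) * norm (real n powr (-p))"
    using eventually_ge_at_top[of "max n0 i"]
  proof eventually_elim
    case (elim n)
    then have n: "n \<ge> n0" "n \<ge> i" "n \<ge> 1" using i1 by auto
    have "J n \<le> K * exp (- c * (\<Sum>j\<in>{1..n}. ec n j ^ (2 * lead_order alg)))" by (rule c(3)[OF n(1)])
    also have "\<dots> \<le> K * exp (- (c * c') * real n powr \<theta>)"
      using c'(3)[OF n(3)] c(1,2) by (intro mult_left_mono) (auto simp: mult.assoc)
    finally have "real n powr (-\<rho>) * J n \<le> real n powr (-\<rho>) * (K * exp (- (c * c') * real n powr \<theta>))"
      by (intro mult_left_mono) auto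
    also have "\<dots> = K * (real n powr (-p) * (real n powr (p - \<rho>) * exp (- (c * c') * real n powr \<theta>)))"
      by (simp add: mult.assoc[symmetric] powr_add[symmetric])
    also have "\<dots> \<le> K * (real n powr (-p) * 1)"
      using elim(1) c(2) by (intro mult_left_mono) auto
    finally have "l\<^sup>2 * (real n powr (-\<rho>) * J n) \<le> l\<^sup>2 * (K * (real n powr (-p) * 1))"
      by (intro mult_left_mono) auto
    then show ?case using J_nonneg[of n] by (simp add: sq_jump_J[OF n(2)] mult.assoc)
  qed
  then show ?thesis by (rule bigoI)
qed

end

theorem theorem4:
  fixes alg :: algorithm
    and f g :: "real \<Rightarrow> real"
    and \<phi> :: "nat \<Rightarrow> (nat \<Rightarrow> real) \<Rightarrow> real"
    and \<sigma> :: "nat \<Rightarrow> real"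
    and \<kappa> l \<rho> :: real
    and istar :: nat
  assumes f_eq: "\<And>t. f t = exp (- g t)"
    and f_prob: "prob_space (density lborel (\<lambda>t. ennreal (f t)))"
    and g_smooth: "\<And>k t. (deriv ^^ k) g field_differentiable (at t)"
    and g_poly: "\<And>k. \<exists>P :: real poly. \<forall>t. \<bar>(deriv ^^ k) g t\<bar> \<le> poly P t"
    and f_moments: "\<And>k :: nat. integrable (density lborel (\<lambda>t. ennreal (f t))) (\<lambda>t. t ^ k)"
    and kappa: "\<kappa> \<ge> 0"
    and phi_meas: "\<And>n. n \<ge> 1 \<Longrightarrow> \<phi> n \<in> borel_measurable (PiM {1..n} (\<lambda>_. borel))"
    and target_prob: "\<And>n. n \<ge> 1 \<Longrightarrow> prob_space (target f \<kappa> \<phi> n)"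
    and l_rho: "l > 0" "\<rho> > 0"
    and sigma: "\<And>n. n \<ge> 1 \<Longrightarrow> \<sigma> n > 0 \<and> (\<sigma> n)\<^sup>2 = l\<^sup>2 * real n powr (-\<rho>)"
    and A: "\<exists>M. \<forall>\<^sub>F n in sequentially. \<forall>x\<in>Rn n. \<phi> n x \<ge> M"
    and B: "\<exists>(\<delta> :: real \<times> real \<Rightarrow> real) C p s s' s''.
              (\<forall>a\<ge>0. \<forall>b\<ge>0. \<delta> (a, b) \<ge> 0) \<and> locally_bounded_on ({0..} \<times> {0..}) \<delta> \<and>
              C > 0 \<and> p > 0 \<and> s < \<kappa> - 1/2 \<and> s' < \<kappa> - 1/2 \<and> s'' < \<kappa> - 1/2 \<and>
              (\<forall>\<^sub>F n in sequentially. \<forall>x\<in>Rn n. \<forall>y\<in>Rn n.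
                 \<bar>\<phi> n y - \<phi> n x\<bar> \<le> \<delta> (snorm n s x, snorm n s y) * snorm n s' (\<lambda>i\<in>{1..n}. y i - x i) \<and>
                 \<bar>\<phi> n x\<bar> \<le> C * (1 + snorm n s'' x powr p))"
    and istar: "istar \<ge> 1"
  shows "(\<rho> = 2 * \<kappa> + I_exp alg \<longrightarrow>
            (\<lambda>n. sq_jump alg f g \<kappa> \<phi> \<sigma> istar n
                   - l\<^sup>2 * acc_limit alg f g \<kappa> l * real n powr (- 2 * \<kappa> - I_exp alg))
              \<in> o(\<lambda>n. real n powr (- 2 * \<kappa> - I_exp alg))) \<and>
         (\<rho> > 2 * \<kappa> + I_exp alg \<longrightarrow>
            (\<lambda>n. sq_jump alg f g \<kappa> \<phi> \<sigma> istar n - l\<^sup>2 * real n powr (-\<rho>))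
              \<in> o(\<lambda>n. real n powr (-\<rho>))) \<and>
         (2 * \<kappa> < \<rho> \<and> \<rho> < 2 * \<kappa> + I_exp alg \<longrightarrow>
            (\<forall>p\<ge>0. sq_jump alg f g \<kappa> \<phi> \<sigma> istar \<in> O(\<lambda>n. real n powr (-p))))"
proof -
  have dens: "smooth_density f g"
    unfolding smooth_density_def using f_eq f_prob g_smooth g_poly f_moments by blast
  have chain: "mh_chain f g \<phi> \<sigma> \<kappa> l \<rho> istar" if "\<rho> > 2 * \<kappa>"
    unfolding mh_chain_def mh_chain_axioms_def
    using dens kappa phi_meas target_prob l_rho(1) that sigma A istar by blast
  \<comment> \<open>Shared by the critical and the supercritical regime, so that the witnesses of
    (B) are unpacked once.\<close>
  have vanish: "(\<lambda>n. \<integral>p. min 1 \<bar>mh_chain.\<Delta> g alg \<phi> \<sigma> \<kappa> n p\<bar> \<partial>(PiM {1..n} (\<lambda>_. density lborel (\<lambda>t. ennreal (f t))) \<Otimes>\<^sub>M PiM {1..n} (\<lambda>_. std_normal_distribution))) \<longlonglongrightarrow> 0"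
    if "\<rho> > 2 * \<kappa>"
  proof -
    interpret mh_chain f g alg \<phi> \<sigma> \<kappa> l \<rho> istar by (rule chain[OF that])
    obtain \<delta> :: "real \<times> real \<Rightarrow> real" and C p s s' s'' where d: "locally_bounded_on ({0..} \<times> {0..}) \<delta>"
      "s < \<kappa> - 1/2" "s' < \<kappa> - 1/2"
      "\<forall>\<^sub>F n in sequentially. \<forall>x\<in>Rn n. \<forall>y\<in>Rn n.
         \<bar>\<phi> n y - \<phi> n x\<bar> \<le> \<delta> (snorm n s x, snorm n s y) * snorm n s' (\<lambda>i\<in>{1..n}. y i - x i) \<and>
         \<bar>\<phi> n x\<bar> \<le> C * (1 + snorm n s'' x powr p)"
      using B by (elim exE conjE) rule
    have "\<forall>\<^sub>F n in sequentially. \<forall>x\<in>Rn n. \<forall>y\<in>Rn n.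
         \<bar>\<phi> n y - \<phi> n x\<bar> \<le> \<delta> (snorm n s x, snorm n s y) * snorm n s' (\<lambda>i\<in>{1..n}. y i - x i)"
      using d(4) by (rule eventually_mono) blast
    from Delta_vanishes[OF d(1-3) this] show ?thesis .
  qed
  show ?thesis
  proof (intro conjI impI allI)
    assume r: "\<rho> = 2 * \<kappa> + I_exp alg"
    then have r': "\<rho> > 2 * \<kappa>" using I_exp_pos[of alg] by simp
    interpret mh_chain f g alg \<phi> \<sigma> \<kappa> l \<rho> istar by (rule chain[OF r'])
    have e: "- 2 * \<kappa> - I_exp alg = - \<rho>" using r by simp
    show "(\<lambda>n. sq_jump alg f g \<kappa> \<phi> \<sigma> istar n - l\<^sup>2 * acc_limit alg f g \<kappa> l * real n powr (- 2 * \<kappa> - I_exp alg))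
        \<in> o(\<lambda>n. real n powr (- 2 * \<kappa> - I_exp alg))"
      unfolding e
      by (rule sq_jump_asymp[OF J_limit[OF vanish[OF r'] sum_ec_critical[OF r], unfolded acc_limit_eq]])
  next
    assume r: "\<rho> > 2 * \<kappa> + I_exp alg"
    then have r': "\<rho> > 2 * \<kappa>" using I_exp_pos[of alg] by simp
    interpret mh_chain f g alg \<phi> \<sigma> \<kappa> l \<rho> istar by (rule chain[OF r'])
    \<comment> \<open>The limit L = 0 gives 2 \<Phi>(0) = 1: asymptotically every proposal is
      accepted.\<close>
    have "J \<longlonglongrightarrow> 1"
      using J_limit[OF vanish[OF r'] sum_ec_supercritical[OF r]] by (simp add: std_normal_cdf_0)
    from sq_jump_asymp[OF this]
    show "(\<lambda>n. sq_jump alg f g \<kappa> \<phi> \<sigma> istar n - l\<^sup>2 * real n powr (-\<rho>)) \<in> o(\<lambda>n. real n powr (-\<rho>))" by simp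
  next
    fix p assume r: "2 * \<kappa> < \<rho> \<and> \<rho> < 2 * \<kappa> + I_exp alg"
    interpret mh_chain f g alg \<phi> \<sigma> \<kappa> l \<rho> istar by (rule chain) (use r in simp)
    show "sq_jump alg f g \<kappa> \<phi> \<sigma> istar \<in> O(\<lambda>n. real n powr (-p))"
      by (rule sq_jump_subcritical) (use r in simp)
  qed
qed

end
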